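(* Let $(M,g)$ be a closed Riemannian manifold. Then there exist $r\in(0,1)$ and $C>0$ such that if $f\in\mathrm{Diff}^2(M)$ satisfies (1) there exists $x\in M$ such that $f(x)=x$ and $\|D_xf-\mathrm{Id}\|=\theta<r$, (2) $\|f^*g-g\|=\eta<r$, and (3) $d_{C^2}(f,\mathrm{Id})=\kappa<r$, then for all $\gamma\in(0,r)$, $$d_{C^0}(f,\mathrm{Id})\le C(\theta+\kappa\gamma+\eta\gamma^{-1}).$$
   Context: Closed manifolds are compact, connected and without boundary. $d_{C^k}$ is a fixed standard distance inducing the $C^k$ topology on $C^k$ maps $M\to M$ (e.g. the $C^k$ norm of the difference after embedding $M$ in some $\mathbb{R}^N$). For a continuous tensor field $T$, $\|T\|=\max_{x\in M}\|T(x)\|$, where $\|T(x)\|$ is the Hilbert–Schmidt norm on tensors over the inner product space $T_xM$ (tensor products of orthonormal basis vectors are orthonormal). *)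

theory Defs
  imports "HOL-Analysis.Analysis"
begin

section \<open>Maps of class \<open>C\<^sup>k\<close> between Euclidean spaces\<close>

text \<open>Only meant for open sets \<open>S\<close>.\<close>

primrec Ck_on :: "nat \<Rightarrow> 'a::euclidean_space set \<Rightarrow> ('a \<Rightarrow> 'b::euclidean_space) \<Rightarrow> bool" where
  "Ck_on 0 S h \<longleftrightarrow> continuous_on S h"
| "Ck_on (Suc k) S h \<longleftrightarrow>
     (\<forall>p\<in>S. h differentiable (at p)) \<and>
     (\<forall>v. Ck_on k S (\<lambda>p. frechet_derivative h (at p) v))"

definition smooth_on :: "'a::euclidean_space set \<Rightarrow> ('a \<Rightarrow> 'b::euclidean_space) \<Rightarrow> bool" where
  "smooth_on S h \<longleftrightarrow> (\<forall>k. Ck_on k S h)"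

primrec iter_deriv ::
    "'a::euclidean_space list \<Rightarrow> ('a \<Rightarrow> 'b::euclidean_space) \<Rightarrow> 'a \<Rightarrow> 'b" where
  "iter_deriv [] h = h"
| "iter_deriv (v # vs) h = iter_deriv vs (\<lambda>p. frechet_derivative h (at p) v)"


section \<open>Closed manifolds\<close>

text \<open>
  A chart is a pair of its domain and its coordinate map; values of the coordinate map outside
  the domain carry no information. The underlying space of a manifold is a subset \<open>M\<close> of a
  Hausdorff type, with the subspace topology. Chart images are open in the model space, so there
  is no boundary; second countability follows from compactness.
\<close>

type_synonym ('m, 'n) chart = "'m set \<times> ('m \<Rightarrow> 'n)"

abbreviation chart_dom :: "('m, 'n) chart \<Rightarrow> 'm set" where
  "chart_dom c \<equiv> fst c"

abbreviation chart_map :: "('m, 'n) chart \<Rightarrow> 'm \<Rightarrow> 'n" where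
  "chart_map c \<equiv> snd c"

definition chart_inv :: "('m, 'n) chart \<Rightarrow> 'n \<Rightarrow> 'm" where
  "chart_inv c = inv_into (chart_dom c) (chart_map c)"

definition chart_on :: "'m::t2_space set \<Rightarrow> ('m, 'n::euclidean_space) chart \<Rightarrow> bool" where
  "chart_on M c \<longleftrightarrow>
     openin (top_of_set M) (chart_dom c) \<and>
     open (chart_map c ` chart_dom c) \<and>
     homeomorphism (chart_dom c) (chart_map c ` chart_dom c) (chart_map c) (chart_inv c)"

definition transition :: "('m, 'n) chart \<Rightarrow> ('m, 'n) chart \<Rightarrow> 'n \<Rightarrow> 'n" where
  "transition c d = chart_map d \<circ> chart_inv c"

definition smooth_atlas :: "'m::t2_space set \<Rightarrow> ('m, 'n::euclidean_space) chart set \<Rightarrow> bool" where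
  "smooth_atlas M A \<longleftrightarrow>
     (\<forall>c\<in>A. chart_on M c) \<and>
     (\<Union>c\<in>A. chart_dom c) = M \<and>
     (\<forall>c\<in>A. \<forall>d\<in>A. smooth_on (chart_map c ` (chart_dom c \<inter> chart_dom d)) (transition c d))"

definition closed_manifold :: "'m::t2_space set \<Rightarrow> ('m, 'n::euclidean_space) chart set \<Rightarrow> bool" where
  "closed_manifold M A \<longleftrightarrow> smooth_atlas M A \<and> compact M \<and> connected M"


section \<open>Maps of class \<open>C\<^sup>k\<close> and diffeomorphisms\<close>

text \<open>Self-maps of \<open>M\<close> are total functions of which only the restriction to \<open>M\<close> matters.\<close>

definition Ck_self_map ::
    "nat \<Rightarrow> 'm::t2_space set \<Rightarrow> ('m, 'n::euclidean_space) chart set \<Rightarrow> ('m \<Rightarrow> 'm) \<Rightarrow> bool" where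
  "Ck_self_map k M A f \<longleftrightarrow>
     f ` M \<subseteq> M \<and> continuous_on M f \<and>
     (\<forall>c\<in>A. \<forall>d\<in>A. Ck_on k (chart_map c ` (chart_dom c \<inter> f -` chart_dom d))
                        (chart_map d \<circ> f \<circ> chart_inv c))"

definition Diff ::
    "nat \<Rightarrow> 'm::t2_space set \<Rightarrow> ('m, 'n::euclidean_space) chart set \<Rightarrow> ('m \<Rightarrow> 'm) set" where
  "Diff k M A = {f. bij_betw f M M \<and> Ck_self_map k M A f \<and> Ck_self_map k M A (inv_into M f)}"


section \<open>Tangent spaces and Riemannian metrics\<close>

text \<open>
  A tangent vector at \<open>x\<close> is the family of its coordinate representations in the charts around
  \<open>x\<close>, related by the derivatives of the transition maps. The value at any other argument is
  set to \<open>0\<close> so that equality of tangent vectors is equality of functions.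
\<close>

type_synonym ('m, 'n) tvec = "('m, 'n) chart \<Rightarrow> 'n"

definition tangent_space ::
    "('m, 'n::euclidean_space) chart set \<Rightarrow> 'm \<Rightarrow> ('m, 'n) tvec set" where
  "tangent_space A x =
     {v. (\<forall>c\<in>A. \<forall>d\<in>A. x \<in> chart_dom c \<and> x \<in> chart_dom d \<longrightarrow>
            v d = frechet_derivative (transition c d) (at (chart_map c x)) (v c)) \<and>
         (\<forall>c. c \<notin> A \<or> x \<notin> chart_dom c \<longrightarrow> v c = 0)}"

text \<open>The tangent vector at \<open>x\<close> whose representation in the chart \<open>c\<close> is \<open>w\<close>.\<close>

definition coord_vec ::
    "('m, 'n::euclidean_space) chart set \<Rightarrow> ('m, 'n) chart \<Rightarrow> 'm \<Rightarrow> 'n \<Rightarrow> ('m, 'n) tvec" where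
  "coord_vec A c x w =
     (\<lambda>d. if d \<in> A \<and> x \<in> chart_dom d
          then frechet_derivative (transition c d) (at (chart_map c x)) w else 0)"

type_synonym ('m, 'n) form_field = "'m \<Rightarrow> ('m, 'n) tvec \<Rightarrow> ('m, 'n) tvec \<Rightarrow> real"

definition riemannian_metric ::
    "'m::t2_space set \<Rightarrow> ('m, 'n::euclidean_space) chart set \<Rightarrow> ('m, 'n) form_field \<Rightarrow> bool" where
  "riemannian_metric M A g \<longleftrightarrow>
     (\<forall>x\<in>M. \<forall>u\<in>tangent_space A x. \<forall>v\<in>tangent_space A x.
        g x u v = g x v u \<and>
        (\<forall>w\<in>tangent_space A x. \<forall>a b.
           g x (\<lambda>c. a *\<^sub>R u c + b *\<^sub>R v c) w = a * g x u w + b * g x v w) \<and>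
        (u \<noteq> (\<lambda>_. 0) \<longrightarrow> g x u u > 0)) \<and>
     (\<forall>c\<in>A. \<forall>u v. smooth_on (chart_map c ` chart_dom c)
        (\<lambda>p. g (chart_inv c p) (coord_vec A c (chart_inv c p) u) (coord_vec A c (chart_inv c p) v)))"

text \<open>By the chain rule the choice of the chart around \<open>x\<close> is immaterial for tangent vectors \<open>v\<close>.\<close>

definition differential ::
    "('m, 'n::euclidean_space) chart set \<Rightarrow> ('m \<Rightarrow> 'm) \<Rightarrow> 'm \<Rightarrow> ('m, 'n) tvec \<Rightarrow> ('m, 'n) tvec" where
  "differential A f x v =
     (let c = (SOME c. c \<in> A \<and> x \<in> chart_dom c)
      in (\<lambda>d. if d \<in> A \<and> f x \<in> chart_dom d
              then frechet_derivative (chart_map d \<circ> f \<circ> chart_inv c) (at (chart_map c x)) (v c)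
              else 0))"

definition pullback ::
    "('m, 'n::euclidean_space) chart set \<Rightarrow> ('m \<Rightarrow> 'm) \<Rightarrow> ('m, 'n) form_field \<Rightarrow> ('m, 'n) form_field" where
  "pullback A f g = (\<lambda>x u v. g (f x) (differential A f x u) (differential A f x v))"


section \<open>Hilbert--Schmidt norms\<close>

text \<open>
  An orthonormal basis of the tangent space at \<open>x\<close>, indexed by the standard basis of the model
  space. It spans because it consists of \<open>DIM('n)\<close> independent vectors.
\<close>

definition orthonormal_frame ::
    "('m, 'n::euclidean_space) chart set \<Rightarrow> ('m, 'n) form_field \<Rightarrow> 'm \<Rightarrow> ('n \<Rightarrow> ('m, 'n) tvec) \<Rightarrow> bool"
  where
  "orthonormal_frame A g x E \<longleftrightarrow>
     (\<forall>i\<in>Basis. E i \<in> tangent_space A x) \<and>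
     (\<forall>i\<in>Basis. \<forall>j\<in>Basis. g x (E i) (E j) = (if i = j then 1 else 0))"

text \<open>The norms below do not depend on the orthonormal basis that is chosen.\<close>

definition some_frame ::
    "('m, 'n::euclidean_space) chart set \<Rightarrow> ('m, 'n) form_field \<Rightarrow> 'm \<Rightarrow> 'n \<Rightarrow> ('m, 'n) tvec" where
  "some_frame A g x = (SOME E. orthonormal_frame A g x E)"

definition hs_norm_form ::
    "('m, 'n::euclidean_space) chart set \<Rightarrow> ('m, 'n) form_field \<Rightarrow> 'm \<Rightarrow>
     (('m, 'n) tvec \<Rightarrow> ('m, 'n) tvec \<Rightarrow> real) \<Rightarrow> real" where
  "hs_norm_form A g x T =
     sqrt (\<Sum>i\<in>Basis. \<Sum>j\<in>Basis. (T (some_frame A g x i) (some_frame A g x j))\<^sup>2)"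

text \<open>
  An endomorphism \<open>L\<close> of the tangent space is a tensor whose coefficients with respect to the
  orthonormal basis \<open>E\<close> and its dual are the numbers \<open>g x (L (E i)) (E j)\<close>.
\<close>

definition hs_norm_endo ::
    "('m, 'n::euclidean_space) chart set \<Rightarrow> ('m, 'n) form_field \<Rightarrow> 'm \<Rightarrow>
     (('m, 'n) tvec \<Rightarrow> ('m, 'n) tvec) \<Rightarrow> real" where
  "hs_norm_endo A g x L = hs_norm_form A g x (\<lambda>u v. g x (L u) v)"

definition field_norm ::
    "'m set \<Rightarrow> ('m, 'n::euclidean_space) chart set \<Rightarrow> ('m, 'n) form_field \<Rightarrow> ('m, 'n) form_field \<Rightarrow> real"
  where
  "field_norm M A g T = (SUP x\<in>M. hs_norm_form A g x (T x))"


section \<open>The \<open>C\<^sup>k\<close> distance\<close>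

text \<open>
  The distance is the \<open>C\<^sup>k\<close> norm of the difference after embedding \<open>M\<close> in a Euclidean space.
  The norm of a vector valued function is measured by the partial derivatives of order at most
  \<open>k\<close> in finitely many charts, over compact pieces of their domains that cover \<open>M\<close>. Different
  embeddings and different covers yield Lipschitz equivalent distances.
\<close>

definition smooth_embedding ::
    "'m set \<Rightarrow> ('m, 'n::euclidean_space) chart set \<Rightarrow> ('m \<Rightarrow> 'e::euclidean_space) \<Rightarrow> bool" where
  "smooth_embedding M A \<iota> \<longleftrightarrow>
     inj_on \<iota> M \<and>
     (\<forall>c\<in>A. smooth_on (chart_map c ` chart_dom c) (\<iota> \<circ> chart_inv c)) \<and>
     (\<forall>c\<in>A. \<forall>x\<in>chart_dom c. inj (frechet_derivative (\<iota> \<circ> chart_inv c) (at (chart_map c x))))"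

definition compact_chart_cover ::
    "'m::t2_space set \<Rightarrow> ('m, 'n::euclidean_space) chart set \<Rightarrow> (('m, 'n) chart \<times> 'm set) set \<Rightarrow> bool"
  where
  "compact_chart_cover M A F \<longleftrightarrow>
     finite F \<and> (\<forall>(c, K)\<in>F. c \<in> A \<and> compact K \<and> K \<subseteq> chart_dom c) \<and> (\<Union>(c, K)\<in>F. K) = M"

definition Ck_norm ::
    "nat \<Rightarrow> (('m, 'n::euclidean_space) chart \<times> 'm set) set \<Rightarrow> ('m \<Rightarrow> 'e::euclidean_space) \<Rightarrow> real" where
  "Ck_norm k F h =
     Sup {norm (iter_deriv bs (h \<circ> chart_inv c) (chart_map c x)) | bs c K x.
            (c, K) \<in> F \<and> x \<in> K \<and> set bs \<subseteq> Basis \<and> length bs \<le> k}"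

definition Ck_dist ::
    "nat \<Rightarrow> (('m, 'n::euclidean_space) chart \<times> 'm set) set \<Rightarrow> ('m \<Rightarrow> 'e::euclidean_space) \<Rightarrow>
     ('m \<Rightarrow> 'm) \<Rightarrow> ('m \<Rightarrow> 'm) \<Rightarrow> real" where
  "Ck_dist k F \<iota> f h = Ck_norm k F (\<lambda>x. \<iota> (f x) - \<iota> (h x))"

end

theory Submission
  imports Defs
begin

text \<open>
  No geodesics are used: the estimate is proved in charts. Write \<open>f = id + h\<close> and \<open>u = Dh\<close> in a chart, with
  \<open>h\<close> and \<open>u\<close> bounded by \<open>W\<close> and \<open>u\<close> Lipschitz with constant of order \<open>\<kappa>\<close>. Comparing \<open>f\<^sup>*g - g\<close> at two points
  at distance of order \<open>\<gamma>\<close> shows that \<open>g p d (u z d - u p d)\<close> is \<open>O((\<eta> + W \<gamma>) \<bar>d\<bar>\<^sup>2)\<close>; integrating along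
  segments, \<open>h - u p\<close> is almost antisymmetric at scale \<open>\<gamma>\<close>, like an infinitesimal isometry, and hence
  its second differences are \<open>O(\<eta> \<gamma> + W \<gamma>\<^sup>2)\<close>. Adding up second differences along a segment, the
  oscillation of \<open>u\<close> over a ball of radius \<open>\<rho>\<close> is \<open>O(\<kappa> \<gamma> + \<eta> / \<gamma> + \<rho> W)\<close>. For small \<open>\<rho>\<close> the last term is
  absorbed, so the size of \<open>h\<close> and \<open>u\<close> at one point of the ball controls their size at every other
  point up to \<open>\<kappa> \<gamma> + \<eta> / \<gamma>\<close>. At the fixed point this size is \<open>O(\<theta>)\<close>, and connectedness and compactness of
  \<open>M\<close> propagate the estimate.
\<close>

text \<open>The count of scales: a segment of length of order \<rho> has about \<rho> / \<gamma>
  steps of length \<gamma>, each contributing a second difference of order \<eta> \<gamma> + W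
  \<gamma>^2. Reading off derivatives from difference quotients divides by \<gamma> and costs
  \<kappa> \<gamma> at the two ends, which leaves \<kappa> \<gamma> + \<rho> (\<eta> / \<gamma> +
  W). The obstacle is W. It does not decay with \<gamma>, and its only a priori bound is of order
  \<kappa>, which would leave a \<kappa> without the factor \<gamma>. Hence the chart estimate is
  stated for every W that bounds \<open>h\<close> and \<open>u\<close>, so that it can be fed back
  into itself once \<rho> is small. A second obstacle is that \<kappa> and the conclusion are
  measured after \<iota> and in the charts of \<open>F\<close>. This requires a translation in both
  directions between \<open>h\<close> and the ambient displacement, with all bounds linear in
  \<kappa>. All radii and constants are chosen before \<open>f\<close> and \<gamma>.\<close>

abbreviation fderiv ::
    "('a::real_normed_vector \<Rightarrow> 'b::real_normed_vector) \<Rightarrow> 'a \<Rightarrow> 'a \<Rightarrow> 'b" where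
  "fderiv f p \<equiv> frechet_derivative f (at p)"

section \<open>Calculus of \<open>C\<^sup>k\<close> maps\<close>

lemma frechet_derivative_cong_open:
  assumes "open S" "p \<in> S" "\<And>q. q \<in> S \<Longrightarrow> f q = g q"
  shows "fderiv f p = fderiv g p"
proof -
  have "(f has_derivative d) (at p) \<longleftrightarrow> (g has_derivative d) (at p)" for d
    using assms has_derivative_transform_within_open[of f d p UNIV S g]
      has_derivative_transform_within_open[of g d p UNIV S f] by auto
  then show ?thesis
    unfolding frechet_derivative_def by simp
qed

lemma differentiable_cong_open:
  assumes "open S" "p \<in> S" "\<And>q. q \<in> S \<Longrightarrow> f q = g q" "f differentiable (at p)"
  shows "g differentiable (at p)"
  using assms has_derivative_transform_within_open[of f _ p UNIV S g]
  unfolding differentiable_def by blast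

lemma has_fderiv:
  "f differentiable (at p) \<Longrightarrow> (f has_derivative fderiv f p) (at p)"
  by (simp add: frechet_derivative_works)

lemma Ck_on_cong:
  assumes "open S" "\<And>p. p \<in> S \<Longrightarrow> f p = g p"
  shows "Ck_on k S f \<longleftrightarrow> Ck_on k S g"
  using assms(2)
proof (induction k arbitrary: f g)
  case 0
  then show ?case by (simp cong: continuous_on_cong)
next
  case (Suc k)
  have "Ck_on k S (\<lambda>p. fderiv f p v) \<longleftrightarrow>
      Ck_on k S (\<lambda>p. fderiv g p v)" for v
    using Suc.prems frechet_derivative_cong_open[OF assms(1), of _ f g] by (intro Suc.IH) auto
  moreover have "f differentiable (at p) \<longleftrightarrow> g differentiable (at p)" if "p \<in> S" for p
    using differentiable_cong_open[OF assms(1) that, of f g]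
      differentiable_cong_open[OF assms(1) that, of g f] Suc.prems by auto
  ultimately show ?case by simp
qed

lemma Ck_on_Suc_imp: "Ck_on (Suc k) S h \<Longrightarrow> Ck_on k S h"
proof (induction k arbitrary: h)
  case 0
  then show ?case
    by (auto intro!: continuous_at_imp_continuous_on differentiable_imp_continuous_within)
next
  case (Suc k)
  then show ?case by (metis Ck_on.simps(2))
qed

lemma Ck_on_mono: "Ck_on k S h \<Longrightarrow> j \<le> k \<Longrightarrow> Ck_on j S h"
  by (induction k) (auto simp: le_Suc_eq simp del: Ck_on.simps(2) dest: Ck_on_Suc_imp)

lemma Ck_on_subset: "Ck_on k S h \<Longrightarrow> T \<subseteq> S \<Longrightarrow> Ck_on k T h"
  by (induction k arbitrary: h) (auto intro: continuous_on_subset)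

text \<open>Needed for maps such as \<open>\<iota> \<circ> f\<close> read in a chart: near each
  point they factor through a chart around the image point, and that chart changes with the
  point.\<close>

lemma Ck_on_local:
  assumes "\<And>p. p \<in> S \<Longrightarrow> \<exists>T. open T \<and> p \<in> T \<and> Ck_on k T h"
  shows "Ck_on k S h"
  using assms
proof (induction k arbitrary: h)
  case 0
  show ?case
  proof (simp, intro continuous_at_imp_continuous_on ballI)
    fix p assume "p \<in> S"
    then obtain T where "open T" "p \<in> T" "continuous_on T h"
      using 0 by force
    then show "isCont h p"
      by (simp add: continuous_on_eq_continuous_at)
  qed
next
  case (Suc k)
  have "Ck_on k S (\<lambda>p. fderiv h p v)" for v
    using Suc.prems by (intro Suc.IH) (metis Ck_on.simps(2))
  then show ?case
    using Suc.prems by (metis Ck_on.simps(2))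
qed

lemma Ck_on_differentiable: "Ck_on (Suc k) S h \<Longrightarrow> p \<in> S \<Longrightarrow> h differentiable (at p)"
  by simp

lemma Ck_on_derivative: "Ck_on (Suc k) S h \<Longrightarrow> Ck_on k S (\<lambda>p. fderiv h p v)"
  by simp

lemma Ck_on_const: "Ck_on k S (\<lambda>p. c)"
  by (induction k arbitrary: c) auto

lemma Ck_on_add:
  assumes "open S" "Ck_on k S f" "Ck_on k S g"
  shows "Ck_on k S (\<lambda>p. f p + g p)"
  using assms(2,3)
proof (induction k arbitrary: f g)
  case 0
  then show ?case by (auto intro: continuous_intros)
next
  case (Suc k)
  have *: "((\<lambda>p. f p + g p) has_derivative
      (\<lambda>v. fderiv f p v + fderiv g p v)) (at p)" if "p \<in> S" for p
    using Suc.prems that by (intro has_derivative_add has_fderiv) auto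
  have "Ck_on k S (\<lambda>p. fderiv f p v + fderiv g p v)" for v
    using Suc.prems by (intro Suc.IH) auto
  then have "Ck_on k S (\<lambda>p. fderiv (\<lambda>p. f p + g p) p v)" for v
    by (subst Ck_on_cong[OF assms(1)]) (auto simp: frechet_derivative_at[OF *, symmetric])
  then show ?case
    using * by (auto simp: differentiable_def)
qed

lemma Ck_on_sum:
  assumes "open S" "\<And>i. i \<in> I \<Longrightarrow> Ck_on k S (f i)"
  shows "Ck_on k S (\<lambda>p. \<Sum>i\<in>I. f i p)"
  using assms(2) by (induction I rule: infinite_finite_induct) (auto intro: Ck_on_const Ck_on_add assms(1))

lemma Ck_on_bounded_linear:
  assumes "open S" "bounded_linear l" "Ck_on k S f"
  shows "Ck_on k S (\<lambda>p. l (f p))"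
  using assms(3)
proof (induction k arbitrary: f)
  case 0
  then show ?case using assms(2) by (auto intro: bounded_linear.continuous_on)
next
  case (Suc k)
  have *: "((\<lambda>p. l (f p)) has_derivative (\<lambda>v. l (fderiv f p v))) (at p)"
    if "p \<in> S" for p
    using Suc.prems that by (intro bounded_linear.has_derivative[OF assms(2)] has_fderiv) auto
  have "Ck_on k S (\<lambda>p. l (fderiv f p v))" for v
    using Suc.prems by (intro Suc.IH) auto
  then have "Ck_on k S (\<lambda>p. fderiv (\<lambda>p. l (f p)) p v)" for v
    by (subst Ck_on_cong[OF assms(1)]) (auto simp: frechet_derivative_at[OF *, symmetric])
  then show ?case
    using * by (auto simp: differentiable_def)
qed

lemma Ck_on_scaleR:
  fixes f :: "'a::euclidean_space \<Rightarrow> real"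
  assumes "open S" "Ck_on k S f" "Ck_on k S g"
  shows "Ck_on k S (\<lambda>p. f p *\<^sub>R g p)"
  using assms(2,3)
proof (induction k arbitrary: f g)
  case 0
  then show ?case by (auto intro: continuous_intros)
next
  case (Suc k)
  have *: "((\<lambda>p. f p *\<^sub>R g p) has_derivative
      (\<lambda>v. f p *\<^sub>R fderiv g p v + fderiv f p v *\<^sub>R g p)) (at p)"
    if "p \<in> S" for p
    using Suc.prems that by (intro has_derivative_scaleR has_fderiv) auto
  have "Ck_on k S (\<lambda>p. f p *\<^sub>R fderiv g p v + fderiv f p v *\<^sub>R g p)" for v
    using Suc.prems by (intro Ck_on_add assms(1) Suc.IH) (auto intro: Ck_on_Suc_imp simp del: Ck_on.simps intro: Ck_on_derivative)
  then have "Ck_on k S (\<lambda>p. fderiv (\<lambda>p. f p *\<^sub>R g p) p v)" for v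
    by (subst Ck_on_cong[OF assms(1)]) (auto simp: frechet_derivative_at[OF *, symmetric])
  then show ?case
    using * by (auto simp: differentiable_def)
qed

lemma Ck_on_inner_right: "open S \<Longrightarrow> Ck_on k S f \<Longrightarrow> Ck_on k S (\<lambda>p. f p \<bullet> b)"
  using Ck_on_bounded_linear[OF _ bounded_linear_inner_left] .

lemma linear_Basis_expansion:
  fixes l :: "'a::euclidean_space \<Rightarrow> 'b::real_vector"
  assumes "linear l"
  shows "l v = (\<Sum>b\<in>Basis. (v \<bullet> b) *\<^sub>R l b)"
proof -
  have "l v = l (\<Sum>b\<in>Basis. (v \<bullet> b) *\<^sub>R b)"
    by (simp add: euclidean_representation)
  also have "\<dots> = (\<Sum>b\<in>Basis. (v \<bullet> b) *\<^sub>R l b)"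
    by (simp add: linear_sum[OF assms] linear_scale[OF assms])
  finally show ?thesis .
qed

lemma Ck_on_compose:
  assumes "open S" "open T" "f ` S \<subseteq> T" "Ck_on k S f" "Ck_on k T g"
  shows "Ck_on k S (\<lambda>p. g (f p))"
  using assms(4,5)
proof (induction k arbitrary: g)
  case 0
  then show ?case using assms(3) by (auto intro: continuous_on_compose2)
next
  case (Suc k)
  have *: "((\<lambda>p. g (f p)) has_derivative
      (\<lambda>v. fderiv g (f p) (fderiv f p v))) (at p)" if "p \<in> S" for p
  proof -
    have "f p \<in> T" using that assms(3) by auto
    then show ?thesis
      using Suc.prems that
      by (intro has_derivative_compose[where f=f and g=g] has_fderiv) auto
  qed
  \<comment> \<open>The chain rule differentiates \<open>g\<close> in the direction
    \<open>fderiv f p v\<close>, which moves with \<open>p\<close>, while \<open>Ck_on\<close>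
    speaks of fixed directions. Expanding the direction in the basis leaves products of scalar
    functions with fixed-direction derivatives, and the induction hypothesis applies to
    these.\<close>
  have eq: "fderiv (\<lambda>p. g (f p)) p v =
      (\<Sum>b\<in>Basis. (fderiv f p v \<bullet> b) *\<^sub>R fderiv g (f p) b)"
    if "p \<in> S" for p v
  proof -
    have "f p \<in> T" using that assms(3) by auto
    then show ?thesis using Suc.prems
      by (subst frechet_derivative_at[OF *[OF that], symmetric], subst linear_Basis_expansion)
        (auto intro: linear_frechet_derivative)
  qed
  have "Ck_on k S (\<lambda>p. \<Sum>b\<in>Basis. (fderiv f p v \<bullet> b) *\<^sub>R
      fderiv g (f p) b)" for v
    using Suc.prems
    by (intro Ck_on_sum Ck_on_scaleR Ck_on_inner_right assms(1) Suc.IH)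
      (auto simp del: Ck_on.simps intro: Ck_on_derivative Ck_on_Suc_imp)
  then have "Ck_on k S (\<lambda>p. fderiv (\<lambda>p. g (f p)) p v)" for v
    by (subst Ck_on_cong[OF assms(1)]) (auto simp: eq)
  then show ?case
    using * by (auto simp: differentiable_def)
qed

lemma Ck_on_iter_deriv_continuous:
  "Ck_on k S h \<Longrightarrow> length bs \<le> k \<Longrightarrow> continuous_on S (iter_deriv bs h)"
proof (induction bs arbitrary: h k)
  case Nil
  then show ?case using Ck_on_mono[of k S h 0] by simp
next
  case (Cons b bs)
  then obtain j where "k = Suc j" by (cases k) auto
  with Cons show ?case by auto
qed

section \<open>Uniform derivative and Lipschitz bounds on balls\<close>

lemma has_derivative_bound:
  fixes f :: "'a::euclidean_space \<Rightarrow> 'b::euclidean_space"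
  assumes "convex S" "\<And>p. p \<in> S \<Longrightarrow> (f has_derivative f' p) (at p)"
    and "\<And>p v. p \<in> S \<Longrightarrow> norm (f' p v) \<le> B * norm v" "p \<in> S" "q \<in> S"
  shows "norm (f p - f q) \<le> B * norm (p - q)"
  by (rule differentiable_bound[OF assms(1) has_derivative_at_withinI[OF assms(2)]
        onorm_le[OF assms(3)] assms(4,5)])

text \<open>\<open>Ck_norm\<close> sees only derivatives in basis directions; this passes to all
  directions and is one source of the dimension factors in later constants.\<close>

lemma linear_norm_le_Basis:
  fixes l :: "'a::euclidean_space \<Rightarrow> 'b::real_normed_vector" and B :: real
  assumes "linear l" "\<And>b. b \<in> Basis \<Longrightarrow> norm (l b) \<le> B"
  shows "norm (l v) \<le> DIM('a) * B * norm v"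
proof -
  have "norm (l v) \<le> (\<Sum>b\<in>Basis. norm ((v \<bullet> b) *\<^sub>R l b))"
    by (subst linear_Basis_expansion[OF assms(1)]) (rule norm_sum)
  also have "\<dots> \<le> (\<Sum>b\<in>(Basis::'a set). norm v * B)"
    using assms(2) by (intro sum_mono) (auto intro!: mult_mono Basis_le_norm)
  finally show ?thesis by (simp add: mult_ac)
qed

lemma compact_bound_family:
  fixes F :: "'i \<Rightarrow> 'a::euclidean_space \<Rightarrow> 'b::real_normed_vector"
  assumes "finite I" "compact K" "\<And>i. i \<in> I \<Longrightarrow> continuous_on K (F i)"
  shows "\<exists>L. 0 < L \<and> (\<forall>i\<in>I. \<forall>p\<in>K. norm (F i p) \<le> L)"
  using assms(1,3)
proof (induction I rule: finite_induct)
  case empty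
  then show ?case by (auto intro: exI[of _ 1])
next
  case (insert i I)
  then obtain L where L: "0 < L" "\<forall>i\<in>I. \<forall>p\<in>K. norm (F i p) \<le> L" by auto
  have "bounded (F i ` K)"
    using insert.prems assms(2) by (intro compact_imp_bounded compact_continuous_image) auto
  then obtain L' where "\<forall>y\<in>F i ` K. norm y \<le> L'" by (auto simp: bounded_iff)
  then show ?case
    using L by (intro exI[of _ "max L L'"]) (auto intro: max.coboundedI1 max.coboundedI2)
qed

text \<open>Indexing by a finite \<open>I\<close> yields one constant for all metric coefficients,
  all partial derivatives of the embedding or all transition maps at once. The Lipschitz clauses
  follow from the derivative bounds because a ball is convex.\<close>

lemma C2_on_cball_bounds:
  fixes \<Phi> :: "'i \<Rightarrow> 'a::euclidean_space \<Rightarrow> 'b::euclidean_space"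
  assumes "finite I" "cball p0 R \<subseteq> U" "\<And>i. i \<in> I \<Longrightarrow> Ck_on 2 U (\<Phi> i)"
  obtains L where "0 < L"
    "\<And>i p. i \<in> I \<Longrightarrow> p \<in> cball p0 R \<Longrightarrow> norm (\<Phi> i p) \<le> L"
    "\<And>i p v. i \<in> I \<Longrightarrow> p \<in> cball p0 R \<Longrightarrow> norm (fderiv (\<Phi> i) p v) \<le> L * norm v"
    "\<And>i p q v. i \<in> I \<Longrightarrow> p \<in> cball p0 R \<Longrightarrow> q \<in> cball p0 R \<Longrightarrow>
       norm (fderiv (\<Phi> i) p v - fderiv (\<Phi> i) q v) \<le> L * norm (p - q) * norm v"
    "\<And>i p q. i \<in> I \<Longrightarrow> p \<in> cball p0 R \<Longrightarrow> q \<in> cball p0 R \<Longrightarrow> norm (\<Phi> i p - \<Phi> i q) \<le> L * norm (p - q)"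
    "\<And>i p b v. i \<in> I \<Longrightarrow> p \<in> cball p0 R \<Longrightarrow> b \<in> Basis \<Longrightarrow>
       norm (fderiv (\<lambda>p. fderiv (\<Phi> i) p b) p v) \<le> L * norm v"
proof -
  define K where "K = cball p0 R"
  have C: "Ck_on 2 K (\<Phi> i)" if "i \<in> I" for i
    using assms that unfolding K_def by (meson Ck_on_subset)
  let ?d = "\<lambda>i p v. fderiv (\<Phi> i) p v"
  let ?dd = "\<lambda>i b p v. fderiv (\<lambda>p. ?d i p b) p v"
  have C1: "Ck_on 1 K (\<lambda>p. ?d i p v)" if "i \<in> I" for i v
    using C[OF that] by (simp add: numeral_2_eq_2)
  have C0: "continuous_on K (\<lambda>p. ?dd i b p v)" if "i \<in> I" for i b v
    using C1[OF that] by simp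
  have C1': "continuous_on K (\<lambda>p. ?d i p v)" if "i \<in> I" for i v
    using Ck_on_mono[OF C1[OF that, of v], of 0] by simp
  have cK: "compact K" "convex K" by (auto simp: K_def)
  obtain L0 where L0: "0 < L0" "\<forall>i\<in>I. \<forall>p\<in>K. norm (\<Phi> i p) \<le> L0"
    using compact_bound_family[OF assms(1) cK(1), of \<Phi>] C Ck_on_mono[of 2 K _ 0] by auto
  obtain L1 where L1: "0 < L1" "\<forall>x\<in>I \<times> Basis. \<forall>p\<in>K. norm (case x of (i, b) \<Rightarrow> ?d i p b) \<le> L1"
    using compact_bound_family[OF _ cK(1), of "I \<times> Basis" "\<lambda>x p. case x of (i,b) \<Rightarrow> ?d i p b"]
      C1' assms(1) by auto
  obtain L2 where L2: "0 < L2" "\<forall>x\<in>I \<times> Basis \<times> Basis. \<forall>p\<in>K. norm (case x of (i, b, b') \<Rightarrow> ?dd i b p b') \<le> L2"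
    using compact_bound_family[OF _ cK(1), of "I \<times> Basis \<times> Basis" "\<lambda>x p. case x of (i,b,b') \<Rightarrow> ?dd i b p b'"]
      C0 assms(1) by auto
  let ?n = "real DIM('a)"
  \<comment> \<open>The summands serve values, first and second derivatives. \<open>L2\<close>
    carries \<open>?n\<close> twice because \<open>linear_norm_le_Basis\<close> is applied to a
    second derivative and then again to a difference of first derivatives.\<close>
  define L where "L = L0 + ?n * L1 + ?n * ?n * L2"
  have n: "?n \<ge> 1" using DIM_positive[where 'a='a] by linarith
  have pos: "?n * L1 > 0" "?n * ?n * L2 > 0" using n L1(1) L2(1) by auto
  have diff: "\<Phi> i differentiable (at p)" if "i \<in> I" "p \<in> K" for i p
    using C[OF that(1)] that by (simp add: numeral_2_eq_2)
  have diff2: "(\<lambda>p. ?d i p v) differentiable (at p)" if "i \<in> I" "p \<in> K" for i p v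
    using C1[OF that(1)] that by simp
  have b1: "norm (?d i p v) \<le> L * norm v" if "i \<in> I" "p \<in> K" for i p v
  proof -
    have "norm (?d i p v) \<le> ?n * L1 * norm v"
      by (rule linear_norm_le_Basis[OF linear_frechet_derivative[OF diff[OF that]]]) (use L1(2) that in auto)
    also have "\<dots> \<le> L * norm v"
      using pos L0(1) by (intro mult_right_mono) (auto simp: L_def)
    finally show ?thesis .
  qed
  have dd: "norm (?dd i b p v) \<le> ?n * L2 * norm v" if "i \<in> I" "p \<in> K" "b \<in> Basis" for i b p v
    by (rule linear_norm_le_Basis[OF linear_frechet_derivative[OF diff2[OF that(1,2)]]]) (use L2(2) that in auto)
  have b4: "norm (?dd i b p v) \<le> L * norm v" if "i \<in> I" "p \<in> K" "b \<in> Basis" for i b p v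
  proof -
    have "?n * L2 \<le> ?n * ?n * L2"
      using mult_left_mono[of 1 ?n ?n] n L2(1) by (intro mult_right_mono) auto
    then have "?n * L2 \<le> L" unfolding L_def using pos L0(1) by linarith
    then have "?n * L2 * norm v \<le> L * norm v" by (rule mult_right_mono) simp
    then show ?thesis using dd[OF that, of v] by linarith
  qed
  have b2: "norm (?d i p v - ?d i q v) \<le> L * norm (p - q) * norm v" if "i \<in> I" "p \<in> K" "q \<in> K" for i p q v
  proof -
    have Bl: "norm (?d i p b - ?d i q b) \<le> ?n * L2 * norm (p - q)" if "b \<in> Basis" for b
    proof (rule has_derivative_bound[OF cK(2) has_fderiv[OF diff2[OF \<open>i \<in> I\<close>]]])
      show "norm (?dd i b p v) \<le> ?n * L2 * norm v" if "p \<in> K" for p v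
        by (rule dd[OF \<open>i \<in> I\<close> that \<open>b \<in> Basis\<close>])
    qed (use that \<open>p \<in> K\<close> \<open>q \<in> K\<close> in auto)
    have "norm (?d i p v - ?d i q v) \<le> ?n * (?n * L2 * norm (p - q)) * norm v"
      by (rule linear_norm_le_Basis[OF linear_compose_sub[OF linear_frechet_derivative[OF diff] linear_frechet_derivative[OF diff]]])
        (use that Bl in auto)
    also have "\<dots> = (?n * ?n * L2) * norm (p - q) * norm v" by simp
    also have "\<dots> \<le> L * norm (p - q) * norm v"
      using pos L0(1) by (intro mult_right_mono) (auto simp: L_def)
    finally show ?thesis .
  qed
  have b3: "norm (\<Phi> i p - \<Phi> i q) \<le> L * norm (p - q)" if "i \<in> I" "p \<in> K" "q \<in> K" for i p q
    by (rule has_derivative_bound[OF cK(2) has_fderiv[OF diff[OF that(1)]] b1[OF that(1)] that(2,3)])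
  have "0 < L" using pos L0(1) by (auto simp: L_def)
  moreover have "norm (\<Phi> i p) \<le> L" if "i \<in> I" "p \<in> K" for i p
    using bspec[OF bspec[OF L0(2) that(1)] that(2)] pos by (auto simp: L_def)
  ultimately show ?thesis
    using that[of L] b1 b2 b3 b4 unfolding K_def by blast
qed

text \<open>The gain is a product: the bound is small in the size \<open>W\<close> of the
  displacement and in \<open>norm (p - q)\<close> simultaneously, where the Lipschitz bound on
  \<open>\<Phi>\<close> alone gives only one factor. The reason is that the derivative of
  \<open>\<lambda>p. \<Phi> (p + h p) - \<Phi> p\<close> is already of order \<open>L * W\<close>.
  Used for metric coefficients and for partial derivatives of the embedding.\<close>

lemma displacement_increment_bound:
  fixes \<Phi> :: "'a::euclidean_space \<Rightarrow> 'b::euclidean_space" and h :: "'a \<Rightarrow> 'a"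
  assumes "convex B"
    and \<Phi>: "\<And>p. p \<in> B' \<Longrightarrow> (\<Phi> has_derivative \<Phi>' p) (at p)"
    and b: "\<And>p v. p \<in> B' \<Longrightarrow> norm (\<Phi>' p v) \<le> L * norm v"
    and lip: "\<And>p q v. p \<in> B' \<Longrightarrow> q \<in> B' \<Longrightarrow> norm (\<Phi>' p v - \<Phi>' q v) \<le> L * norm (p - q) * norm v"
    and h: "\<And>p. p \<in> B \<Longrightarrow> (h has_derivative u p) (at p)"
    and W: "\<And>p. p \<in> B \<Longrightarrow> norm (h p) \<le> W" "\<And>p v. p \<in> B \<Longrightarrow> norm (u p v) \<le> W * norm v"
    and sub: "B \<subseteq> B'" "\<And>p. p \<in> B \<Longrightarrow> p + h p \<in> B'" and "0 \<le> L" "p \<in> B" "q \<in> B"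
  shows "norm ((\<Phi> (p + h p) - \<Phi> p) - (\<Phi> (q + h q) - \<Phi> q)) \<le> 2 * L * W * norm (p - q)"
proof (rule has_derivative_bound[OF \<open>convex B\<close>])
  fix p assume p: "p \<in> B"
  have 1: "((\<lambda>p. \<Phi> (p + h p)) has_derivative (\<lambda>v. \<Phi>' (p + h p) (v + u p v))) (at p)"
    by (rule has_derivative_compose[where f="\<lambda>p. p + h p" and g=\<Phi>])
      (auto intro!: derivative_intros h p \<Phi> sub(2))
  show "((\<lambda>p. \<Phi> (p + h p) - \<Phi> p) has_derivative (\<lambda>v. \<Phi>' (p + h p) (v + u p v) - \<Phi>' p v)) (at p)"
    using p sub by (intro has_derivative_diff 1 \<Phi>) auto
  fix v
  have lin: "linear (\<Phi>' (p + h p))"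
    using has_derivative_linear[OF \<Phi>[OF sub(2)[OF p]]] .
  have "norm (\<Phi>' (p + h p) (v + u p v) - \<Phi>' p v)
      = norm ((\<Phi>' (p + h p) v - \<Phi>' p v) + \<Phi>' (p + h p) (u p v))"
    by (simp add: linear_add[OF lin] algebra_simps)
  also have "\<dots> \<le> L * norm (h p) * norm v + L * norm (u p v)"
    using lip[of "p + h p" p v] b[of "p + h p" "u p v"] p sub
    by (intro norm_triangle_mono) auto
  also have "\<dots> \<le> L * W * norm v + L * (W * norm v)"
    using W p \<open>0 \<le> L\<close> by (intro add_mono mult_mono mult_right_mono mult_left_mono) auto
  finally show "norm (\<Phi>' (p + h p) (v + u p v) - \<Phi>' p v) \<le> 2 * L * W * norm v" by simp
qed (use assms in auto)

section \<open>Almost isometries near the identity of a Euclidean ball\<close>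

text \<open>\<open>W\<close> is a parameter separate from \<kappa>, so that the same
  \<open>h\<close> and \<open>u\<close> can be used with several values of \<open>W\<close>. The
  bound \<open>u_bound1\<close> keeps terms quadratic in \<open>u\<close> linear in
  \<open>W\<close>. \<open>B\<close> carries the displacement; \<open>B'\<close> also contains the
  displaced points, and \<open>G\<close> is controlled there.\<close>

locale almost_isometry =
  fixes B B' :: "'n::euclidean_space set" and h :: "'n \<Rightarrow> 'n" and u :: "'n \<Rightarrow> 'n \<Rightarrow> 'n"
    and G :: "'n \<Rightarrow> 'n \<Rightarrow> 'n \<Rightarrow> real" and L m \<eta> \<kappa> W :: real
  assumes convex_B: "convex B" and B_sub: "B \<subseteq> B'" and maps: "\<And>p. p \<in> B \<Longrightarrow> p + h p \<in> B'"
    and bil: "\<And>p. p \<in> B' \<Longrightarrow> bilinear (G p)"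
    and sym: "\<And>p a b. p \<in> B' \<Longrightarrow> G p a b = G p b a"
    and G_bound: "\<And>p a b. p \<in> B' \<Longrightarrow> \<bar>G p a b\<bar> \<le> L * norm a * norm b"
    and G_lip: "\<And>p q a b. p \<in> B' \<Longrightarrow> q \<in> B' \<Longrightarrow> \<bar>G p a b - G q a b\<bar> \<le> L * norm (p - q) * norm a * norm b"
    and G_incr: "\<And>p q a b. p \<in> B \<Longrightarrow> q \<in> B \<Longrightarrow>
       \<bar>(G (p + h p) a b - G p a b) - (G (q + h q) a b - G q a b)\<bar> \<le> L * W * norm (p - q) * norm a * norm b"
    and G_pos: "\<And>p a. p \<in> B \<Longrightarrow> m * (norm a)\<^sup>2 \<le> G p a a"
    and h_deriv: "\<And>p. p \<in> B \<Longrightarrow> (h has_derivative u p) (at p)"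
    and h_bound: "\<And>p. p \<in> B \<Longrightarrow> norm (h p) \<le> W"
    and u_bound: "\<And>p v. p \<in> B \<Longrightarrow> norm (u p v) \<le> W * norm v"
    and u_bound1: "\<And>p v. p \<in> B \<Longrightarrow> norm (u p v) \<le> norm v"
    and u_lip: "\<And>p q v. p \<in> B \<Longrightarrow> q \<in> B \<Longrightarrow> norm (u p v - u q v) \<le> \<kappa> * norm (p - q) * norm v"
    and almost_isom: "\<And>p v. p \<in> B \<Longrightarrow> \<bar>G (p + h p) (v + u p v) (v + u p v) - G p v v\<bar> \<le> \<eta> * (norm v)\<^sup>2"
    and L_nonneg: "0 \<le> L" and m_pos: "0 < m" and \<eta>_nonneg: "0 \<le> \<eta>"
    and \<kappa>_nonneg: "0 \<le> \<kappa>" and \<kappa>_le1: "\<kappa> \<le> 1" and W_nonneg: "0 \<le> W"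
begin

text \<open>Comparing the metric defect at \<open>z\<close> and at \<open>p\<close> on the same
  vector \<open>d\<close> leaves, by symmetry of \<open>G\<close>, twice the wanted term. The two
  defects cost \<open>2 * \<eta>\<close>, and the errors add up to 13 times
  \<open>L * W * s * (norm d)\<^sup>2\<close>; half of 13 is rounded up to 7.\<close>

lemma metric_derivative_increment:
  assumes p: "p \<in> B" and z: "z \<in> B" and s: "norm (z - p) \<le> s"
  shows "\<bar>G p d (u z d - u p d)\<bar> \<le> (\<eta> + 7 * L * W * s) * (norm d)\<^sup>2"
proof -
  define fp fz where "fp = p + h p" and "fz = z + h z"
  define e where "e = u z d - u p d"
  have in': "p \<in> B'" "z \<in> B'" "fp \<in> B'" "fz \<in> B'"
    using p z B_sub maps by (auto simp: fp_def fz_def)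
  note bl = bilinear_ladd[OF bil] bilinear_radd[OF bil] bilinear_lsub[OF bil] bilinear_rsub[OF bil]
  \<comment> \<open>\<open>E1\<close> compares the change of \<open>G\<close> under the displacement
    at \<open>z\<close> and at \<open>p\<close>, \<open>E2\<close> is the change of \<open>G\<close>
    from \<open>p\<close> to \<open>z\<close>, \<open>E3\<close> its change from \<open>p\<close> to
    \<open>fp\<close>, and \<open>E4\<close> is the part of \<open>G p\<close> that is quadratic in
    \<open>u\<close>. Each pairs a factor of order \<open>W\<close> with one of order
    \<open>s\<close>.\<close>
  define E1 where "E1 = (G fz (d + u z d) (d + u z d) - G z (d + u z d) (d + u z d)) - (G fp (d + u z d) (d + u z d) - G p (d + u z d) (d + u z d))"
  define E2 where "E2 = (G z (u z d) (d + u z d) - G p (u z d) (d + u z d)) + (G z d (u z d) - G p d (u z d))"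
  define E3 where "E3 = G fp e (d + u z d + (d + u p d)) - G p e (d + u z d + (d + u p d))"
  define E4 where "E4 = G p e (u z d + u p d)"
  define Tz where "Tz = G fz (d + u z d) (d + u z d) - G z d d"
  define Tp where "Tp = G fp (d + u p d) (d + u p d) - G p d d"
  have s0: "0 \<le> s" using s norm_ge_zero order_trans by blast
  have Wd: "norm (u z d) \<le> W * norm d" "norm (u p d) \<le> W * norm d"
    using u_bound p z by auto
  have F: "norm (d + u z d) \<le> 2 * norm d" "norm (d + u p d) \<le> 2 * norm d"
    using u_bound1[OF z, of d] u_bound1[OF p, of d] norm_triangle_ineq[of d "u z d"] norm_triangle_ineq[of d "u p d"]
    by auto
  have e: "norm e \<le> \<kappa> * s * norm d"
    unfolding e_def using u_lip[OF z p, of d] s \<kappa>_nonneg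
    by (meson mult_left_mono mult_right_mono norm_ge_zero order_trans)
  \<comment> \<open>Giving up the factor \<kappa> here makes \<open>E3\<close> and \<open>E4\<close>
    multiples of \<open>L * W * s\<close> like the other errors.\<close>
  have e': "norm e \<le> s * norm d"
    using e \<kappa>_le1 s0 by (metis mult_left_le_one_le mult_right_mono norm_ge_zero order_trans mult_nonneg_nonneg \<kappa>_nonneg)
  have eq: "Tz - Tp = E1 + E2 + E3 + E4 + 2 * G p d e"
    unfolding Tz_def Tp_def E1_def E2_def E3_def E4_def e_def
    by (simp add: bl in' sym[of fp "u z d" d] sym[of fp "u p d" d] sym[of p "u z d" d] sym[of p "u p d" d]
      sym[of fp "u z d" "u p d"] sym[of p "u z d" "u p d"] sym[of z "u z d" d] sym[of fz "u z d" d])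
  have "\<bar>E1\<bar> \<le> L * W * norm (z - p) * norm (d + u z d) * norm (d + u z d)"
    unfolding E1_def fz_def fp_def by (rule G_incr[OF z p])
  also have "\<dots> \<le> L * W * s * (2 * norm d) * (2 * norm d)"
    using s F L_nonneg W_nonneg s0 by (intro mult_mono) auto
  finally have 1: "\<bar>E1\<bar> \<le> 4 * (L * W * s * (norm d)\<^sup>2)"
    by (simp add: power2_eq_square)
  have "\<bar>E2\<bar> \<le> \<bar>G z (u z d) (d + u z d) - G p (u z d) (d + u z d)\<bar> + \<bar>G z d (u z d) - G p d (u z d)\<bar>"
    unfolding E2_def by (rule abs_triangle_ineq)
  also have "\<dots> \<le> L * norm (z - p) * norm (u z d) * norm (d + u z d) + L * norm (z - p) * norm d * norm (u z d)"
    using in' by (intro add_mono G_lip) auto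
  also have "\<dots> \<le> L * s * (W * norm d) * (2 * norm d) + L * s * norm d * (W * norm d)"
    using s F Wd L_nonneg W_nonneg s0 by (intro add_mono mult_mono) auto
  finally have 2: "\<bar>E2\<bar> \<le> 3 * (L * W * s * (norm d)\<^sup>2)"
    by (simp add: power2_eq_square)
  have "\<bar>E3\<bar> \<le> L * norm (fp - p) * norm e * norm (d + u z d + (d + u p d))"
    unfolding E3_def using in' by (intro G_lip) auto
  also have "\<dots> \<le> L * W * (s * norm d) * (4 * norm d)"
    using F e' h_bound[OF p] L_nonneg W_nonneg s0 norm_triangle_ineq[of "d + u z d" "d + u p d"]
    by (intro mult_mono) (auto simp: fp_def)
  finally have 3: "\<bar>E3\<bar> \<le> 4 * (L * W * s * (norm d)\<^sup>2)"
    by (simp add: power2_eq_square mult_ac)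
  have "\<bar>E4\<bar> \<le> L * norm e * norm (u z d + u p d)"
    unfolding E4_def using in' by (intro G_bound) auto
  also have "\<dots> \<le> L * (s * norm d) * (2 * (W * norm d))"
    using Wd e' L_nonneg W_nonneg s0 norm_triangle_ineq[of "u z d" "u p d"]
    by (intro mult_mono) auto
  finally have 4: "\<bar>E4\<bar> \<le> 2 * (L * W * s * (norm d)\<^sup>2)"
    by (simp add: power2_eq_square mult_ac)
  have T: "\<bar>Tz\<bar> \<le> \<eta> * (norm d)\<^sup>2" "\<bar>Tp\<bar> \<le> \<eta> * (norm d)\<^sup>2"
    unfolding Tz_def Tp_def fz_def fp_def using almost_isom p z by auto
  have nn: "0 \<le> L * W * s * (norm d)\<^sup>2" using L_nonneg W_nonneg s0 by auto
  have "2 * \<bar>G p d e\<bar> \<le> 2 * (\<eta> * (norm d)\<^sup>2) + 13 * (L * W * s * (norm d)\<^sup>2)"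
    using eq 1 2 3 4 T by linarith
  then have "\<bar>G p d e\<bar> \<le> \<eta> * (norm d)\<^sup>2 + 7 * (L * W * s * (norm d)\<^sup>2)"
    using nn by linarith
  then show ?thesis by (simp add: e_def algebra_simps)
qed

text \<open>The mean value theorem on the segment from \<open>x\<close> to \<open>y\<close>, applied
  to the scalar pairing with \<open>G p d\<close>. It works because \<open>d\<close> is both the
  direction of the segment and the vector paired with, so the derivative of the pairing is exactly
  the quantity just bounded.\<close>

lemma metric_chord_increment:
  assumes p: "p \<in> B" and x: "x \<in> B" "norm (x - p) \<le> s" and y: "y \<in> B" "norm (y - p) \<le> s"
  shows "\<bar>G p (y - x) (h y - h x - u p (y - x))\<bar> \<le> (\<eta> + 7 * L * W * s) * (norm (y - x))\<^sup>2"
proof -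
  define d where "d = y - x"
  have pB': "p \<in> B'" using p B_sub by auto
  have lin: "linear (G p d)" using bil[OF pB'] by (simp add: bilinear_def)
  have seg: "x + t *\<^sub>R d \<in> B \<and> norm (x + t *\<^sub>R d - p) \<le> s" if "t \<in> {0..1}" for t
  proof -
    have eq: "x + t *\<^sub>R d = (1 - t) *\<^sub>R x + t *\<^sub>R y"
      by (simp add: d_def algebra_simps)
    have "convex (B \<inter> cball p s)" using convex_B by (intro convex_Int convex_cball)
    moreover have "x \<in> B \<inter> cball p s" "y \<in> B \<inter> cball p s"
      using x y by (auto simp: dist_norm norm_minus_commute)
    ultimately have "x + t *\<^sub>R d \<in> B \<inter> cball p s"
      unfolding eq convex_alt using that by auto
    then show ?thesis by (auto simp: dist_norm norm_minus_commute)
  qed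
  define \<phi> where "\<phi> = (\<lambda>t. G p d (h (x + t *\<^sub>R d) - t *\<^sub>R u p d))"
  have "(\<phi> has_derivative (\<lambda>r. r * G p d (u (x + t *\<^sub>R d) d - u p d))) (at t within {0..1})"
    if "t \<in> {0..1}" for t
  proof -
    have hd: "(h has_derivative u (x + t *\<^sub>R d)) (at (x + t *\<^sub>R d))"
      using seg[OF that] h_deriv by auto
    have 1: "((\<lambda>t. h (x + t *\<^sub>R d)) has_derivative (\<lambda>r. u (x + t *\<^sub>R d) (r *\<^sub>R d))) (at t)"
      by (rule has_derivative_compose[where f="\<lambda>t. x + t *\<^sub>R d" and g=h])
        (auto intro!: derivative_eq_intros hd)
    have "(\<phi> has_derivative (\<lambda>r. G p d (u (x + t *\<^sub>R d) (r *\<^sub>R d) - r *\<^sub>R u p d))) (at t)"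
      unfolding \<phi>_def
      by (intro bounded_linear.has_derivative[OF linear_conv_bounded_linear[THEN iffD1, OF lin]]
          has_derivative_diff 1) (auto intro!: derivative_eq_intros)
    moreover have "G p d (u (x + t *\<^sub>R d) (r *\<^sub>R d) - r *\<^sub>R u p d) = r * G p d (u (x + t *\<^sub>R d) d - u p d)" for r
      using linear_scale[OF has_derivative_linear[OF hd], of r d]
      by (simp add: scaleR_diff_right[symmetric] linear_scale[OF lin])
    ultimately show ?thesis
      by (simp add: has_derivative_at_withinI)
  qed
  then obtain t where t: "t \<in> {0..1}" "\<phi> 1 - \<phi> 0 = (1 - 0) * G p d (u (x + t *\<^sub>R d) d - u p d)"
    using mvt_very_simple[of 0 1 \<phi> "\<lambda>t r. r * G p d (u (x + t *\<^sub>R d) d - u p d)"] by auto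
  have "\<phi> 1 - \<phi> 0 = G p d (h y - h x - u p d)"
    by (simp add: \<phi>_def linear_diff[OF lin, symmetric]) (simp add: d_def algebra_simps)
  then have "\<bar>G p d (h y - h x - u p d)\<bar> = \<bar>G p d (u (x + t *\<^sub>R d) d - u p d)\<bar>"
    using t by simp
  also have "\<dots> \<le> (\<eta> + 7 * L * W * s) * (norm d)\<^sup>2"
    using seg[OF t(1)] p by (intro metric_derivative_increment) auto
  finally show ?thesis by (simp add: d_def)
qed

text \<open>Up to errors \<open>(q, q') \<mapsto> G p q (H q')\<close> is antisymmetric on the cluster, and it is linear in \<open>q\<close>;
  hence \<open>H\<close> is additive up to errors.\<close>

lemma second_difference_bound:
  assumes \<gamma>: "0 < \<gamma>" and sub: "cball p (2 * \<gamma>) \<subseteq> B" and a: "norm a \<le> \<gamma>" and b: "norm b \<le> \<gamma>"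
  shows "norm (h (p + a + b) - h (p + a) - h (p + b) + h p) \<le> 81 * \<gamma> * (\<eta> + 14 * L * W * \<gamma>) / m"
proof -
  have p: "p \<in> B" using sub \<gamma> by (auto simp: subset_iff)
  then have pB': "p \<in> B'" using B_sub by auto
  \<comment> \<open>Removing the affine part makes \<open>H\<close> vanish at 0 and does not change
    second differences.\<close>
  define H where "H = (\<lambda>q. h (p + q) - h p - u p q)"
  \<comment> \<open>Points within \<open>2 * \<gamma>\<close> of \<open>p\<close> turn the 7 into
    14, and chords of length at most \<open>3 * \<gamma>\<close> give 9 after squaring.\<close>
  define \<epsilon> where "\<epsilon> = 9 * \<gamma>\<^sup>2 * (\<eta> + 14 * L * W * \<gamma>)"
  have lin_u: "linear (u p)" using has_derivative_linear[OF h_deriv[OF p]] .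
  have Hd: "\<bar>G p (q - q') (H q - H q')\<bar> \<le> \<epsilon>"
    if "norm q \<le> 2 * \<gamma>" "norm q' \<le> 2 * \<gamma>" "norm (q - q') \<le> 3 * \<gamma>" for q q'
  proof -
    have "p + q \<in> B" "p + q' \<in> B" using sub that by (auto simp: subset_iff dist_norm)
    then have "\<bar>G p (p + q - (p + q')) (h (p + q) - h (p + q') - u p (p + q - (p + q')))\<bar>
        \<le> (\<eta> + 7 * L * W * (2 * \<gamma>)) * (norm (p + q - (p + q')))\<^sup>2"
      using that p by (intro metric_chord_increment) auto
    also have "h (p + q) - h (p + q') - u p (p + q - (p + q')) = H q - H q'"
      by (simp add: H_def linear_diff[OF lin_u])
    also have "(\<eta> + 7 * L * W * (2 * \<gamma>)) * (norm (p + q - (p + q')))\<^sup>2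
        \<le> (\<eta> + 7 * L * W * (2 * \<gamma>)) * (3 * \<gamma>)\<^sup>2"
      using that(3) \<eta>_nonneg L_nonneg W_nonneg \<gamma> by (intro mult_left_mono power_mono) auto
    also have "\<dots> = \<epsilon>" by (simp add: \<epsilon>_def power_mult_distrib algebra_simps)
    finally show ?thesis by simp
  qed
  have H0: "H 0 = 0" by (simp add: H_def linear_0[OF lin_u])
  note bl = bilinear_lsub[OF bil] bilinear_rsub[OF bil]
  \<comment> \<open>Polarization: expand the bound for the pair \<open>q\<close>, \<open>q'\<close>
    and remove the two diagonal terms, which are the same bound with the second point 0.\<close>
  have anti: "\<bar>G p q (H q') + G p q' (H q)\<bar> \<le> 3 * \<epsilon>"
    if "norm q \<le> 2 * \<gamma>" "norm q' \<le> 2 * \<gamma>" "norm q \<le> 3 * \<gamma>" "norm q' \<le> 3 * \<gamma>" "norm (q - q') \<le> 3 * \<gamma>" for q q'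
  proof -
    have "\<bar>G p q (H q)\<bar> \<le> \<epsilon>" using Hd[of q 0] that \<gamma> by (simp add: H0)
    moreover have "\<bar>G p q' (H q')\<bar> \<le> \<epsilon>" using Hd[of q' 0] that \<gamma> by (simp add: H0)
    moreover have "\<bar>G p q (H q) - G p q (H q') - (G p q' (H q) - G p q' (H q'))\<bar> \<le> \<epsilon>"
      using Hd[of q q'] that \<gamma> by (simp add: bl pB')
    ultimately show ?thesis by linarith
  qed
  define S where "S = h (p + a + b) - h (p + a) - h (p + b) + h p"
  have S: "S = H (a + b) - H a - H b"
    by (simp add: S_def H_def linear_add[OF lin_u] add.assoc)
  \<comment> \<open>Swapping the arguments by \<open>anti\<close> in each of the three terms turns
    the additivity defect of \<open>H\<close> into that of \<open>\<lambda>q. G p q (H c)\<close>,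
    which is zero. Three swaps cost \<open>9 * \<epsilon>\<close>.\<close>
  have key: "\<bar>G p c S\<bar> \<le> 9 * \<epsilon>" if c: "norm c \<le> \<gamma>" for c
  proof -
    have n: "norm (a + b) \<le> 2 * \<gamma>" "norm (c - (a + b)) \<le> 3 * \<gamma>" "norm (c - a) \<le> 2 * \<gamma>" "norm (c - b) \<le> 2 * \<gamma>"
      using a b c norm_triangle_ineq[of a b] norm_triangle_ineq4[of c "a + b"]
        norm_triangle_ineq4[of c a] norm_triangle_ineq4[of c b] by linarith+
    have "G p c S = G p c (H (a + b)) - G p c (H a) - G p c (H b)"
      unfolding S by (simp add: bl pB')
    moreover have "G p (a + b) (H c) = G p a (H c) + G p b (H c)"
      by (rule bilinear_ladd[OF bil[OF pB']])
    moreover have "\<bar>G p c (H (a + b)) + G p (a + b) (H c)\<bar> \<le> 3 * \<epsilon>"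
      "\<bar>G p c (H a) + G p a (H c)\<bar> \<le> 3 * \<epsilon>" "\<bar>G p c (H b) + G p b (H c)\<bar> \<le> 3 * \<epsilon>"
      using n a b c \<gamma> by (auto intro!: anti)
    ultimately show ?thesis by linarith
  qed
  have "m * \<gamma> * norm S \<le> 9 * \<epsilon>"
  proof (cases "S = 0")
    case True
    then show ?thesis using \<eta>_nonneg L_nonneg W_nonneg \<gamma> by (auto simp: \<epsilon>_def)
  next
    case False
    \<comment> \<open>The multiple of \<open>S\<close> of the largest length allowed in
      \<open>key\<close>; the lower bound \<open>m\<close> then turns the pairing into
      \<open>norm S\<close>.\<close>
    define c where "c = (\<gamma> / norm S) *\<^sub>R S"
    have "norm c = \<gamma>" using \<gamma> False by (simp add: c_def)
    moreover have "G p c S = \<gamma> / norm S * G p S S"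
      by (simp add: c_def bilinear_lmul[OF bil[OF pB']])
    ultimately have "\<gamma> / norm S * G p S S \<le> 9 * \<epsilon>"
      using key[of c] by linarith
    moreover have "\<gamma> / norm S * (m * (norm S)\<^sup>2) \<le> \<gamma> / norm S * G p S S"
      using G_pos[OF p] \<gamma> by (intro mult_left_mono) auto
    moreover have "\<gamma> / norm S * (m * (norm S)\<^sup>2) = m * \<gamma> * norm S"
      using False by (simp add: power2_eq_square)
    ultimately show ?thesis by linarith
  qed
  then have "(m * norm S) * \<gamma> \<le> (81 * \<gamma> * (\<eta> + 14 * L * W * \<gamma>)) * \<gamma>"
    by (simp add: \<epsilon>_def power2_eq_square mult_ac)
  then have "m * norm S \<le> 81 * \<gamma> * (\<eta> + 14 * L * W * \<gamma>)"
    using \<gamma> mult_right_le_imp_le by blast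
  then show ?thesis
    using m_pos by (simp add: S_def field_simps)
qed

text \<open>The derivatives at both ends are replaced by differences of \<open>h\<close> over a step
  \<gamma> in direction \<open>v\<close>. Along the segment these differences change by one second
  difference per step; there are at most \<open>2 * D / \<gamma>\<close> steps, whence 162 = 2 * 81.
  Finally everything is divided by \<gamma>.\<close>

lemma derivative_oscillation_inner:
  assumes \<gamma>: "0 < \<gamma>" "\<gamma> \<le> D" and sub: "\<And>x. x \<in> closed_segment p q \<Longrightarrow> cball x (2 * \<gamma>) \<subseteq> B"
    and D: "norm (q - p) \<le> D" and v: "norm v = 1"
  shows "norm (u p v - u q v) \<le> 2 * \<kappa> * \<gamma> + 162 * D / m * (\<eta> / \<gamma> + 14 * L * W)"
proof -
  \<comment> \<open>Rounding up keeps the steps no longer than \<gamma>; it at most doubles their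
    number because \<open>D / \<gamma>\<close> is at least 1.\<close>
  define n where "n = nat \<lceil>D / \<gamma>\<rceil>"
  define a where "a = (1 / real n) *\<^sub>R (q - p)"
  define M where "M = 81 * \<gamma> * (\<eta> + 14 * L * W * \<gamma>) / m"
  have M0: "0 \<le> M" using \<eta>_nonneg L_nonneg W_nonneg \<gamma> m_pos by (auto simp: M_def)
  have D1: "1 \<le> D / \<gamma>" using \<gamma> by simp
  have n: "D / \<gamma> \<le> real n" "real n \<le> 2 * D / \<gamma>" "0 < n"
    using D1 unfolding n_def by linarith+
  have na: "norm a \<le> \<gamma>"
  proof -
    have "norm a \<le> D / n" using D n by (simp add: a_def divide_right_mono)
    also have "\<dots> \<le> \<gamma>" using n \<gamma> by (simp add: field_simps)
    finally show ?thesis .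
  qed
  have seg: "p + real i *\<^sub>R a \<in> closed_segment p q" if "i \<le> n" for i
  proof -
    have "p + real i *\<^sub>R a = (1 - real i / n) *\<^sub>R p + (real i / n) *\<^sub>R q"
      by (simp add: a_def algebra_simps)
    moreover have "0 \<le> real i / n" "real i / n \<le> 1" using that n by auto
    ultimately show ?thesis unfolding closed_segment_def by blast
  qed
  have nq: "p + real n *\<^sub>R a = q" using n by (simp add: a_def)
  define w where "w = \<gamma> *\<^sub>R v"
  have w: "norm w = \<gamma>" using v \<gamma> by (simp add: w_def)
  define g where "g = (\<lambda>i. h (p + real i *\<^sub>R a + w) - h (p + real i *\<^sub>R a))"
  have "norm (g (Suc i) - g i) \<le> M" if "i < n" for i
  proof -
    have "norm (h (p + real i *\<^sub>R a + a + w) - h (p + real i *\<^sub>R a + a) - h (p + real i *\<^sub>R a + w) + h (p + real i *\<^sub>R a)) \<le> M"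
      unfolding M_def using \<gamma> sub seg[of i] that na w by (intro second_difference_bound) auto
    moreover have "p + real (Suc i) *\<^sub>R a = p + real i *\<^sub>R a + a" by (simp add: algebra_simps)
    ultimately show ?thesis by (simp add: g_def algebra_simps)
  qed
  then have "norm (g i - g 0) \<le> real i * M" if "i \<le> n" for i
    using that
  proof (induction i)
    case (Suc i)
    have "norm (g (Suc i) - g 0) \<le> norm (g (Suc i) - g i) + norm (g i - g 0)"
      using norm_triangle_ineq[of "g (Suc i) - g i" "g i - g 0"] by simp
    also have "\<dots> \<le> M + real i * M" using Suc by (intro add_mono) auto
    finally show ?case by (simp add: algebra_simps)
  qed simp
  then have gn: "norm (g n - g 0) \<le> 2 * D / \<gamma> * M"
    using n(2) M0 by (meson mult_right_mono order_refl order_trans)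
  have lin: "norm (h (x + w) - h x - u x w) \<le> \<kappa> * \<gamma> * \<gamma>" if x: "cball x (2 * \<gamma>) \<subseteq> B" for x
  proof -
    have xB: "x \<in> B" using x \<gamma> by (auto simp: subset_iff)
    have "norm ((h (x + w) - u x (x + w)) - (h x - u x x)) \<le> \<kappa> * \<gamma> * norm (x + w - x)"
    proof (rule has_derivative_bound[where S="cball x \<gamma>"])
      fix z assume "z \<in> cball x \<gamma>"
      then have zB: "z \<in> B" and zx: "norm (z - x) \<le> \<gamma>"
        using x \<gamma> by (auto simp: subset_iff dist_norm norm_minus_commute)
      show "((\<lambda>z. h z - u x z) has_derivative (\<lambda>v. u z v - u x v)) (at z)"
        using h_deriv[OF zB] has_derivative_bounded_linear[OF h_deriv[OF xB]]
        by (intro has_derivative_diff) (auto intro: bounded_linear_imp_has_derivative)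
      show "norm (u z v - u x v) \<le> \<kappa> * \<gamma> * norm v" for v
        using u_lip[OF zB xB, of v] zx \<kappa>_nonneg
        by (meson mult_left_mono mult_right_mono norm_ge_zero order_trans)
    qed (use \<gamma> w in \<open>auto simp: dist_norm\<close>)
    then show ?thesis using w linear_add[OF has_derivative_linear[OF h_deriv[OF xB]], of x w]
      by (simp add: algebra_simps)
  qed
  have pq: "cball p (2 * \<gamma>) \<subseteq> B" "cball q (2 * \<gamma>) \<subseteq> B" using sub by auto
  then have pqB: "p \<in> B" "q \<in> B" using \<gamma> by (auto simp: subset_iff)
  have "norm (u q w - u p w) \<le> 2 * (\<kappa> * \<gamma> * \<gamma>) + 2 * D / \<gamma> * M"
  proof -
    have "u q w - u p w = (g n - g 0) - (h (q + w) - h q - u q w) + (h (p + w) - h p - u p w)"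
      by (simp add: g_def nq)
    also have "norm \<dots> \<le> norm (g n - g 0) + norm (h (q + w) - h q - u q w) + norm (h (p + w) - h p - u p w)"
      by (meson add_mono norm_triangle_ineq norm_triangle_ineq4 order_refl order_trans)
    finally show ?thesis using gn lin[OF pq(1)] lin[OF pq(2)] by linarith
  qed
  moreover have "u q w - u p w = \<gamma> *\<^sub>R (u q v - u p v)"
    using pqB by (simp add: w_def linear_scale[OF has_derivative_linear[OF h_deriv]] scaleR_diff_right)
  ultimately have "\<gamma> * norm (u q v - u p v) \<le> 2 * (\<kappa> * \<gamma> * \<gamma>) + 2 * D / \<gamma> * M"
    using \<gamma> by simp
  moreover have "2 * D / \<gamma> * M = \<gamma> * (162 * D / m * (\<eta> / \<gamma> + 14 * L * W))"
    using \<gamma> m_pos by (simp add: M_def field_simps)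
  ultimately have "\<gamma> * norm (u q v - u p v) \<le> \<gamma> * (2 * \<kappa> * \<gamma> + 162 * D / m * (\<eta> / \<gamma> + 14 * L * W))"
    by (simp add: algebra_simps)
  then show ?thesis using \<gamma> by (simp add: norm_minus_commute)
qed

text \<open>The inner estimate needs room \<open>2 * \<gamma>\<close> around the segment, which
  points near the boundary of \<open>B\<close> lack. Contracting \<open>B\<close> towards
  \<open>p0\<close> creates it and moves points by at most \<open>2 * \<gamma>\<close>. The
  Lipschitz bound on \<open>u\<close> pays \<open>2 * \<kappa> * \<gamma>\<close> at each end, so 2
  becomes 6; \<open>D = 2 * \<rho>\<close> turns 162 into 324.\<close>

lemma derivative_oscillation:
  assumes B: "B = cball p0 \<rho>" and \<gamma>: "0 < \<gamma>" "2 * \<gamma> \<le> \<rho>" and pq: "p \<in> B" "q \<in> B"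
  shows "norm (u p v - u q v) \<le> (6 * \<kappa> * \<gamma> + 324 * \<rho> / m * (\<eta> / \<gamma> + 14 * L * W)) * norm v"
proof -
  define sh where "sh = (\<lambda>p. p0 + (1 - 2 * \<gamma> / \<rho>) *\<^sub>R (p - p0))"
  have \<rho>: "0 < \<rho>" using \<gamma> by linarith
  have t: "0 \<le> 1 - 2 * \<gamma> / \<rho>" using \<gamma> \<rho> by (simp add: field_simps)
  have sh1: "norm (sh x - x) \<le> 2 * \<gamma>" and sh2: "norm (sh x - p0) \<le> \<rho> - 2 * \<gamma>" if "x \<in> B" for x
  proof -
    have nx: "norm (x - p0) \<le> \<rho>" using that by (simp add: B dist_norm norm_minus_commute)
    have "sh x - x = (- (2 * \<gamma> / \<rho>)) *\<^sub>R (x - p0)" by (simp add: sh_def algebra_simps)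
    then have "norm (sh x - x) = 2 * \<gamma> / \<rho> * norm (x - p0)" using \<gamma> \<rho> by simp
    also have "\<dots> \<le> 2 * \<gamma> / \<rho> * \<rho>" using nx \<gamma> \<rho> by (intro mult_left_mono) auto
    finally show "norm (sh x - x) \<le> 2 * \<gamma>" using \<rho> by simp
    have "norm (sh x - p0) = (1 - 2 * \<gamma> / \<rho>) * norm (x - p0)" using t by (simp add: sh_def)
    also have "\<dots> \<le> (1 - 2 * \<gamma> / \<rho>) * \<rho>" using nx t by (intro mult_left_mono) auto
    also have "\<dots> = \<rho> - 2 * \<gamma>" using \<rho> by (simp add: field_simps)
    finally show "norm (sh x - p0) \<le> \<rho> - 2 * \<gamma>" .
  qed
  have shB: "sh x \<in> B" if "x \<in> B" for x
    using sh2[OF that] \<gamma> by (simp add: B dist_norm norm_minus_commute)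
  have unit: "norm (u p v - u q v) \<le> 6 * \<kappa> * \<gamma> + 324 * \<rho> / m * (\<eta> / \<gamma> + 14 * L * W)" if v: "norm v = 1" for v
  proof -
    have "norm (u (sh p) v - u (sh q) v) \<le> 2 * \<kappa> * \<gamma> + 162 * (2 * \<rho>) / m * (\<eta> / \<gamma> + 14 * L * W)"
    proof (rule derivative_oscillation_inner)
      show "norm (sh q - sh p) \<le> 2 * \<rho>"
        using sh2[OF pq(1)] sh2[OF pq(2)] \<gamma> norm_triangle_ineq4[of "sh q - p0" "sh p - p0"] by simp
      fix x assume "x \<in> closed_segment (sh p) (sh q)"
      moreover have "closed_segment (sh p) (sh q) \<subseteq> cball p0 (\<rho> - 2 * \<gamma>)"
        using sh2[OF pq(1)] sh2[OF pq(2)]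
        by (intro closed_segment_subset convex_cball) (auto simp: dist_norm norm_minus_commute)
      ultimately have "dist p0 x \<le> \<rho> - 2 * \<gamma>" by auto
      then show "cball x (2 * \<gamma>) \<subseteq> B"
        unfolding B by (auto simp: subset_iff) (metis add.commute add_le_cancel_left diff_add_cancel dist_triangle_le add_mono order_trans dist_triangle le_diff_eq)
    qed (use \<gamma> v in auto)
    moreover have "norm (u x v - u (sh x) v) \<le> \<kappa> * (2 * \<gamma>)" if "x \<in> B" for x
    proof -
      have "norm (u x v - u (sh x) v) \<le> \<kappa> * norm (x - sh x) * norm v"
        by (rule u_lip[OF that shB[OF that]])
      also have "\<dots> \<le> \<kappa> * (2 * \<gamma>)" using sh1[OF that] v \<kappa>_nonneg by (simp add: norm_minus_commute mult_left_mono)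
      finally show ?thesis .
    qed
    note this[OF pq(1)] this[OF pq(2)]
    moreover have "norm (u p v - u q v) \<le> norm (u p v - u (sh p) v) + norm (u (sh p) v - u (sh q) v) + norm (u q v - u (sh q) v)"
      using norm_triangle_ineq[of "u p v - u (sh p) v" "u (sh p) v - u q v"]
        norm_triangle_ineq4[of "u (sh p) v - u (sh q) v" "u q v - u (sh q) v"] by simp
    ultimately show ?thesis by simp
  qed
  show ?thesis
  proof (cases "v = 0")
    case True
    then show ?thesis using pq by (simp add: linear_0[OF has_derivative_linear[OF h_deriv]])
  next
    case False
    define e where "e = (1 / norm v) *\<^sub>R v"
    have e: "norm e = 1" "v = norm v *\<^sub>R e" using False by (auto simp: e_def)
    have "u x v = norm v *\<^sub>R u x e" if "x \<in> B" for x
      using linear_scale[OF has_derivative_linear[OF h_deriv[OF that]], of "norm v" e] e by simp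
    then have "norm (u p v - u q v) = norm v * norm (u p e - u q e)"
      using pq by (simp add: scaleR_diff_right[symmetric])
    also have "\<dots> \<le> norm v * (6 * \<kappa> * \<gamma> + 324 * \<rho> / m * (\<eta> / \<gamma> + 14 * L * W))"
      by (intro mult_left_mono unit e) auto
    finally show ?thesis by (simp add: mult.commute)
  qed
qed

end

text \<open>On a small ball the term with \<open>W\<close> in the oscillation estimate is absorbed, because \<open>W\<close> is itself
  controlled by the oscillation and the values at one point.\<close>

lemma almost_isometry_propagation:
  fixes h :: "'n::euclidean_space \<Rightarrow> 'n"
  assumes AI: "\<And>W. 0 \<le> W \<Longrightarrow> (\<And>p. p \<in> cball p0 \<rho> \<Longrightarrow> norm (h p) \<le> W) \<Longrightarrow>
      (\<And>p v. p \<in> cball p0 \<rho> \<Longrightarrow> norm (u p v) \<le> W * norm v) \<Longrightarrow>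
      almost_isometry (cball p0 \<rho>) B' h u G L m \<eta> \<kappa> W"
    and h1: "\<And>p. p \<in> cball p0 \<rho> \<Longrightarrow> norm (h p) \<le> 1"
    and u1: "\<And>p v. p \<in> cball p0 \<rho> \<Longrightarrow> norm (u p v) \<le> norm v"
    and \<gamma>: "0 < \<gamma>" "2 * \<gamma> \<le> \<rho>" and small: "4 * \<rho> \<le> 1" "324 * \<rho> / m * (14 * L) \<le> 1 / 2"
    and p: "p \<in> cball p0 \<rho>" "0 \<le> N" "norm (h p) \<le> N" "\<And>v. norm (u p v) \<le> N * norm v"
    and q: "q \<in> cball p0 \<rho>"
  shows "norm (h q) \<le> 2 * (N + 6 * \<kappa> * \<gamma> + 324 * \<rho> / m * (\<eta> / \<gamma>))"
    "norm (u q v) \<le> 2 * (N + 6 * \<kappa> * \<gamma> + 324 * \<rho> / m * (\<eta> / \<gamma>)) * norm v"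
proof -
  define A where "A = N + 6 * \<kappa> * \<gamma> + 324 * \<rho> / m * (\<eta> / \<gamma>)"
  interpret one: almost_isometry "cball p0 \<rho>" B' h u G L m \<eta> \<kappa> 1
    using h1 u1 by (intro AI) auto
  have \<rho>: "0 < \<rho>" using \<gamma> by linarith
  have A0: "0 \<le> A"
    using p(2) one.\<kappa>_nonneg one.\<eta>_nonneg one.m_pos \<gamma> \<rho> by (auto simp: A_def)
  define P where "P = (\<lambda>W. \<forall>q\<in>cball p0 \<rho>. norm (h q) \<le> W \<and> (\<forall>v. norm (u q v) \<le> W * norm v))"
  \<comment> \<open>One pass through the oscillation estimate halves the contribution of
    \<open>W\<close>: for \<open>u\<close> by the smallness of \<rho> relative to \<open>m\<close>
    and \<open>L\<close>, for \<open>h\<close> because the ball has diameter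
    \<open>2 * \<rho>\<close>, at most 1/2.\<close>
  have step: "P (A + W / 2)" if W: "0 \<le> W" "P W" for W
  proof -
    interpret almost_isometry "cball p0 \<rho>" B' h u G L m \<eta> \<kappa> W
      using W by (intro AI) (auto simp: P_def)
    have osc: "norm (u q v - u p v) \<le> (6 * \<kappa> * \<gamma> + 324 * \<rho> / m * (\<eta> / \<gamma> + 14 * L * W)) * norm v"
      if "q \<in> cball p0 \<rho>" for q v
      by (rule derivative_oscillation[OF refl \<gamma> that p(1)])
    have absorb: "324 * \<rho> / m * (14 * L * W) \<le> W / 2"
      using mult_right_mono[OF small(2) W(1)] by simp
    show ?thesis unfolding P_def
    proof (intro ballI conjI allI)
      fix q assume q: "q \<in> cball p0 \<rho>"
      fix v
      have "norm (u q v) \<le> norm (u p v) + norm (u q v - u p v)"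
        using norm_triangle_ineq[of "u p v" "u q v - u p v"] by simp
      also have "\<dots> \<le> N * norm v + (6 * \<kappa> * \<gamma> + 324 * \<rho> / m * (\<eta> / \<gamma> + 14 * L * W)) * norm v"
        using osc[OF q, of v] p(4)[of v] by linarith
      also have "\<dots> = (N + 6 * \<kappa> * \<gamma> + 324 * \<rho> / m * (\<eta> / \<gamma>) + 324 * \<rho> / m * (14 * L * W)) * norm v"
        by (simp add: distrib_left distrib_right)
      also have "\<dots> \<le> (A + W / 2) * norm v"
        using absorb by (intro mult_right_mono) (auto simp: A_def)
      finally show "norm (u q v) \<le> (A + W / 2) * norm v" .
    next
      fix q assume q: "q \<in> cball p0 \<rho>"
      have "norm (h q - h p) \<le> W * norm (q - p)"
        by (rule has_derivative_bound[OF convex_cball h_deriv u_bound q p(1)])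
      also have "\<dots> \<le> W * (2 * \<rho>)"
        using q p(1) W(1) norm_triangle_ineq4[of "q - p0" "p - p0"]
        by (intro mult_left_mono) (auto simp: dist_norm norm_minus_commute)
      also have "\<dots> \<le> W / 2" using small(1) mult_left_mono[OF small(1) W(1)] by simp
      finally have "norm (h q) \<le> norm (h p) + W / 2"
        using norm_triangle_ineq[of "h p" "h q - h p"] by simp
      moreover have "0 \<le> 6 * \<kappa> * \<gamma>" "0 \<le> 324 * \<rho> / m * (\<eta> / \<gamma>)"
        using one.\<kappa>_nonneg one.\<eta>_nonneg one.m_pos \<gamma> \<rho> by auto
      ultimately show "norm (h q) \<le> A + W / 2"
        using p(3) unfolding A_def by linarith
    qed
  qed
  \<comment> \<open>\<open>2 * A\<close> is the fixed point of the improvement from \<open>W\<close>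
    to \<open>A + W / 2\<close>. Iterating from the a priori bound 1 and passing to the limit
    replaces working with the best constant as a supremum.\<close>
  have Pn: "P (2 * A + 1 / 2 ^ n)" for n
  proof (induction n)
    case 0
    show ?case unfolding P_def
    proof (intro ballI conjI allI)
      fix q assume q: "q \<in> cball p0 \<rho>"
      show "norm (h q) \<le> 2 * A + 1 / 2 ^ 0" using h1[OF q] A0 by simp
      show "norm (u q v) \<le> (2 * A + 1 / 2 ^ 0) * norm v" for v
        using u1[OF q, of v] A0 mult_right_mono[of 1 "2 * A + 1" "norm v"] by simp
    qed
  next
    case (Suc n)
    have "P (A + (2 * A + 1 / 2 ^ n) / 2)" by (rule step) (use A0 Suc in auto)
    moreover have "A + (2 * A + 1 / 2 ^ n) / 2 = 2 * A + 1 / 2 ^ Suc n" by (simp add: field_simps)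
    ultimately show ?case by simp
  qed
  have lim: "(\<lambda>n. 2 * A + 1 / 2 ^ n) \<longlonglongrightarrow> 2 * A"
  proof -
    have "(\<lambda>n. 2 * A + (1 / 2 :: real) ^ n) \<longlonglongrightarrow> 2 * A + 0"
      by (intro tendsto_intros LIMSEQ_power_zero) auto
    then show ?thesis by (simp add: power_one_over)
  qed
  have "norm (h q) \<le> 2 * A"
    using Pn q by (intro LIMSEQ_le_const[OF lim]) (auto simp: P_def)
  moreover have "norm (u q v) \<le> 2 * A * norm v"
    using Pn q by (intro LIMSEQ_le_const[OF tendsto_mult_right[OF lim]]) (auto simp: P_def)
  ultimately show "norm (h q) \<le> 2 * (N + 6 * \<kappa> * \<gamma> + 324 * \<rho> / m * (\<eta> / \<gamma>))"
    "norm (u q v) \<le> 2 * (N + 6 * \<kappa> * \<gamma> + 324 * \<rho> / m * (\<eta> / \<gamma>)) * norm v"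
    by (auto simp: A_def)
qed

section \<open>Inner products on a Euclidean space\<close>

text \<open>Instances are the metric at a point read in a chart and the standard inner product, so
  both share one coefficient estimate.\<close>

locale inner_form =
  fixes B :: "'n::euclidean_space \<Rightarrow> 'n \<Rightarrow> real"
  assumes bil: "bilinear B" and sym: "B v w = B w v" and pos: "v \<noteq> 0 \<Longrightarrow> 0 < B v v"
begin

lemma nonneg: "0 \<le> B v v"
  using pos[of v] bilinear_lzero[OF bil, of 0] by (cases "v = 0") auto

lemma sum_left: "B (\<Sum>i\<in>I. c i *\<^sub>R e i) w = (\<Sum>i\<in>I. c i * B (e i) w)"
proof -
  have "linear (\<lambda>v. B v w)" using bil by (simp add: bilinear_def)
  then show ?thesis
    using linear_sum[of "\<lambda>v. B v w" "\<lambda>i. c i *\<^sub>R e i" I] linear_scale[of "\<lambda>v. B v w"] by simp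
qed

text \<open>Gram-Schmidt by induction on the index set: fewer than \<open>DIM('n)\<close> vectors do
  not span, so some vector lies outside their span, and projecting and normalizing it gives the next
  one. Indices are standard basis vectors, as in \<open>orthonormal_frame\<close>.\<close>

lemma orthonormal_on_exists:
  assumes "I \<subseteq> (Basis :: 'n set)"
  shows "\<exists>e. \<forall>i\<in>I. \<forall>j\<in>I. B (e i) (e j) = (if i = j then 1 else (0::real))"
  using finite_subset[OF assms finite_Basis] assms
proof (induction I rule: finite_induct)
  case (insert i I)
  then obtain e where e: "\<And>i j. i \<in> I \<Longrightarrow> j \<in> I \<Longrightarrow> B (e i) (e j) = (if i = j then 1 else (0::real))"
    by blast
  have "I \<subset> Basis" using insert by auto
  then have "card I < DIM('n)" by (rule psubset_card_mono[OF finite_Basis])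
  then have "card (e ` I) < DIM('n)"
    using card_image_le[OF insert(1), of e] by linarith
  then have "span (e ` I) \<noteq> UNIV"
    using dim_le_card'[of "e ` I"] insert(1) by (metis dim_UNIV dim_span finite_imageI leD)
  then obtain v where v: "v \<notin> span (e ` I)" by auto
  define w where "w = v - (\<Sum>j\<in>I. B v (e j) *\<^sub>R e j)"
  have "(\<Sum>j\<in>I. B v (e j) *\<^sub>R e j) \<in> span (e ` I)"
    by (intro span_sum span_scale span_base) auto
  then have "w \<noteq> 0" using v by (auto simp: w_def)
  then have pw: "0 < B w w" by (rule pos)
  have we: "B w (e j) = 0" if "j \<in> I" for j
  proof -
    have "B w (e j) = B v (e j) - (\<Sum>k\<in>I. B v (e k) * (if k = j then 1 else 0))"
      using e that by (simp add: w_def bilinear_lsub[OF bil] sum_left)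
    then show ?thesis using that insert(1) by (simp add: if_distrib cong: if_cong)
  qed
  define e' where "e' = e(i := (1 / sqrt (B w w)) *\<^sub>R w)"
  have "B (e' j) (e' k) = (if j = k then 1 else 0)" if "j \<in> insert i I" "k \<in> insert i I" for j k
    using that e we insert(2) pw
    by (auto simp: e'_def bilinear_lmul[OF bil] bilinear_rmul[OF bil] sym[of "e _" w] real_sqrt_mult_self[symmetric]
        simp del: real_sqrt_mult_self) (auto simp: divide_simps)
  then show ?case by blast
qed auto

definition orthonormal :: "('n \<Rightarrow> 'n) \<Rightarrow> bool" where
  "orthonormal e \<longleftrightarrow> (\<forall>i\<in>Basis. \<forall>j\<in>Basis. B (e i) (e j) = (if i = j then 1 else 0))"

lemma orthonormal_exists: "\<exists>e. orthonormal e"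
  using orthonormal_on_exists[OF order_refl] by (simp add: orthonormal_def)

lemma orthonormal_expansion:
  assumes "orthonormal e"
  shows "w = (\<Sum>i\<in>Basis. B w (e i) *\<^sub>R e i)"
proof -
  \<comment> \<open>Injective because pairing with \<open>e j\<close> recovers the coefficients,
    hence surjective by dimension: this is why \<open>e\<close> spans.\<close>
  define \<psi> where "\<psi> = (\<lambda>c::'n. \<Sum>i\<in>Basis. (c \<bullet> i) *\<^sub>R e i)"
  have coef: "B (\<psi> c) (e j) = c \<bullet> j" if "j \<in> Basis" for c j
  proof -
    have "B (\<psi> c) (e j) = (\<Sum>i\<in>Basis. (c \<bullet> i) * (if i = j then 1 else 0))"
      using assms that by (simp add: \<psi>_def sum_left orthonormal_def)
    then show ?thesis using that by (simp add: if_distrib cong: if_cong)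
  qed
  have lin: "linear \<psi>"
    by (auto simp: \<psi>_def linear_iff inner_add_left scaleR_add_left sum.distrib scaleR_sum_right)
  have "inj \<psi>"
    by (rule injI) (metis coef euclidean_eqI)
  then have "surj \<psi>" using linear_injective_imp_surjective[OF lin] by simp
  then obtain c where "w = \<psi> c" by blast
  then show ?thesis using coef by (simp add: \<psi>_def)
qed

lemma orthonormal_coefficient_bound:
  assumes "orthonormal e" "i \<in> Basis"
  shows "\<bar>B w (e i)\<bar> \<le> sqrt (B w w)"
proof -
  have "B w w = B (\<Sum>i\<in>Basis. B w (e i) *\<^sub>R e i) w"
    by (rule arg_cong[OF orthonormal_expansion[OF assms(1), of w], of "\<lambda>z. B z w"])
  also have "\<dots> = (\<Sum>i\<in>Basis. (B w (e i))\<^sup>2)"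
    by (simp add: sum_left power2_eq_square sym[of "e _" w])
  finally have "(B w (e i))\<^sup>2 \<le> B w w"
    using member_le_sum[of i Basis "\<lambda>i. (B w (e i))\<^sup>2"] assms by simp
  then show ?thesis by (metis real_sqrt_abs real_sqrt_le_iff)
qed

text \<open>Each coordinate in an orthonormal basis is at most the length of the vector, and there
  are \<open>(DIM('n))\<^sup>2\<close> pairs of coordinates.\<close>

lemma form_bound_by_coefficients:
  assumes e: "orthonormal e" and S: "bilinear S"
    and \<tau>: "\<And>i j. i \<in> Basis \<Longrightarrow> j \<in> Basis \<Longrightarrow> \<bar>S (e i) (e j)\<bar> \<le> \<tau>"
  shows "\<bar>S v w\<bar> \<le> (real DIM('n))\<^sup>2 * \<tau> * sqrt (B v v) * sqrt (B w w)"
proof -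
  have "S v w = S (\<Sum>i\<in>Basis. B v (e i) *\<^sub>R e i) (\<Sum>j\<in>Basis. B w (e j) *\<^sub>R e j)"
    using orthonormal_expansion[OF e] by simp
  also have "\<dots> = (\<Sum>(i, j)\<in>Basis \<times> Basis. B v (e i) * B w (e j) * S (e i) (e j))"
    unfolding bilinear_sum[OF S]
    by (simp add: bilinear_lmul[OF S] bilinear_rmul[OF S] mult_ac case_prod_unfold)
  finally have "\<bar>S v w\<bar> \<le> (\<Sum>(i, j)\<in>Basis \<times> Basis. \<bar>B v (e i) * B w (e j) * S (e i) (e j)\<bar>)"
    by (simp add: case_prod_unfold)
  also have "\<dots> \<le> (\<Sum>(i, j)\<in>(Basis::'n set) \<times> (Basis::'n set). sqrt (B v v) * sqrt (B w w) * \<tau>)"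
    using orthonormal_coefficient_bound[OF e] \<tau> nonneg
    by (intro sum_mono) (auto simp: abs_mult intro!: mult_mono)
  also have "\<dots> = (real DIM('n))\<^sup>2 * \<tau> * sqrt (B v v) * sqrt (B w w)"
    by (simp add: card_cartesian_product case_prod_unfold power2_eq_square)
  finally show ?thesis .
qed

end

section \<open>Charts and tangent spaces\<close>

abbreviation chart_image :: "('m, 'n) chart \<Rightarrow> 'n set" where
  "chart_image c \<equiv> chart_map c ` chart_dom c"

locale atlas =
  fixes M :: "'m::t2_space set" and A :: "('m, 'n::euclidean_space) chart set"
  assumes smooth_atlas: "smooth_atlas M A"
begin

abbreviation open_in_M :: "'m set \<Rightarrow> bool" where
  "open_in_M \<equiv> openin (top_of_set M)"

lemma
  assumes "c \<in> A"
  shows chart_dom_openin: "open_in_M (chart_dom c)"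
    and chart_image_open: "open (chart_image c)"
    and chart_homeomorphism: "homeomorphism (chart_dom c) (chart_image c) (chart_map c) (chart_inv c)"
  using smooth_atlas assms unfolding smooth_atlas_def chart_on_def by auto

lemma chart_dom_subset: "c \<in> A \<Longrightarrow> chart_dom c \<subseteq> M"
  using chart_dom_openin openin_imp_subset by blast

lemma chart_exists: "x \<in> M \<Longrightarrow> \<exists>c\<in>A. x \<in> chart_dom c"
  using smooth_atlas unfolding smooth_atlas_def by blast

lemma chart_inv_map [simp]: "c \<in> A \<Longrightarrow> x \<in> chart_dom c \<Longrightarrow> chart_inv c (chart_map c x) = x"
  using chart_homeomorphism unfolding homeomorphism_def by blast

lemma chart_map_inv [simp]: "c \<in> A \<Longrightarrow> p \<in> chart_image c \<Longrightarrow> chart_map c (chart_inv c p) = p"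
  using chart_homeomorphism unfolding homeomorphism_def by blast

lemma chart_inv_dom [simp]: "c \<in> A \<Longrightarrow> p \<in> chart_image c \<Longrightarrow> chart_inv c p \<in> chart_dom c"
  by auto

lemma continuous_on_chart_map: "c \<in> A \<Longrightarrow> continuous_on (chart_dom c) (chart_map c)"
  using chart_homeomorphism homeomorphism_def by blast

lemma chart_map_open_image:
  assumes c: "c \<in> A" and T: "open_in_M T" "T \<subseteq> chart_dom c"
  shows "open (chart_map c ` T)"
proof -
  have "openin (top_of_set (chart_dom c)) T"
    using T chart_dom_subset[OF c] by (meson openin_subset_trans)
  then have "openin (top_of_set (chart_image c)) (chart_map c ` T)"
    using chart_homeomorphism[OF c] homeomorphism_imp_open_map by blast
  then show ?thesis
    using chart_image_open[OF c] openin_open_trans by blast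
qed

lemma chart_inv_open_image:
  assumes c: "c \<in> A" and T: "open T" "T \<subseteq> chart_image c"
  shows "open_in_M (chart_inv c ` T)"
proof -
  have "openin (top_of_set (chart_image c)) T"
    by (rule open_subset[OF T(2,1)])
  then have "openin (top_of_set (chart_dom c)) (chart_inv c ` T)"
    using chart_homeomorphism[OF c] homeomorphism_imp_open_map homeomorphism_symD by blast
  then show ?thesis
    using chart_dom_openin[OF c] openin_trans by blast
qed

lemma overlap_openin:
  "c \<in> A \<Longrightarrow> d \<in> A \<Longrightarrow> open_in_M (chart_dom c \<inter> chart_dom d)"
  by (intro openin_Int chart_dom_openin)

lemma overlap_image_open:
  "c \<in> A \<Longrightarrow> d \<in> A \<Longrightarrow> open (chart_map c ` (chart_dom c \<inter> chart_dom d))"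
  by (intro chart_map_open_image overlap_openin) auto

lemma transition_Ck:
  "c \<in> A \<Longrightarrow> d \<in> A \<Longrightarrow> Ck_on k (chart_map c ` (chart_dom c \<inter> chart_dom d)) (transition c d)"
  using smooth_atlas unfolding smooth_atlas_def smooth_on_def by blast

lemma transition_differentiable:
  "c \<in> A \<Longrightarrow> d \<in> A \<Longrightarrow> x \<in> chart_dom c \<Longrightarrow> x \<in> chart_dom d \<Longrightarrow>
    transition c d differentiable (at (chart_map c x))"
  using transition_Ck[of c d 1] by auto

lemma transition_apply [simp]:
  "c \<in> A \<Longrightarrow> x \<in> chart_dom c \<Longrightarrow> transition c d (chart_map c x) = chart_map d x"
  by (simp add: transition_def)

lemma transition_self:
  assumes "c \<in> A" "x \<in> chart_dom c"
  shows "fderiv (transition c c) (chart_map c x) = (\<lambda>v. v)"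
proof -
  have "fderiv (transition c c) (chart_map c x) = fderiv (\<lambda>p. p) (chart_map c x)"
    using assms chart_image_open[OF assms(1)]
    by (intro frechet_derivative_cong_open[of "chart_image c"]) (auto simp: transition_def)
  then show ?thesis by simp
qed

lemma chart_change_eq:
  assumes "c \<in> A" "d \<in> A" "q \<in> chart_map c ` (chart_dom c \<inter> chart_dom d)"
  shows "(\<phi> \<circ> chart_inv c) q = (\<phi> \<circ> chart_inv d) (transition c d q)"
  using assms by (auto simp: transition_def)

text \<open>The target of \<open>\<phi>\<close> is arbitrary, so that one chain rule covers
  coordinate maps, \<open>f\<close> followed by a coordinate map, and the ambient
  displacement.\<close>

lemma chart_change_has_derivative:
  assumes c: "c \<in> A" "x \<in> chart_dom c" and d: "d \<in> A" "x \<in> chart_dom d"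
    and \<phi>: "(\<phi> \<circ> chart_inv d) differentiable (at (chart_map d x))"
  shows "((\<phi> \<circ> chart_inv c) has_derivative
    (\<lambda>v. fderiv (\<phi> \<circ> chart_inv d) (chart_map d x)
       (fderiv (transition c d) (chart_map c x) v))) (at (chart_map c x))"
proof -
  define \<psi> where "\<psi> = \<phi> \<circ> chart_inv d"
  have \<psi>: "(\<psi> has_derivative fderiv \<psi> (chart_map d x)) (at (transition c d (chart_map c x)))"
    using has_fderiv[OF \<phi>] c by (simp add: \<psi>_def)
  have "((\<lambda>q. \<psi> (transition c d q)) has_derivative
    (\<lambda>v. fderiv \<psi> (chart_map d x)
       (fderiv (transition c d) (chart_map c x) v))) (at (chart_map c x))"
    by (rule has_derivative_compose[OF has_fderiv[OF transition_differentiable[OF c(1) d(1) c(2) d(2)]] \<psi>])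
  then show ?thesis unfolding \<psi>_def
    by (rule has_derivative_transform_within_open[OF _ overlap_image_open[OF c(1) d(1)]])
      (use c d chart_change_eq[OF c(1) d(1), of _ \<phi>] in auto)
qed

lemma chart_change_derivative:
  assumes "c \<in> A" "x \<in> chart_dom c" "d \<in> A" "x \<in> chart_dom d"
    and "(\<phi> \<circ> chart_inv d) differentiable (at (chart_map d x))"
  shows "fderiv (\<phi> \<circ> chart_inv c) (chart_map c x) v =
    fderiv (\<phi> \<circ> chart_inv d) (chart_map d x)
       (fderiv (transition c d) (chart_map c x) v)"
  by (simp add: frechet_derivative_at[OF chart_change_has_derivative[OF assms], symmetric])

lemma transition_chain:
  assumes "c \<in> A" "x \<in> chart_dom c" "d \<in> A" "x \<in> chart_dom d" "e \<in> A" "x \<in> chart_dom e"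
  shows "fderiv (transition c e) (chart_map c x) v =
    fderiv (transition d e) (chart_map d x)
       (fderiv (transition c d) (chart_map c x) v)"
  using chart_change_derivative[of c x d "chart_map e" v] transition_differentiable[of d e x] assms
  by (simp add: transition_def)

lemma coord_vec_tangent:
  assumes "c \<in> A" "x \<in> chart_dom c"
  shows "coord_vec A c x w \<in> tangent_space A x"
proof -
  have "coord_vec A c x w e = fderiv (transition d e) (chart_map d x) (coord_vec A c x w d)"
    if "d \<in> A" "e \<in> A" "x \<in> chart_dom d" "x \<in> chart_dom e" for d e
    using transition_chain[OF assms that(1,3) that(2,4), of w] that by (simp add: coord_vec_def)
  moreover have "coord_vec A c x w d = 0" if "d \<notin> A \<or> x \<notin> chart_dom d" for d
    using that by (auto simp: coord_vec_def)
  ultimately show ?thesis unfolding tangent_space_def by blast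
qed

lemma coord_vec_self: "c \<in> A \<Longrightarrow> x \<in> chart_dom c \<Longrightarrow> coord_vec A c x w c = w"
  by (simp add: coord_vec_def transition_self)

lemma tangent_eq_coord_vec:
  assumes "c \<in> A" "x \<in> chart_dom c" "v \<in> tangent_space A x"
  shows "v = coord_vec A c x (v c)"
proof
  fix d
  show "v d = coord_vec A c x (v c) d"
  proof (cases "d \<in> A \<and> x \<in> chart_dom d")
    case True
    then have "v d = fderiv (transition c d) (chart_map c x) (v c)"
      using assms unfolding tangent_space_def by blast
    then show ?thesis using True by (simp add: coord_vec_def)
  next
    case False
    then have "v d = 0" using assms(3) unfolding tangent_space_def by blast
    then show ?thesis using False by (auto simp: coord_vec_def)
  qed
qed

lemma coord_vec_linear:
  assumes "c \<in> A" "x \<in> chart_dom c"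
  shows "coord_vec A c x (a *\<^sub>R v + b *\<^sub>R w) = (\<lambda>d. a *\<^sub>R coord_vec A c x v d + b *\<^sub>R coord_vec A c x w d)"
proof
  fix d
  show "coord_vec A c x (a *\<^sub>R v + b *\<^sub>R w) d = a *\<^sub>R coord_vec A c x v d + b *\<^sub>R coord_vec A c x w d"
  proof (cases "d \<in> A \<and> x \<in> chart_dom d")
    case True
    then have "linear (fderiv (transition c d) (chart_map c x))"
      using assms by (intro linear_frechet_derivative transition_differentiable) auto
    then show ?thesis using True by (simp add: coord_vec_def linear_add linear_scale)
  qed (auto simp: coord_vec_def)
qed

lemma openin_preimage_chart:
  assumes f: "f ` M \<subseteq> M" "continuous_on M f" and c: "c \<in> A" "d \<in> A"
  shows "open_in_M (chart_dom c \<inter> f -` chart_dom d)"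
proof -
  have "open_in_M (M \<inter> f -` chart_dom d)"
    using f chart_dom_openin[OF c(2)] by (intro continuous_openin_preimage) auto
  then have "open_in_M (chart_dom c \<inter> (M \<inter> f -` chart_dom d))"
    by (rule openin_Int[OF chart_dom_openin[OF c(1)]])
  moreover have "chart_dom c \<inter> (M \<inter> f -` chart_dom d) = chart_dom c \<inter> f -` chart_dom d"
    using chart_dom_subset[OF c(1)] by auto
  ultimately show ?thesis by simp
qed

end

section \<open>Self-maps of class C2 and their differentials in charts\<close>

locale atlas_map = atlas M A for M :: "'m::t2_space set" and A :: "('m, 'n::euclidean_space) chart set" +
  fixes f :: "'m \<Rightarrow> 'm"
  assumes C2: "Ck_self_map 2 M A f"
begin

lemma f_maps: "x \<in> M \<Longrightarrow> f x \<in> M" and f_cont: "continuous_on M f"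
  using C2 unfolding Ck_self_map_def by auto

lemma f_dom_open: "c \<in> A \<Longrightarrow> d \<in> A \<Longrightarrow> open (chart_map c ` (chart_dom c \<inter> f -` chart_dom d))"
  using f_maps f_cont by (intro chart_map_open_image openin_preimage_chart) auto

lemma f_Ck: "c \<in> A \<Longrightarrow> d \<in> A \<Longrightarrow>
    Ck_on 2 (chart_map c ` (chart_dom c \<inter> f -` chart_dom d)) (chart_map d \<circ> f \<circ> chart_inv c)"
  using C2 unfolding Ck_self_map_def by auto

lemma f_differentiable:
  assumes "c \<in> A" "d \<in> A" "x \<in> chart_dom c" "f x \<in> chart_dom d"
  shows "(chart_map d \<circ> f \<circ> chart_inv c) differentiable (at (chart_map c x))"
  using f_Ck[OF assms(1,2)] assms by (simp add: numeral_2_eq_2)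

lemma f_post_change:
  assumes c: "c \<in> A" "x \<in> chart_dom c" and d: "d \<in> A" "f x \<in> chart_dom d"
    and \<phi>: "(\<phi> \<circ> chart_inv d) differentiable (at (chart_map d (f x)))"
  shows "((\<phi> \<circ> f \<circ> chart_inv c) has_derivative
    (\<lambda>v. fderiv (\<phi> \<circ> chart_inv d) (chart_map d (f x))
       (fderiv (chart_map d \<circ> f \<circ> chart_inv c) (chart_map c x) v))) (at (chart_map c x))"
proof -
  define \<psi> F where "\<psi> = \<phi> \<circ> chart_inv d" and "F = chart_map d \<circ> f \<circ> chart_inv c"
  have \<psi>: "(\<psi> has_derivative fderiv \<psi> (chart_map d (f x))) (at (F (chart_map c x)))"
    using has_fderiv[OF \<phi>] c by (simp add: \<psi>_def F_def)
  have "((\<lambda>q. \<psi> (F q)) has_derivative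
    (\<lambda>v. fderiv \<psi> (chart_map d (f x))
       (fderiv F (chart_map c x) v))) (at (chart_map c x))"
    unfolding F_def
    by (rule has_derivative_compose[OF has_fderiv[OF f_differentiable[OF c(1) d(1) c(2) d(2)]] \<psi>[unfolded F_def]])
  then show ?thesis unfolding \<psi>_def F_def
    by (rule has_derivative_transform_within_open[OF _ f_dom_open[OF c(1) d(1)]]) (use c d in auto)
qed

text \<open>\<open>differential\<close> reads its argument in an arbitrarily selected chart. Two
  chain rules remove this choice: one moves the source from the selected chart to \<open>c\<close>,
  the other factors the target chart \<open>e\<close> through \<open>d\<close>.\<close>

lemma differential_coord_vec:
  assumes c: "c \<in> A" "x \<in> chart_dom c" and d: "d \<in> A" "f x \<in> chart_dom d"
  shows "differential A f x (coord_vec A c x w) =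
    coord_vec A d (f x) (fderiv (chart_map d \<circ> f \<circ> chart_inv c) (chart_map c x) w)"
proof
  fix e
  define c0 where "c0 = (SOME c. c \<in> A \<and> x \<in> chart_dom c)"
  have c0: "c0 \<in> A" "x \<in> chart_dom c0"
    using someI[of "\<lambda>c. c \<in> A \<and> x \<in> chart_dom c" c] c by (auto simp: c0_def)
  show "differential A f x (coord_vec A c x w) e =
    coord_vec A d (f x) (fderiv (chart_map d \<circ> f \<circ> chart_inv c) (chart_map c x) w) e"
  proof (cases "e \<in> A \<and> f x \<in> chart_dom e")
    case True
    have "differential A f x (coord_vec A c x w) e =
        fderiv (chart_map e \<circ> f \<circ> chart_inv c0) (chart_map c0 x)
          (fderiv (transition c c0) (chart_map c x) w)"
      using True c0 by (simp add: differential_def c0_def[symmetric] coord_vec_def)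
    also have "\<dots> = fderiv (chart_map e \<circ> f \<circ> chart_inv c) (chart_map c x) w"
      using chart_change_derivative[OF c c0, of "chart_map e \<circ> f" w] f_differentiable[of c0 e x] c0 True
      by simp
    also have "\<dots> = fderiv (transition d e) (chart_map d (f x))
       (fderiv (chart_map d \<circ> f \<circ> chart_inv c) (chart_map c x) w)"
      using frechet_derivative_at[OF f_post_change[OF c d, of "chart_map e"], symmetric]
        transition_differentiable[of d e "f x"] d True by (simp add: transition_def)
    finally show ?thesis using True by (simp add: coord_vec_def)
  next
    case False
    then show ?thesis by (auto simp: differential_def coord_vec_def Let_def)
  qed
qed

end

section \<open>The metric in coordinates\<close>

definition gcoord ::
    "('m, 'n::euclidean_space) chart set \<Rightarrow> ('m, 'n) form_field \<Rightarrow> ('m, 'n) chart \<Rightarrow> 'n \<Rightarrow> 'n \<Rightarrow> 'n \<Rightarrow> real" where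
  "gcoord A g c p u v =
     g (chart_inv c p) (coord_vec A c (chart_inv c p) u) (coord_vec A c (chart_inv c p) v)"

locale riemannian_atlas = atlas M A for M :: "'m::t2_space set" and A :: "('m, 'n::euclidean_space) chart set" +
  fixes g :: "('m, 'n) form_field"
  assumes metric: "riemannian_metric M A g"
begin

lemma gcoord_Ck: "c \<in> A \<Longrightarrow> Ck_on k (chart_image c) (\<lambda>p. gcoord A g c p u v)"
  using metric unfolding riemannian_metric_def smooth_on_def gcoord_def by blast

lemma gcoord_at:
  "c \<in> A \<Longrightarrow> x \<in> chart_dom c \<Longrightarrow> gcoord A g c (chart_map c x) u v = g x (coord_vec A c x u) (coord_vec A c x v)"
  by (simp add: gcoord_def)

lemma gcoord_inner_product:
  assumes c: "c \<in> A" and p: "p \<in> chart_image c"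
  shows "inner_form (gcoord A g c p)"
proof -
  obtain x where x: "x \<in> chart_dom c" "p = chart_map c x" using p by auto
  then have xM: "x \<in> M" using chart_dom_subset[OF c] by auto
  note tv = coord_vec_tangent[OF c x(1)]
  have sym: "gcoord A g c p v w = gcoord A g c p w v" for v w
    using metric xM tv unfolding riemannian_metric_def x(2) gcoord_at[OF c x(1)] by blast
  have lin1: "gcoord A g c p (a *\<^sub>R u + b *\<^sub>R v) w = a * gcoord A g c p u w + b * gcoord A g c p v w" for a b u v w
    using metric xM tv unfolding riemannian_metric_def x(2) gcoord_at[OF c x(1)] coord_vec_linear[OF c x(1)]
    by blast
  have lin: "linear (\<lambda>v. gcoord A g c p v w)" for w
    using lin1[of 1 _ 1 _ w] lin1[of _ _ 0 0 w] by (intro linearI) (auto)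
  have "(\<lambda>v. gcoord A g c p v w) = gcoord A g c p w" for w
    using sym by (intro ext)
  then have "bilinear (gcoord A g c p)"
    unfolding bilinear_def using lin by metis
  moreover have "0 < gcoord A g c p v v" if "v \<noteq> 0" for v
  proof -
    have "coord_vec A c x v \<noteq> (\<lambda>_. 0)"
      using coord_vec_self[OF c x(1), of v] that by auto
    then show ?thesis
      using metric xM tv unfolding riemannian_metric_def x(2) gcoord_at[OF c x(1)] by blast
  qed
  ultimately show ?thesis using sym by unfold_locales
qed

lemma orthonormal_frame_coord:
  assumes c: "c \<in> A" "x \<in> chart_dom c" and E: "orthonormal_frame A g x E"
  shows "inner_form.orthonormal (gcoord A g c (chart_map c x)) (\<lambda>i. E i c)"
    "i \<in> Basis \<Longrightarrow> E i = coord_vec A c x (E i c)"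
proof -
  interpret inner_form "gcoord A g c (chart_map c x)"
    using c by (intro gcoord_inner_product) auto
  show *: "i \<in> Basis \<Longrightarrow> E i = coord_vec A c x (E i c)" for i
    using E c unfolding orthonormal_frame_def by (intro tangent_eq_coord_vec) auto
  show "orthonormal (\<lambda>i. E i c)"
    using E unfolding orthonormal_def orthonormal_frame_def gcoord_at[OF c]
    by (simp only: *[symmetric] cong: ball_cong) simp
qed

lemma some_frame: "x \<in> M \<Longrightarrow> orthonormal_frame A g x (some_frame A g x)"
proof -
  assume "x \<in> M"
  then obtain c where c: "c \<in> A" "x \<in> chart_dom c" using chart_exists by blast
  interpret inner_form "gcoord A g c (chart_map c x)"
    using c by (intro gcoord_inner_product) auto
  obtain e where "orthonormal e" using orthonormal_exists by blast
  then have "orthonormal_frame A g x (\<lambda>i. coord_vec A c x (e i))"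
    using c unfolding orthonormal_def orthonormal_frame_def gcoord_at[OF c]
    by (auto intro: coord_vec_tangent)
  then show ?thesis unfolding some_frame_def by (rule someI[of "orthonormal_frame A g x"])
qed

lemma abs_le_hs_norm_form:
  assumes "i \<in> Basis" "j \<in> Basis"
  shows "\<bar>T (some_frame A g x i) (some_frame A g x j)\<bar> \<le> hs_norm_form A g x T"
proof -
  let ?t = "\<lambda>i j. (T (some_frame A g x i) (some_frame A g x j))\<^sup>2"
  have "?t i j \<le> (\<Sum>j\<in>Basis. ?t i j)" using assms by (intro member_le_sum) auto
  also have "\<dots> \<le> (\<Sum>i\<in>Basis. \<Sum>j\<in>Basis. ?t i j)"
    using assms by (intro member_le_sum[of i Basis "\<lambda>i. \<Sum>j\<in>Basis. ?t i j"] sum_nonneg) auto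
  finally show ?thesis unfolding hs_norm_form_def by (metis real_sqrt_abs real_sqrt_le_iff)
qed

lemma hs_norm_form_nonneg: "0 \<le> hs_norm_form A g x T"
  unfolding hs_norm_form_def by (intro real_sqrt_ge_zero sum_nonneg) auto

text \<open>\<open>T\<close> acts on tangent vectors, encoded as families over charts, and is
  meaningful only on the tangent space. \<open>S\<close> is its coordinate version on the whole
  model space, where bilinearity can be stated and the coefficient estimate applies.\<close>

lemma form_le_hs_norm:
  assumes c: "c \<in> A" "x \<in> chart_dom c"
    and S: "bilinear S" "\<And>u v. S u v = T (coord_vec A c x u) (coord_vec A c x v)"
  shows "\<bar>S v w\<bar> \<le> (real DIM('n))\<^sup>2 * hs_norm_form A g x T *
    sqrt (gcoord A g c (chart_map c x) v v) * sqrt (gcoord A g c (chart_map c x) w w)"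
proof -
  interpret inner_form "gcoord A g c (chart_map c x)"
    using c by (intro gcoord_inner_product) auto
  have E: "orthonormal_frame A g x (some_frame A g x)"
    using c chart_dom_subset[OF c(1)] by (intro some_frame) blast
  note E' = orthonormal_frame_coord[OF c E]
  show ?thesis
  proof (rule form_bound_by_coefficients[OF E'(1) S(1)])
    fix i j :: 'n assume "i \<in> Basis" "j \<in> Basis"
    then show "\<bar>S (some_frame A g x i c) (some_frame A g x j c)\<bar> \<le> hs_norm_form A g x T"
      using abs_le_hs_norm_form[of i j T x] E'(2)[of i] E'(2)[of j] unfolding S(2) by simp
  qed
qed

text \<open>The converse comparison, tested on unit vectors because the members of an orthonormal
  frame are such. It serves to show that the supremum in \<open>field_norm\<close> is over a bounded
  set.\<close>

lemma hs_norm_le: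
  assumes c: "c \<in> A" "x \<in> chart_dom c" and "0 \<le> (\<tau>::real)"
    and T: "\<And>u v. gcoord A g c (chart_map c x) u u = 1 \<Longrightarrow> gcoord A g c (chart_map c x) v v = 1 \<Longrightarrow>
       \<bar>T (coord_vec A c x u) (coord_vec A c x v)\<bar> \<le> \<tau>"
  shows "hs_norm_form A g x T \<le> real DIM('n) * \<tau>"
proof -
  interpret inner_form "gcoord A g c (chart_map c x)"
    using c by (intro gcoord_inner_product) auto
  have E: "orthonormal_frame A g x (some_frame A g x)"
    using c chart_dom_subset[OF c(1)] by (intro some_frame) blast
  note E' = orthonormal_frame_coord[OF c E]
  have "\<bar>T (some_frame A g x i) (some_frame A g x j)\<bar> \<le> \<tau>" if "i \<in> Basis" "j \<in> Basis" for i j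
    using T[of "some_frame A g x i c" "some_frame A g x j c"] E'(1) that
    unfolding E'(2)[OF that(1), symmetric] E'(2)[OF that(2), symmetric] orthonormal_def by simp
  then have "(\<Sum>i\<in>Basis. \<Sum>j\<in>Basis. (T (some_frame A g x i) (some_frame A g x j))\<^sup>2) \<le>
      (\<Sum>i\<in>(Basis::'n set). \<Sum>j\<in>(Basis::'n set). \<tau>\<^sup>2)"
    using \<open>0 \<le> \<tau>\<close> by (intro sum_mono) (metis abs_le_square_iff abs_of_nonneg)
  also have "\<dots> = (real DIM('n) * \<tau>)\<^sup>2" by (simp add: power_mult_distrib power2_eq_square)
  finally have "hs_norm_form A g x T \<le> sqrt ((real DIM('n) * \<tau>)\<^sup>2)"
    unfolding hs_norm_form_def by (rule real_sqrt_le_mono)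
  then show ?thesis using \<open>0 \<le> \<tau>\<close> by simp
qed

end

locale riemannian_atlas_map = riemannian_atlas M A g + atlas_map M A f
  for M :: "'m::t2_space set" and A :: "('m, 'n::euclidean_space) chart set" and g f
begin

lemma pullback_coord:
  assumes c: "c \<in> A" "x \<in> chart_dom c" and d: "d \<in> A" "f x \<in> chart_dom d"
  shows "pullback A f g x (coord_vec A c x u) (coord_vec A c x v) =
    gcoord A g d (chart_map d (f x))
      (fderiv (chart_map d \<circ> f \<circ> chart_inv c) (chart_map c x) u)
      (fderiv (chart_map d \<circ> f \<circ> chart_inv c) (chart_map c x) v)"
  by (simp add: pullback_def differential_coord_vec[OF assms] gcoord_at[OF d])

end

section \<open>Displacements measured through an immersion\<close>

lemma bilinear_bound_Basis:
  fixes S :: "'n::euclidean_space \<Rightarrow> 'n \<Rightarrow> real"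
  assumes S: "bilinear S" and \<tau>: "\<And>i j. i \<in> Basis \<Longrightarrow> j \<in> Basis \<Longrightarrow> \<bar>S i j\<bar> \<le> \<tau>"
  shows "\<bar>S v w\<bar> \<le> (real DIM('n))\<^sup>2 * \<tau> * norm v * norm w"
proof -
  interpret inner_form "\<lambda>v w :: 'n. v \<bullet> w"
    by unfold_locales (auto simp: bilinear_def linear_iff inner_commute algebra_simps)
  have "orthonormal (\<lambda>i. i)" by (auto simp: orthonormal_def inner_Basis)
  from form_bound_by_coefficients[OF this S \<tau>] show ?thesis
    by (simp add: norm_eq_sqrt_inner)
qed

text \<open>The C2 distance measures the ambient difference
  \<open>\<psi> (p + h p) - \<psi> p\<close>, the chart estimate needs \<open>h\<close> and its
  derivative \<open>u\<close>. The lower bounds with \<mu> allow solving for \<open>h\<close> and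
  \<open>u\<close>; the bounds on second derivatives of \<open>\<psi>\<close> are what makes
  \<open>u\<close> Lipschitz.\<close>

locale immersed_displacement =
  fixes B B' :: "'n::euclidean_space set" and \<psi> :: "'n \<Rightarrow> 'e::euclidean_space" and \<psi>' \<psi>''
    and h :: "'n \<Rightarrow> 'n" and u :: "'n \<Rightarrow> 'n \<Rightarrow> 'n" and L \<mu> \<kappa> :: real
  assumes convex_B: "convex B" and B_sub: "B \<subseteq> B'" and maps: "\<And>p. p \<in> B \<Longrightarrow> p + h p \<in> B'"
    and \<psi>_deriv: "\<And>p. p \<in> B' \<Longrightarrow> (\<psi> has_derivative \<psi>' p) (at p)"
    and \<psi>'_deriv: "\<And>p b. p \<in> B' \<Longrightarrow> b \<in> Basis \<Longrightarrow> ((\<lambda>p. \<psi>' p b) has_derivative \<psi>'' b p) (at p)"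
    and \<psi>_lip: "\<And>p q. p \<in> B' \<Longrightarrow> q \<in> B' \<Longrightarrow> norm (\<psi> p - \<psi> q) \<le> L * norm (p - q)"
    and \<psi>'_bound: "\<And>p v. p \<in> B' \<Longrightarrow> norm (\<psi>' p v) \<le> L * norm v"
    and \<psi>'_lip: "\<And>p q v. p \<in> B' \<Longrightarrow> q \<in> B' \<Longrightarrow> norm (\<psi>' p v - \<psi>' q v) \<le> L * norm (p - q) * norm v"
    and \<psi>''_bound: "\<And>p b v. p \<in> B' \<Longrightarrow> b \<in> Basis \<Longrightarrow> norm (\<psi>'' b p v) \<le> L * norm v"
    and \<psi>''_lip: "\<And>p q b v. p \<in> B' \<Longrightarrow> q \<in> B' \<Longrightarrow> b \<in> Basis \<Longrightarrow>
       norm (\<psi>'' b p v - \<psi>'' b q v) \<le> L * norm (p - q) * norm v"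
    and lower: "\<And>p q. p \<in> B' \<Longrightarrow> q \<in> B' \<Longrightarrow> \<mu> * norm (p - q) \<le> norm (\<psi> p - \<psi> q)"
    and lower': "\<And>p v. p \<in> B' \<Longrightarrow> \<mu> * norm v \<le> norm (\<psi>' p v)"
    and h_deriv: "\<And>p. p \<in> B \<Longrightarrow> (h has_derivative u p) (at p)"
    and L_nonneg: "0 \<le> L" and \<mu>_pos: "0 < \<mu>" and \<kappa>_nonneg: "0 \<le> \<kappa>"
begin

definition DH :: "'n \<Rightarrow> 'n \<Rightarrow> 'e" where
  "DH p v = \<psi>' (p + h p) (v + u p v) - \<psi>' p v"

lemma H_deriv: "p \<in> B \<Longrightarrow> ((\<lambda>p. \<psi> (p + h p) - \<psi> p) has_derivative DH p) (at p)"
  unfolding DH_def using B_sub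
  by (intro has_derivative_diff \<psi>_deriv has_derivative_compose[where f="\<lambda>p. p + h p" and g=\<psi>])
    (auto intro!: derivative_intros h_deriv maps)

lemma h_le: "p \<in> B \<Longrightarrow> norm (h p) \<le> norm (\<psi> (p + h p) - \<psi> p) / \<mu>"
  using lower[of "p + h p" p] maps[of p] B_sub \<mu>_pos by (auto simp: field_simps)

lemma \<psi>'_linear: "p \<in> B' \<Longrightarrow> linear (\<psi>' p)"
  using has_derivative_linear[OF \<psi>_deriv] .

text \<open>Solve the definition of \<open>DH\<close> for \<open>\<psi>' (p + h p) (u p v)\<close>;
  what remains is the change of \<open>\<psi>'\<close> over the distance
  \<open>norm (h p)\<close>.\<close>

lemma u_le:
  assumes "p \<in> B"
  shows "norm (u p v) \<le> (norm (DH p v) + L * norm (h p) * norm v) / \<mu>"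
proof -
  have in': "p \<in> B'" "p + h p \<in> B'" using assms B_sub maps by auto
  have "\<mu> * norm (u p v) \<le> norm (\<psi>' (p + h p) (u p v))"
    by (rule lower'[OF in'(2)])
  also have "\<psi>' (p + h p) (u p v) = DH p v - (\<psi>' (p + h p) v - \<psi>' p v)"
    by (simp add: DH_def linear_add[OF \<psi>'_linear[OF in'(2)]])
  also have "norm \<dots> \<le> norm (DH p v) + norm (\<psi>' (p + h p) v - \<psi>' p v)"
    by (rule norm_triangle_ineq4)
  also have "norm (\<psi>' (p + h p) v - \<psi>' p v) \<le> L * norm (h p) * norm v"
    using \<psi>'_lip[OF in'(2,1), of v] by simp
  finally show ?thesis using \<mu>_pos by (simp add: field_simps)
qed

text \<open>The constant comes from \<open>(N + L * (N / \<mu>)) / \<mu>\<close>: the bound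
  \<open>N / \<mu>\<close> on \<open>h\<close> enters the bound on \<open>u\<close> once
  more.\<close>

lemma displacement_le:
  assumes "p \<in> B" "norm (\<psi> (p + h p) - \<psi> p) \<le> N" "\<And>v. norm (DH p v) \<le> N * norm v"
  shows "norm (h p) \<le> (1 + L / \<mu>) / \<mu> * N" "norm (u p v) \<le> (1 + L / \<mu>) / \<mu> * N * norm v"
proof -
  have N: "0 \<le> N" using assms(2) norm_ge_zero order_trans by blast
  have h: "norm (h p) \<le> N / \<mu>"
    using h_le[OF assms(1)] assms(2) \<mu>_pos by (meson divide_right_mono less_imp_le order_trans)
  also have "\<dots> \<le> (1 + L / \<mu>) * (N / \<mu>)"
    using mult_right_mono[of 1 "1 + L / \<mu>" "N / \<mu>"] L_nonneg \<mu>_pos N by simp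
  finally show "norm (h p) \<le> (1 + L / \<mu>) / \<mu> * N" by simp
  have "norm (u p v) \<le> (norm (DH p v) + L * norm (h p) * norm v) / \<mu>"
    by (rule u_le[OF assms(1)])
  also have "\<dots> \<le> (N * norm v + L * (N / \<mu>) * norm v) / \<mu>"
    using assms(3) h L_nonneg \<mu>_pos by (intro divide_right_mono add_mono mult_right_mono mult_left_mono) auto
  also have "\<dots> = (1 + L / \<mu>) / \<mu> * N * norm v" using \<mu>_pos by (simp add: field_simps)
  finally show "norm (u p v) \<le> (1 + L / \<mu>) / \<mu> * N * norm v" .
qed

lemma DH_le:
  assumes "p \<in> B" "norm (h p) \<le> Q" "\<And>v. norm (u p v) \<le> Q * norm v"
  shows "norm (\<psi> (p + h p) - \<psi> p) \<le> L * Q" "norm (DH p v) \<le> 2 * L * Q * norm v"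
proof -
  have in': "p \<in> B'" "p + h p \<in> B'" using assms B_sub maps by auto
  show "norm (\<psi> (p + h p) - \<psi> p) \<le> L * Q"
    using \<psi>_lip[OF in'(2,1)] mult_left_mono[OF assms(2) L_nonneg] by simp
  have "DH p v = (\<psi>' (p + h p) v - \<psi>' p v) + \<psi>' (p + h p) (u p v)"
    by (simp add: DH_def linear_add[OF \<psi>'_linear[OF in'(2)]])
  also have "norm \<dots> \<le> L * norm (h p) * norm v + L * norm (u p v)"
    using \<psi>'_lip[OF in'(2,1), of v] \<psi>'_bound[OF in'(2), of "u p v"] by (intro norm_triangle_mono) auto
  also have "\<dots> \<le> L * Q * norm v + L * (Q * norm v)"
    using assms(2,3) L_nonneg by (intro add_mono mult_left_mono mult_right_mono) auto
  finally show "norm (DH p v) \<le> 2 * L * Q * norm v" by simp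
qed

text \<open>The Lipschitz constant has to be linear in \<kappa>. Solving
  \<open>DH p v - DH q v\<close> for the difference of \<open>u\<close> leaves the increment
  \<open>I\<close> of \<open>\<psi>'\<close> along the displacement and the change of
  \<open>\<psi>'\<close> acting on \<open>u q v\<close>. Both carry a factor \<open>W\<close>, hence
  \<kappa>, and give the summands \<open>2 * DIM('n)\<close> and 2.\<close>

lemma u_lipschitz:
  assumes H: "\<And>p. p \<in> B \<Longrightarrow> norm (\<psi> (p + h p) - \<psi> p) \<le> \<kappa>"
    and DH: "\<And>p v. p \<in> B \<Longrightarrow> norm (DH p v) \<le> \<kappa> * norm v"
    and DHl: "\<And>p q v. p \<in> B \<Longrightarrow> q \<in> B \<Longrightarrow> norm (DH p v - DH q v) \<le> \<kappa> * norm (p - q) * norm v"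
    and W: "W = (1 + L / \<mu>) / \<mu> * \<kappa>" "W \<le> 1" and pq: "p \<in> B" "q \<in> B"
  shows "norm (u p v - u q v) \<le> (1 + (2 * DIM('n) + 2) * L * ((1 + L / \<mu>) / \<mu>)) / \<mu> * \<kappa> * norm (p - q) * norm v"
proof -
  have in': "p \<in> B'" "p + h p \<in> B'" "q \<in> B'" "q + h q \<in> B'" using pq B_sub maps by auto
  have W0: "0 \<le> W" using W L_nonneg \<mu>_pos \<kappa>_nonneg by auto
  have hW: "norm (h p) \<le> W" if "p \<in> B" for p
    using displacement_le(1)[OF that H[OF that] DH[OF that]] W by simp
  have uW: "norm (u p v) \<le> W * norm v" if "p \<in> B" for p v
    using displacement_le(2)[OF that H[OF that] DH[OF that]] W by simp
  define I where "I = (\<lambda>v. (\<psi>' (p + h p) v - \<psi>' p v) - (\<psi>' (q + h q) v - \<psi>' q v))"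
  have linI: "linear I"
    unfolding I_def by (intro linear_compose_sub \<psi>'_linear in')
  have "norm (I b) \<le> 2 * L * W * norm (p - q)" if b: "b \<in> Basis" for b
    unfolding I_def
    by (rule displacement_increment_bound[where B=B and B'=B' and \<Phi>="\<lambda>p. \<psi>' p b" and \<Phi>'="\<psi>'' b" and h=h and u=u])
      (use convex_B b \<psi>'_deriv \<psi>''_bound \<psi>''_lip h_deriv hW uW B_sub maps L_nonneg pq in auto)
  then have I: "norm (I v) \<le> real DIM('n) * (2 * L * W * norm (p - q)) * norm v"
    by (rule linear_norm_le_Basis[OF linI])
  have f: "norm (p + h p - (q + h q)) \<le> 2 * norm (p - q)"
  proof -
    have "norm (h p - h q) \<le> W * norm (p - q)"
      by (rule has_derivative_bound[OF convex_B h_deriv uW pq])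
    also have "\<dots> \<le> norm (p - q)" using W(2) W0 by (simp add: mult_left_le_one_le)
    finally show ?thesis using norm_triangle_ineq[of "p - q" "h p - h q"] by (simp add: algebra_simps)
  qed
  have J: "norm (\<psi>' (p + h p) (u q v) - \<psi>' (q + h q) (u q v)) \<le> 2 * L * W * norm (p - q) * norm v"
  proof -
    have "norm (\<psi>' (p + h p) (u q v) - \<psi>' (q + h q) (u q v)) \<le> L * norm (p + h p - (q + h q)) * norm (u q v)"
      by (rule \<psi>'_lip[OF in'(2,4)])
    also have "\<dots> \<le> L * (2 * norm (p - q)) * (W * norm v)"
      using f uW[OF pq(2), of v] L_nonneg by (intro mult_mono) auto
    finally show ?thesis by (simp add: mult_ac)
  qed
  have "\<mu> * norm (u p v - u q v) \<le> norm (\<psi>' (p + h p) (u p v - u q v))"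
    by (rule lower'[OF in'(2)])
  also have "\<psi>' (p + h p) (u p v - u q v) = (DH p v - DH q v) - I v - (\<psi>' (p + h p) (u q v) - \<psi>' (q + h q) (u q v))"
    by (simp add: DH_def I_def linear_add[OF \<psi>'_linear] linear_diff[OF \<psi>'_linear] in')
  also have "norm \<dots> \<le> norm (DH p v - DH q v) + norm (I v) + norm (\<psi>' (p + h p) (u q v) - \<psi>' (q + h q) (u q v))"
    by (meson norm_triangle_ineq4 order_trans add_mono order_refl)
  also have "\<dots> \<le> \<kappa> * norm (p - q) * norm v + real DIM('n) * (2 * L * W * norm (p - q)) * norm v + 2 * L * W * norm (p - q) * norm v"
    using DHl[OF pq] I J by (intro add_mono)
  also have "\<dots> = (1 + (2 * DIM('n) + 2) * L * ((1 + L / \<mu>) / \<mu>)) * \<kappa> * norm (p - q) * norm v"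
    unfolding W(1) by (simp add: algebra_simps)
  finally show ?thesis using \<mu>_pos by (simp add: field_simps)
qed

end

section \<open>Embedded closed Riemannian manifolds\<close>

locale embedded_manifold = riemannian_atlas M A g
  for M :: "'m::t2_space set" and A :: "('m, 'n::euclidean_space) chart set" and g +
  fixes F :: "(('m, 'n) chart \<times> 'm set) set" and \<iota> :: "'m \<Rightarrow> 'e::euclidean_space"
  assumes compact_M: "compact M" and connected_M: "connected M"
    and embedding: "smooth_embedding M A \<iota>" and cover: "compact_chart_cover M A F"
begin

lemma inj_\<iota>: "inj_on \<iota> M"
  using embedding unfolding smooth_embedding_def by blast

lemma \<iota>_Ck: "c \<in> A \<Longrightarrow> Ck_on k (chart_image c) (\<iota> \<circ> chart_inv c)"
  using embedding unfolding smooth_embedding_def smooth_on_def by blast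

lemma \<iota>_immersion: "c \<in> A \<Longrightarrow> x \<in> chart_dom c \<Longrightarrow> inj (fderiv (\<iota> \<circ> chart_inv c) (chart_map c x))"
  using embedding unfolding smooth_embedding_def by blast

lemma continuous_on_\<iota>: "continuous_on M \<iota>"
  unfolding continuous_on_def
proof
  fix x assume "x \<in> M"
  then obtain c where c: "c \<in> A" "x \<in> chart_dom c" using chart_exists by blast
  obtain T where T: "open T" "chart_dom c = M \<inter> T"
    using chart_dom_openin[OF c(1)] by (auto simp: openin_open)
  have "continuous_on (chart_dom c) ((\<iota> \<circ> chart_inv c) \<circ> chart_map c)"
    by (rule continuous_on_compose[OF continuous_on_chart_map[OF c(1)]]) (use \<iota>_Ck[OF c(1), of 0] in simp)
  then have "continuous_on (chart_dom c) \<iota>"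
    by (rule continuous_on_eq) (use c in simp)
  moreover have "at x within M = at x within chart_dom c"
    using T c(2) by (intro at_within_nhd[of x T]) auto
  ultimately show "(\<iota> \<longlongrightarrow> \<iota> x) (at x within M)"
    using c(2) by (simp add: continuous_on_def)
qed

text \<open>Compactness: the part of \<open>M\<close> outside \<open>V\<close> has a compact image
  that misses \<open>\<iota> x\<close>. Closeness of \<open>f\<close> to the identity is known only
  after \<iota>, and this is what keeps \<open>f x\<close> inside a given chart.\<close>

lemma \<iota>_separates:
  assumes V: "open_in_M V" "x \<in> V"
  obtains r where "0 < r" "\<And>y. y \<in> M \<Longrightarrow> norm (\<iota> y - \<iota> x) < r \<Longrightarrow> y \<in> V"
proof -
  have "x \<in> M" using V openin_imp_subset by blast
  obtain T where T: "open T" "V = M \<inter> T" using V(1) by (auto simp: openin_open)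
  have "compact (M - T)" using compact_M T by (intro compact_diff)
  then have "compact (\<iota> ` (M - T))"
    by (intro compact_continuous_image continuous_on_subset[OF continuous_on_\<iota>]) auto
  then have "open (- (\<iota> ` (M - T)))" by (intro open_Compl compact_imp_closed)
  moreover have "\<iota> x \<in> - (\<iota> ` (M - T))"
    using inj_\<iota> V T \<open>x \<in> M\<close> by (auto dest: inj_onD)
  ultimately obtain r where r: "0 < r" "ball (\<iota> x) r \<subseteq> - (\<iota> ` (M - T))"
    using open_contains_ball by blast
  show ?thesis
  proof
    fix y assume "y \<in> M" "norm (\<iota> y - \<iota> x) < r"
    then have "\<iota> y \<in> ball (\<iota> x) r" by (simp add: dist_norm norm_minus_commute)
    then show "y \<in> V" using r(2) \<open>y \<in> M\<close> T by auto
  qed (use r in auto)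
qed

lemma cover_finite: "finite F"
  and cover_chart: "(c, K) \<in> F \<Longrightarrow> c \<in> A"
  and cover_compact: "(c, K) \<in> F \<Longrightarrow> compact K"
  and cover_dom: "(c, K) \<in> F \<Longrightarrow> x \<in> K \<Longrightarrow> x \<in> chart_dom c"
  and cover_M: "x \<in> M \<Longrightarrow> \<exists>c K. (c, K) \<in> F \<and> x \<in> K"
  and cover_sub: "(c, K) \<in> F \<Longrightarrow> K \<subseteq> M"
  using cover unfolding compact_chart_cover_def by fast+

definition H :: "('m \<Rightarrow> 'm) \<Rightarrow> 'm \<Rightarrow> 'e" where
  "H f x = \<iota> (f x) - \<iota> x"

abbreviation Hc :: "('m \<Rightarrow> 'm) \<Rightarrow> ('m, 'n) chart \<Rightarrow> 'n \<Rightarrow> 'e" where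
  "Hc f c \<equiv> H f \<circ> chart_inv c"

lemma Ck_dist_id: "Ck_dist k F \<iota> f id = Ck_norm k F (H f)"
  by (simp add: Ck_dist_def H_def[abs_def])

abbreviation C2_dist :: "('m \<Rightarrow> 'm) \<Rightarrow> real" where
  "C2_dist f \<equiv> Ck_dist 2 F \<iota> f id"

text \<open>The distance is a real supremum; nonemptiness of \<open>M\<close> makes its index set
  nonempty.\<close>

lemma Ck_dist_0_le:
  assumes "M \<noteq> {}" "\<And>x. x \<in> M \<Longrightarrow> norm (H f x) \<le> C"
  shows "Ck_dist 0 F \<iota> f id \<le> C"
  unfolding Ck_dist_id Ck_norm_def
proof (rule cSup_least)
  obtain x c K where x: "(c, K) \<in> F" "x \<in> K" using assms(1) cover_M by blast
  have "norm (iter_deriv [] (Hc f c) (chart_map c x)) \<in>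
      {norm (iter_deriv bs (Hc f c) (chart_map c x)) | bs c K x.
      (c, K) \<in> F \<and> x \<in> K \<and> set bs \<subseteq> Basis \<and> length bs \<le> 0}"
    using x by (intro CollectI exI[of _ "[]"] exI[of _ c] exI[of _ K] exI[of _ x]) auto
  then show "{norm (iter_deriv bs (Hc f c) (chart_map c x)) | bs c K x.
      (c, K) \<in> F \<and> x \<in> K \<and> set bs \<subseteq> Basis \<and> length bs \<le> 0} \<noteq> {}"
    by blast
next
  fix t assume "t \<in> {norm (iter_deriv bs (Hc f c) (chart_map c x)) | bs c K x.
      (c, K) \<in> F \<and> x \<in> K \<and> set bs \<subseteq> Basis \<and> length bs \<le> 0}"
  then obtain c K x where t: "t = norm ((Hc f c) (chart_map c x))" "(c, K) \<in> F" "x \<in> K"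
    by auto
  then have "x \<in> M" using cover_sub by blast
  have "t = norm (H f x)"
    using t cover_chart[OF t(2)] cover_dom[OF t(2,3)] by simp
  then show "t \<le> C" using assms(2)[OF \<open>x \<in> M\<close>] by simp
qed

end

section \<open>The ambient displacement of a C2 self-map\<close>

locale embedded_manifold_map = embedded_manifold M A g F \<iota> + riemannian_atlas_map M A g f
  for M :: "'m::t2_space set" and A :: "('m, 'n::euclidean_space) chart set" and g F
    and \<iota> :: "'m \<Rightarrow> 'e::euclidean_space" and f
begin

lemma \<iota>_f_Ck:
  assumes c: "c \<in> A"
  shows "Ck_on 2 (chart_image c) (\<iota> \<circ> f \<circ> chart_inv c)"
proof (rule Ck_on_local)
  fix p assume "p \<in> chart_image c"
  then obtain x where x: "x \<in> chart_dom c" "p = chart_map c x" by auto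
  then have "f x \<in> M" using chart_dom_subset[OF c] f_maps by blast
  then obtain d where d: "d \<in> A" "f x \<in> chart_dom d" using chart_exists by blast
  let ?T = "chart_map c ` (chart_dom c \<inter> f -` chart_dom d)"
  have "Ck_on 2 ?T (\<lambda>p. (\<iota> \<circ> chart_inv d) ((chart_map d \<circ> f \<circ> chart_inv c) p))"
    by (rule Ck_on_compose[OF f_dom_open[OF c d(1)] chart_image_open[OF d(1)] _ f_Ck[OF c d(1)] \<iota>_Ck[OF d(1)]])
      (use c in auto)
  then have "Ck_on 2 ?T (\<iota> \<circ> f \<circ> chart_inv c)"
    by (subst Ck_on_cong[OF f_dom_open[OF c d(1)]]) (use c d in auto)
  then show "\<exists>T. open T \<and> p \<in> T \<and> Ck_on 2 T (\<iota> \<circ> f \<circ> chart_inv c)"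
    using f_dom_open[OF c d(1)] x d by (intro exI[of _ ?T]) auto
qed

lemma H_Ck:
  assumes c: "c \<in> A"
  shows "Ck_on 2 (chart_image c) (Hc f c)"
proof -
  have "Ck_on 2 (chart_image c) (\<lambda>p. (\<iota> \<circ> f \<circ> chart_inv c) p + - (\<iota> \<circ> chart_inv c) p)"
    by (intro Ck_on_add chart_image_open \<iota>_f_Ck c
        Ck_on_bounded_linear[OF _ bounded_linear_minus[OF bounded_linear_ident]] \<iota>_Ck)
  then show ?thesis
    by (subst Ck_on_cong[OF chart_image_open[OF c]]) (auto simp: H_def)
qed

text \<open>A real supremum bounds the members of its set only if the set is bounded above. Here it
  lies in a finite union, over cover pieces and lists of length at most 2, of continuous images of
  compact sets.\<close>

lemma iter_deriv_le_Ck_dist: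
  assumes "(c, K) \<in> F" "x \<in> K" "set bs \<subseteq> Basis" "length bs \<le> 2"
  shows "norm (iter_deriv bs (Hc f c) (chart_map c x)) \<le> C2_dist f"
  unfolding Ck_dist_id Ck_norm_def
proof (rule cSup_upper)
  let ?S = "{norm (iter_deriv bs (Hc f c) (chart_map c x)) | bs c K x.
            (c, K) \<in> F \<and> x \<in> K \<and> set bs \<subseteq> Basis \<and> length bs \<le> 2}"
  show "norm (iter_deriv bs (Hc f c) (chart_map c x)) \<in> ?S"
    using assms by blast
  let ?L = "{bs :: 'n list. set bs \<subseteq> Basis \<and> length bs \<le> 2}"
  have "?S \<subseteq> (\<Union>cK\<in>F. \<Union>bs\<in>?L. norm ` (\<lambda>x. iter_deriv bs (H f \<circ> chart_inv (fst cK)) (chart_map (fst cK) x)) ` snd cK)"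
    by force
  moreover have "bounded (norm ` (\<lambda>x. iter_deriv bs (H f \<circ> chart_inv (fst cK)) (chart_map (fst cK) x)) ` snd cK)"
    if "cK \<in> F" "bs \<in> ?L" for cK bs
  proof -
    obtain c K where cK': "cK = (c, K)" by (rule prod.exhaust)
    with that(1) have cK: "cK = (c, K)" "(c, K) \<in> F" by auto
    have c: "c \<in> A" "K \<subseteq> chart_dom c" "compact K"
      using cover_chart[OF cK(2)] cover_dom[OF cK(2)] cover_compact[OF cK(2)] by auto
    have "continuous_on (chart_image c) (iter_deriv bs (Hc f c))"
      using that(2) by (intro Ck_on_iter_deriv_continuous[OF H_Ck[OF c(1)]]) auto
    then have "continuous_on K (\<lambda>x. iter_deriv bs (Hc f c) (chart_map c x))"
      by (rule continuous_on_compose2[OF _ continuous_on_subset[OF continuous_on_chart_map[OF c(1)] c(2)]])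
        (use c in auto)
    then have "compact (norm ` (\<lambda>x. iter_deriv bs (Hc f c) (chart_map c x)) ` K)"
      using c(3) by (intro compact_continuous_image continuous_intros) auto
    then show ?thesis unfolding cK(1) fst_conv snd_conv by (rule compact_imp_bounded)
  qed
  then have "bounded (\<Union>cK\<in>F. \<Union>bs\<in>?L. norm ` (\<lambda>x. iter_deriv bs (H f \<circ> chart_inv (fst cK)) (chart_map (fst cK) x)) ` snd cK)"
    using cover_finite finite_lists_length_le[of "Basis :: 'n set" 2] by (intro bounded_UN ballI) auto
  ultimately have "bounded ?S" by (rule bounded_subset[rotated])
  then show "bdd_above ?S" by (rule bounded_imp_bdd_above)
qed

lemma H_le: "x \<in> M \<Longrightarrow> norm (H f x) \<le> C2_dist f"
proof -
  assume "x \<in> M"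
  then obtain c K where "(c, K) \<in> F" "x \<in> K" using cover_M by blast
  then show ?thesis
    using iter_deriv_le_Ck_dist[of c K x "[]"] cover_chart[of c K] cover_dom[of c K x] by simp
qed

lemma
  assumes cK: "(c, K) \<in> F" "x \<in> K" and b: "b \<in> Basis"
  shows H_deriv_le: "norm (fderiv (Hc f c) (chart_map c x) b) \<le> C2_dist f"
    and H_deriv2_le: "b' \<in> Basis \<Longrightarrow> norm (fderiv (\<lambda>p. fderiv (Hc f c) p b)
      (chart_map c x) b') \<le> C2_dist f"
  using iter_deriv_le_Ck_dist[OF cK, of "[b]"] iter_deriv_le_Ck_dist[OF cK, of "[b, b']"] b by simp_all

end

section \<open>Uniform bounds for the metric in a chart\<close>

lemma bilinear_diff:
  "bilinear S \<Longrightarrow> bilinear T \<Longrightarrow> bilinear (\<lambda>v w. S v w - T v w)"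
  unfolding bilinear_def by (auto intro: linear_compose_sub)

lemma bilinear_compose_linear:
  assumes "bilinear S" "linear k" "linear l"
  shows "bilinear (\<lambda>v w. S (k v) (l w))"
  using assms unfolding bilinear_def linear_iff by simp

context riemannian_atlas
begin

lemma gcoord_bilinear:
  "c \<in> A \<Longrightarrow> p \<in> chart_image c \<Longrightarrow> bilinear (gcoord A g c p)"
  using inner_form.bil[OF gcoord_inner_product] .

lemma gcoord_lower_bound:
  assumes c: "c \<in> A" and K: "compact K" "K \<subseteq> chart_image c"
  obtains m where "0 < m" "\<And>p v. p \<in> K \<Longrightarrow> m * (norm v)\<^sup>2 \<le> gcoord A g c p v v"
proof (cases "K = {}")
  case True
  then show ?thesis using that[of 1] by auto
next
  case False
  let ?G = "gcoord A g c"
  \<comment> \<open>Smoothness of the metric is given for fixed vector arguments only. The expansion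
    in coefficients is continuous jointly in point and vector, so it attains a minimum over
    \<open>K\<close> times the unit sphere; homogeneity extends the bound to all vectors.\<close>
  let ?q = "\<lambda>z. \<Sum>(i, j)\<in>Basis \<times> Basis. (snd z \<bullet> i) * (snd z \<bullet> j) * ?G (fst z) i j"
  have expand: "?G p v v = ?q (p, v)" if "p \<in> K" for p v
  proof -
    note bl = gcoord_bilinear[OF c, of p]
    have p: "p \<in> chart_image c" using that K by auto
    have "?G p v v = ?G p (\<Sum>i\<in>Basis. (v \<bullet> i) *\<^sub>R i) (\<Sum>i\<in>Basis. (v \<bullet> i) *\<^sub>R i)"
      by (simp add: euclidean_representation)
    then show ?thesis unfolding bilinear_sum[OF bl[OF p]]
      by (simp add: bilinear_lmul[OF bl[OF p]] bilinear_rmul[OF bl[OF p]] case_prod_unfold mult_ac)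
  qed
  have cont: "continuous_on (K \<times> sphere (0::'n) 1) ?q"
  proof -
    have "continuous_on (K \<times> sphere (0::'n) 1) (\<lambda>z. ?G (fst z) i j)" for i j
      using gcoord_Ck[OF c, of 0 i j] K
      by (intro continuous_on_compose2[where g="\<lambda>p. ?G p i j" and f=fst]) (auto intro: continuous_intros)
    then show ?thesis
      unfolding case_prod_unfold by (intro continuous_intros)
  qed
  have ne: "K \<times> sphere (0::'n) 1 \<noteq> {}" using False by auto
  have "compact (K \<times> sphere (0::'n) 1)" using K by (intro compact_Times) auto
  from continuous_attains_inf[OF this ne cont]
  obtain z where z: "z \<in> K \<times> sphere (0::'n) 1" "\<forall>y\<in>K \<times> sphere (0::'n) 1. ?q z \<le> ?q y" by blast
  obtain p1 v1 where z': "z = (p1, v1)" "p1 \<in> K" "norm v1 = 1" using z(1) by auto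
  show ?thesis
  proof
    have "p1 \<in> chart_image c" using z' K by auto
    moreover have "v1 \<noteq> 0" using z' by auto
    ultimately have "0 < ?G p1 v1 v1"
      using inner_form.pos[OF gcoord_inner_product[OF c]] by blast
    then show "0 < ?q z" using expand[OF z'(2), of v1] z'(1) by simp
    fix p v assume p: "p \<in> K"
    note bl = gcoord_bilinear[OF c, of p]
    have pi: "p \<in> chart_image c" using p K by auto
    show "?q z * (norm v)\<^sup>2 \<le> ?G p v v"
    proof (cases "v = 0")
      case True
      then show ?thesis using bilinear_lzero[OF bl[OF pi]] by simp
    next
      case False
      define e where "e = (1 / norm v) *\<^sub>R v"
      have e: "norm e = 1" "v = norm v *\<^sub>R e" using False by (auto simp: e_def)
      have "?q z \<le> ?G p e e" using z(2) e(1) p expand[OF p, of e] by simp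
      then have "?q z * (norm v)\<^sup>2 \<le> ?G p e e * (norm v)\<^sup>2" by (rule mult_right_mono) simp
      also have "\<dots> = ?G p (norm v *\<^sub>R e) (norm v *\<^sub>R e)"
        by (simp add: bilinear_lmul[OF bl[OF pi]] bilinear_rmul[OF bl[OF pi]] power2_eq_square)
      finally show ?thesis using e(2) by simp
    qed
  qed
qed

lemma gcoord_bounds:
  assumes c: "c \<in> A" and K: "cball p0 R \<subseteq> chart_image c"
  obtains L where "0 < L"
    "\<And>p a b. p \<in> cball p0 R \<Longrightarrow> \<bar>gcoord A g c p a b\<bar> \<le> L * norm a * norm b"
    "\<And>p q a b. p \<in> cball p0 R \<Longrightarrow> q \<in> cball p0 R \<Longrightarrow>
       \<bar>gcoord A g c p a b - gcoord A g c q a b\<bar> \<le> L * norm (p - q) * norm a * norm b"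
    "\<And>i j p v. p \<in> cball p0 R \<Longrightarrow> i \<in> Basis \<Longrightarrow> j \<in> Basis \<Longrightarrow>
       norm (fderiv (\<lambda>p. gcoord A g c p i j) p v) \<le> L * norm v"
    "\<And>i j p q v. p \<in> cball p0 R \<Longrightarrow> q \<in> cball p0 R \<Longrightarrow> i \<in> Basis \<Longrightarrow> j \<in> Basis \<Longrightarrow>
       norm (fderiv (\<lambda>p. gcoord A g c p i j) p v -
         fderiv (\<lambda>p. gcoord A g c p i j) q v) \<le> L * norm (p - q) * norm v"
proof -
  let ?G = "gcoord A g c"
  let ?\<Phi> = "\<lambda>ij p. ?G p (fst ij) (snd ij)"
  let ?n = "(real DIM('n))\<^sup>2"
  obtain L where L: "0 < L"
    "\<And>ij p. ij \<in> Basis \<times> Basis \<Longrightarrow> p \<in> cball p0 R \<Longrightarrow> norm (?\<Phi> ij p) \<le> L"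
    "\<And>ij p v. ij \<in> Basis \<times> Basis \<Longrightarrow> p \<in> cball p0 R \<Longrightarrow> norm (fderiv (?\<Phi> ij) p v) \<le> L * norm v"
    "\<And>ij p q v. ij \<in> Basis \<times> Basis \<Longrightarrow> p \<in> cball p0 R \<Longrightarrow> q \<in> cball p0 R \<Longrightarrow>
       norm (fderiv (?\<Phi> ij) p v - fderiv (?\<Phi> ij) q v) \<le> L * norm (p - q) * norm v"
    "\<And>ij p q. ij \<in> Basis \<times> Basis \<Longrightarrow> p \<in> cball p0 R \<Longrightarrow> q \<in> cball p0 R \<Longrightarrow>
       norm (?\<Phi> ij p - ?\<Phi> ij q) \<le> L * norm (p - q)"
    by (rule C2_on_cball_bounds[where I="Basis \<times> Basis" and \<Phi>="?\<Phi>", OF _ K gcoord_Ck[OF c]]) auto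
  have inK: "p \<in> chart_image c" if "p \<in> cball p0 R" for p using that K by auto
  have n1: "1 \<le> ?n"
    using DIM_positive[where 'a='n] by (simp add: one_le_power Suc_le_eq)
  have LL: "L \<le> ?n * L" using n1 L(1) by simp
  have mono: "L * t \<le> ?n * L * t" if "0 \<le> t" for t using LL that by (rule mult_right_mono)
  show ?thesis
  proof
    show "0 < ?n * L" using n1 L(1) by simp
    show "\<bar>?G p a b\<bar> \<le> ?n * L * norm a * norm b" if "p \<in> cball p0 R" for p a b
      using L(2)[of "(_, _)" p] that by (intro bilinear_bound_Basis gcoord_bilinear c inK) auto
    show "\<bar>?G p a b - ?G q a b\<bar> \<le> ?n * L * norm (p - q) * norm a * norm b" if "p \<in> cball p0 R" "q \<in> cball p0 R" for p q a b
    proof -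
      have "\<bar>?G p a b - ?G q a b\<bar> \<le> ?n * (L * norm (p - q)) * norm a * norm b"
        using L(5)[of "(_, _)" p q] that
        by (intro bilinear_bound_Basis[where S="\<lambda>a b. ?G p a b - ?G q a b"] bilinear_diff gcoord_bilinear c inK) auto
      then show ?thesis by (simp add: mult_ac)
    qed
    show "norm (fderiv (\<lambda>p. ?G p i j) p v) \<le> ?n * L * norm v"
      if "p \<in> cball p0 R" "i \<in> Basis" "j \<in> Basis" for i j p v
      using L(3)[of "(i, j)" p v] mono[of "norm v"] that by simp
    show "norm (fderiv (\<lambda>p. ?G p i j) p v - fderiv (\<lambda>p. ?G p i j) q v)
        \<le> ?n * L * norm (p - q) * norm v"
      if "p \<in> cball p0 R" "q \<in> cball p0 R" "i \<in> Basis" "j \<in> Basis" for i j p q v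
      using L(4)[of "(i, j)" p q v] mono[of "norm (p - q) * norm v"] that by (simp add: mult.assoc)
  qed
qed

end

section \<open>Finiteness of the supremum behind the metric defect\<close>

lemma compact_locally_bounded:
  fixes \<phi> :: "'m::topological_space \<Rightarrow> real"
  assumes "compact M"
    and "\<And>x. x \<in> M \<Longrightarrow> \<exists>V C. openin (top_of_set M) V \<and> x \<in> V \<and> (\<forall>y\<in>V. \<phi> y \<le> C)"
  shows "\<exists>C. \<forall>x\<in>M. \<phi> x \<le> C"
proof -
  let ?\<V> = "{V. openin (top_of_set M) V \<and> (\<exists>C. \<forall>y\<in>V. \<phi> y \<le> C)}"
  have "(\<forall>V\<in>?\<V>. openin (top_of_set M) V) \<and> M \<subseteq> \<Union>?\<V>" using assms(2) by blast
  then obtain D where D: "D \<subseteq> ?\<V>" "finite D" "M \<subseteq> \<Union>D"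
    using assms(1) unfolding compact_eq_openin_cover by meson
  then have "\<forall>V\<in>D. \<exists>C. \<forall>y\<in>V. \<phi> y \<le> C" by blast
  then obtain C where C: "\<And>V y. V \<in> D \<Longrightarrow> y \<in> V \<Longrightarrow> \<phi> y \<le> C V" by metis
  have "\<phi> x \<le> (\<Sum>V\<in>D. \<bar>C V\<bar>)" if x: "x \<in> M" for x
  proof -
    obtain V where V: "V \<in> D" "x \<in> V" using D(3) x by blast
    have "\<phi> x \<le> \<bar>C V\<bar>" using C[OF V] by linarith
    also have "\<dots> \<le> (\<Sum>V\<in>D. \<bar>C V\<bar>)" using V D(2) by (intro member_le_sum) auto
    finally show ?thesis .
  qed
  then show ?thesis by blast
qed

context riemannian_atlas_map
begin

text \<open>\<open>some_frame\<close> chooses frames independently at each point, so nothing can be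
  read off from continuity of the frames. A bound on all pairs of unit vectors, uniform near
  \<open>x0\<close>, avoids this.\<close>

lemma hs_norm_pullback_locally_bounded:
  assumes x0: "x0 \<in> M"
  shows "\<exists>V C. open_in_M V \<and> x0 \<in> V \<and>
    (\<forall>x\<in>V. hs_norm_form A g x (\<lambda>u v. pullback A f g x u v - g x u v) \<le> C)"
proof -
  obtain c where c: "c \<in> A" "x0 \<in> chart_dom c" using x0 chart_exists by blast
  obtain d where d: "d \<in> A" "f x0 \<in> chart_dom d" using x0 f_maps chart_exists by blast
  define p0 where "p0 = chart_map c x0"
  define S where "S = chart_map c ` (chart_dom c \<inter> f -` chart_dom d)"
  define fh where "fh = chart_map d \<circ> f \<circ> chart_inv c"
  have "open S" "p0 \<in> S" using f_dom_open[OF c(1) d(1)] c d by (auto simp: S_def p0_def)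
  then obtain R where R: "0 < R" "cball p0 R \<subseteq> S" using open_contains_cball by blast
  have Sc: "S \<subseteq> chart_image c" by (auto simp: S_def)
  then have Kc: "cball p0 R \<subseteq> chart_image c" using R by blast
  obtain L where L: "0 < L" "\<And>p a b. p \<in> cball p0 R \<Longrightarrow> \<bar>gcoord A g c p a b\<bar> \<le> L * norm a * norm b"
    using gcoord_bounds[OF c(1) Kc] by metis
  obtain m where m: "0 < m" "\<And>p v. p \<in> cball p0 R \<Longrightarrow> m * (norm v)\<^sup>2 \<le> gcoord A g c p v v"
    using gcoord_lower_bound[OF c(1) compact_cball Kc] by metis
  have fC: "Ck_on 2 S fh" using f_Ck[OF c(1) d(1)] by (simp add: S_def fh_def)
  have "\<exists>L>0. \<forall>p\<in>cball p0 R. \<forall>v. norm (fderiv fh p v) \<le> L * norm v"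
    by (rule C2_on_cball_bounds[of "{()}" p0 R S "\<lambda>_. fh"]) (use R fC in blast)+
  then obtain L1 where L1: "0 < L1" "\<And>p v. p \<in> cball p0 R \<Longrightarrow> norm (fderiv fh p v) \<le> L1 * norm v"
    by blast
  have "continuous_on (cball p0 R) fh"
    using Ck_on_mono[OF fC, of 0] R(2) by (auto intro: continuous_on_subset)
  then have cK: "compact (fh ` cball p0 R)" by (intro compact_continuous_image) auto
  have Kd: "fh ` cball p0 R \<subseteq> chart_image d"
    using R(2) c(1) by (auto simp: S_def fh_def)
  have "\<exists>L. 0 < L \<and> (\<forall>ij\<in>Basis \<times> Basis. \<forall>q\<in>fh ` cball p0 R. norm (gcoord A g d q (fst ij) (snd ij)) \<le> L)"
    using gcoord_Ck[OF d(1), of 0] Kd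
    by (intro compact_bound_family cK) (auto intro: continuous_on_subset)
  then obtain L2 where L2: "0 < L2"
    "\<And>i j q. i \<in> Basis \<Longrightarrow> j \<in> Basis \<Longrightarrow> q \<in> fh ` cball p0 R \<Longrightarrow> \<bar>gcoord A g d q i j\<bar> \<le> L2"
    by force
  define C where "C = (real DIM('n))\<^sup>2 * L2 * L1\<^sup>2 + L"
  have C0: "0 \<le> C" using L L2 by (simp add: C_def)
  have "hs_norm_form A g x (\<lambda>u v. pullback A f g x u v - g x u v) \<le> real DIM('n) * (C / m)"
    if x: "x \<in> chart_inv c ` ball p0 R" for x
  proof -
    obtain p where "p \<in> ball p0 R" and px: "x = chart_inv c p" using x by blast
    then have p: "p \<in> cball p0 R" "x = chart_inv c p" by auto
    then have pS: "p \<in> S" using R by blast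
    then have xc: "x \<in> chart_dom c" "f x \<in> chart_dom d" "chart_map c x = p"
      using c(1) p(2) by (auto simp: S_def)
    have fhp: "fh p = chart_map d (f x)" using p by (simp add: fh_def)
    show ?thesis
    proof (rule hs_norm_le[OF c(1) xc(1)])
      show "0 \<le> C / m" using C0 m by simp
      fix u v assume uv: "gcoord A g c (chart_map c x) u u = 1" "gcoord A g c (chart_map c x) v v = 1"
      let ?D = "fderiv fh p"
      \<comment> \<open>Both squared Euclidean norms are at most \<open>1 / m\<close>, hence so is
        the product of the norms, by the inequality between geometric and arithmetic mean.\<close>
      have "m * (norm u)\<^sup>2 \<le> 1" "m * (norm v)\<^sup>2 \<le> 1"
        using m(2)[OF p(1), of u] m(2)[OF p(1), of v] uv xc(3) by auto
      moreover have "2 * (norm u * norm v) \<le> (norm u)\<^sup>2 + (norm v)\<^sup>2"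
        using sum_squares_bound[of "norm u" "norm v"] by simp
      then have "m * (2 * (norm u * norm v)) \<le> m * ((norm u)\<^sup>2 + (norm v)\<^sup>2)"
        using m(1) by (intro mult_left_mono) auto
      ultimately have "m * (norm u * norm v) \<le> 1" by (simp add: distrib_left)
      then have nuv: "norm u * norm v \<le> 1 / m" using m(1) by (simp add: field_simps)
      have "\<bar>gcoord A g d (fh p) (?D u) (?D v)\<bar> \<le> (real DIM('n))\<^sup>2 * L2 * norm (?D u) * norm (?D v)"
        using L2(2) p(1) Kd by (intro bilinear_bound_Basis gcoord_bilinear d) auto
      also have "\<dots> \<le> (real DIM('n))\<^sup>2 * L2 * (L1 * norm u) * (L1 * norm v)"
        using L1 L2(1) p(1) by (intro mult_mono) auto
      finally have 1: "\<bar>gcoord A g d (fh p) (?D u) (?D v)\<bar> \<le> (real DIM('n))\<^sup>2 * L2 * L1\<^sup>2 * (norm u * norm v)"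
        by (simp add: power2_eq_square mult_ac)
      have 2: "\<bar>gcoord A g c p u v\<bar> \<le> L * (norm u * norm v)"
        using L(2)[OF p(1)] by (simp add: mult.assoc)
      have "pullback A f g x (coord_vec A c x u) (coord_vec A c x v) - g x (coord_vec A c x u) (coord_vec A c x v)
          = gcoord A g d (fh p) (?D u) (?D v) - gcoord A g c p u v"
        unfolding pullback_coord[OF c(1) xc(1) d(1) xc(2)] gcoord_at[OF c(1) xc(1), symmetric] fhp xc(3) fh_def[symmetric] by simp
      also have "\<bar>\<dots>\<bar> \<le> C * (norm u * norm v)"
        using 1 2 by (simp add: C_def distrib_right)
      also have "\<dots> \<le> C * (1 / m)" using nuv C0 by (rule mult_left_mono)
      finally show "\<bar>pullback A f g x (coord_vec A c x u) (coord_vec A c x v) - g x (coord_vec A c x u) (coord_vec A c x v)\<bar> \<le> C / m"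
        by simp
    qed
  qed
  moreover have "open_in_M (chart_inv c ` ball p0 R)"
    using Kc by (intro chart_inv_open_image c) (auto simp: subset_iff)
  moreover have "x0 \<in> chart_inv c ` ball p0 R"
    using R(1) c by (intro image_eqI[of _ _ p0]) (auto simp: p0_def)
  ultimately show ?thesis by blast
qed

lemma hs_norm_le_field_norm:
  assumes "compact M" "x \<in> M"
  shows "hs_norm_form A g x (\<lambda>u v. pullback A f g x u v - g x u v) \<le>
    field_norm M A g (\<lambda>x u v. pullback A f g x u v - g x u v)"
  unfolding field_norm_def
proof (rule cSUP_upper[OF assms(2)])
  obtain C where "\<forall>x\<in>M. hs_norm_form A g x (\<lambda>u v. pullback A f g x u v - g x u v) \<le> C"
    using compact_locally_bounded[OF assms(1) hs_norm_pullback_locally_bounded] by blast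
  then show "bdd_above ((\<lambda>x. hs_norm_form A g x (\<lambda>u v. pullback A f g x u v - g x u v)) ` M)"
    by (auto simp: bdd_above_def)
qed

end

section \<open>Transfer of derivative bounds from cover charts to a working chart\<close>

context embedded_manifold_map
begin

lemma H_differentiable: "c \<in> A \<Longrightarrow> x \<in> chart_dom c \<Longrightarrow> (Hc f c) differentiable (at (chart_map c x))"
  using H_Ck[of c] by (simp add: numeral_2_eq_2)

lemma H_derivative_differentiable:
  "c \<in> A \<Longrightarrow> x \<in> chart_dom c \<Longrightarrow>
    (\<lambda>p. fderiv (Hc f c) p v) differentiable (at (chart_map c x))"
  using H_Ck[of c] by (simp add: numeral_2_eq_2)

text \<open>The C2 distance controls derivatives at \<open>x\<close> only in a chart
  \<open>d\<close> of the cover whose piece contains \<open>x\<close>. The second derivative in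
  \<open>c\<close> also involves the second derivative of the transition map, which gives the
  summand \<open>L\<close> beside the quadratic one.\<close>

lemma
  fixes L :: real
  assumes c: "c \<in> A" "x \<in> chart_dom c" and d: "(d, K) \<in> F" "x \<in> K" and L: "0 \<le> L"
    and t1: "\<And>v. norm (fderiv (transition c d) (chart_map c x) v) \<le> L * norm v"
    and t2: "\<And>b v. b \<in> Basis \<Longrightarrow>
      norm (fderiv (\<lambda>p. fderiv (transition c d) p b) (chart_map c x) v) \<le> L * norm v"
  shows H_chart_derivative_bound:
      "norm (fderiv (Hc f c) (chart_map c x) v) \<le> DIM('n) * L * C2_dist f * norm v"
    and H_chart_second_derivative_bound: "b \<in> Basis \<Longrightarrow>
      norm (fderiv (\<lambda>p. fderiv (Hc f c) p b) (chart_map c x) v)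
      \<le> DIM('n) * (L + DIM('n) * L\<^sup>2) * C2_dist f * norm v"
proof -
  define \<kappa> where "\<kappa> = C2_dist f"
  have dA: "d \<in> A" "x \<in> chart_dom d" using cover_chart[OF d(1)] cover_dom[OF d] by auto
  have "x \<in> M" using cover_sub[OF d(1)] d(2) by blast
  have \<kappa>0: "0 \<le> \<kappa>" using H_le[OF \<open>x \<in> M\<close>] norm_ge_zero order_trans unfolding \<kappa>_def by blast
  define \<tau> Hd p where "\<tau> = transition c d" and "Hd = H f \<circ> chart_inv d" and "p = chart_map c x"
  have \<tau>p: "\<tau> p = chart_map d x" using c by (simp add: \<tau>_def p_def)
  have HdD: "Hd differentiable (at (\<tau> p))" unfolding \<tau>p Hd_def by (rule H_differentiable[OF dA])
  have \<tau>D: "\<tau> differentiable (at p)"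
    unfolding \<tau>_def p_def by (rule transition_differentiable[OF c(1) dA(1) c(2) dA(2)])
  have Hdb: "norm (fderiv Hd (\<tau> p) b) \<le> \<kappa>" if "b \<in> Basis" for b
    using H_deriv_le[OF d that] unfolding \<tau>p Hd_def \<kappa>_def .
  have Hdv: "norm (fderiv Hd (\<tau> p) v) \<le> DIM('n) * \<kappa> * norm v" for v
    by (rule linear_norm_le_Basis[OF linear_frechet_derivative[OF HdD] Hdb])
  have Hd2: "norm (fderiv (\<lambda>p. fderiv Hd p b) (\<tau> p) v) \<le> DIM('n) * \<kappa> * norm v"
    if "b \<in> Basis" for b v
  proof (rule linear_norm_le_Basis[OF linear_frechet_derivative])
    show "(\<lambda>p. fderiv Hd p b) differentiable at (\<tau> p)"
      unfolding \<tau>p Hd_def by (rule H_derivative_differentiable[OF dA])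
    show "norm (fderiv (\<lambda>p. fderiv Hd p b) (\<tau> p) b') \<le> \<kappa>" if "b' \<in> Basis" for b'
      using H_deriv2_le[OF d \<open>b \<in> Basis\<close> that] unfolding \<tau>p Hd_def \<kappa>_def .
  qed
  have "norm (fderiv (Hc f c) p v) = norm (fderiv Hd (\<tau> p) (fderiv \<tau> p v))"
    using chart_change_derivative[OF c dA, of "H f" v] HdD[unfolded \<tau>p Hd_def] c by (simp add: \<tau>p Hd_def \<tau>_def p_def)
  also have "\<dots> \<le> DIM('n) * \<kappa> * (L * norm v)"
    using t1[of v] \<kappa>0 by (intro order_trans[OF Hdv] mult_left_mono) (auto simp: \<tau>_def p_def)
  finally show "norm (fderiv (Hc f c) (chart_map c x) v) \<le> DIM('n) * L * C2_dist f * norm v"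
    by (simp add: \<kappa>_def p_def mult_ac)
  assume b: "b \<in> Basis"
  define T where "T = chart_map c ` (chart_dom c \<inter> chart_dom d)"
  have T: "open T" "p \<in> T" using overlap_image_open[OF c(1) dA(1)] c dA by (auto simp: T_def p_def)
  \<comment> \<open>The direction \<open>fderiv \<tau> q b\<close> moves with \<open>q\<close>;
    expanding it in the basis leaves derivatives of \<open>Hd\<close> in fixed directions, to which
    the product rule applies.\<close>
  let ?E = "\<lambda>q. \<Sum>k\<in>Basis. (fderiv \<tau> q b \<bullet> k) *\<^sub>R fderiv Hd (\<tau> q) k"
  have E: "?E q = fderiv (Hc f c) q b" if q: "q \<in> T" for q
  proof -
    obtain y where y: "y \<in> chart_dom c" "y \<in> chart_dom d" "q = chart_map c y" using q by (auto simp: T_def)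
    have Hy: "Hd differentiable (at (chart_map d y))" unfolding Hd_def by (rule H_differentiable[OF dA(1) y(2)])
    have "fderiv (Hc f c) q b
        = fderiv Hd (chart_map d y) (fderiv \<tau> q b)"
      using chart_change_derivative[OF c(1) y(1) dA(1) y(2), of "H f" b] Hy by (simp add: Hd_def \<tau>_def y(3))
    also have "\<dots> = (\<Sum>k\<in>Basis. (fderiv \<tau> q b \<bullet> k) *\<^sub>R fderiv Hd (chart_map d y) k)"
      by (rule linear_Basis_expansion[OF linear_frechet_derivative[OF Hy]])
    finally show ?thesis using y c(1) by (simp add: \<tau>_def)
  qed
  let ?A1 = "\<lambda>k v. (fderiv \<tau> p b \<bullet> k) *\<^sub>R
      fderiv (\<lambda>q. fderiv Hd q k) (\<tau> p) (fderiv \<tau> p v)"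
  let ?A2 = "\<lambda>k v. (fderiv (\<lambda>q. fderiv \<tau> q b) p v \<bullet> k) *\<^sub>R fderiv Hd (\<tau> p) k"
  have "Ck_on (Suc (Suc 0)) T \<tau>" unfolding T_def \<tau>_def by (rule transition_Ck[OF c(1) dA(1)])
  then have \<tau>2: "(\<lambda>q. fderiv \<tau> q b) differentiable (at p)" using T(2) by simp
  have "(?E has_derivative (\<lambda>v. \<Sum>k\<in>Basis. ?A1 k v + ?A2 k v)) (at p)"
  proof (intro has_derivative_sum has_derivative_scaleR)
    fix k :: 'n
    show "((\<lambda>q. fderiv \<tau> q b \<bullet> k) has_derivative
        (\<lambda>v. fderiv (\<lambda>q. fderiv \<tau> q b) p v \<bullet> k)) (at p)"
      by (intro has_derivative_inner_left has_fderiv \<tau>2)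
    show "((\<lambda>q. fderiv Hd (\<tau> q) k) has_derivative
        (\<lambda>v. fderiv (\<lambda>q. fderiv Hd q k) (\<tau> p) (fderiv \<tau> p v))) (at p)"
    proof (rule has_derivative_compose[OF has_fderiv[OF \<tau>D], where g="\<lambda>q. fderiv Hd q k"])
      show "((\<lambda>q. fderiv Hd q k) has_derivative fderiv (\<lambda>q. fderiv Hd q k) (\<tau> p)) (at (\<tau> p))"
        unfolding \<tau>p Hd_def by (intro has_fderiv H_derivative_differentiable dA)
    qed
  qed
  then have "((\<lambda>q. fderiv (Hc f c) q b) has_derivative
      (\<lambda>v. \<Sum>k\<in>Basis. ?A1 k v + ?A2 k v)) (at p)"
    by (rule has_derivative_transform_within_open[OF _ T E])
  note E' = frechet_derivative_at[OF this]
  have alg: "n * (L * (n * \<kappa> * (L * t)) + L * t * \<kappa>) = n * (L + n * L\<^sup>2) * \<kappa> * t" for n t :: real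
    by (simp add: power2_eq_square distrib_left distrib_right)
  have eq: "fderiv (\<lambda>q. fderiv (Hc f c) q b) p v = (\<Sum>k\<in>Basis. ?A1 k v + ?A2 k v)"
    by (rule fun_cong[OF E'[symmetric]])
  have "norm (fderiv (\<lambda>q. fderiv (Hc f c) q b) p v)
      \<le> (\<Sum>k\<in>(Basis :: 'n set). L * (DIM('n) * \<kappa> * (L * norm v)) + L * norm v * \<kappa>)"
    unfolding eq
  proof (rule sum_norm_le)
    fix k :: 'n assume k: "k \<in> Basis"
    have "\<bar>fderiv \<tau> p b \<bullet> k\<bar> \<le> L"
      using Basis_le_norm[OF k, of "fderiv \<tau> p b"] t1[of b] b by (simp add: \<tau>_def p_def)
    moreover have "norm (fderiv (\<lambda>q. fderiv Hd q k) (\<tau> p) (fderiv \<tau> p v))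
        \<le> DIM('n) * \<kappa> * (L * norm v)"
      using t1[of v] \<kappa>0 by (intro order_trans[OF Hd2[OF k]] mult_left_mono) (auto simp: \<tau>_def p_def)
    ultimately have 1: "norm (?A1 k v) \<le> L * (DIM('n) * \<kappa> * (L * norm v))"
      using L by (simp add: mult_mono)
    have "\<bar>fderiv (\<lambda>q. fderiv \<tau> q b) p v \<bullet> k\<bar> \<le> L * norm v"
      using Basis_le_norm[OF k, of "fderiv (\<lambda>q. fderiv \<tau> q b) p v"] t2[OF b, of v]
      by (simp add: \<tau>_def p_def)
    then have 2: "norm (?A2 k v) \<le> L * norm v * \<kappa>"
      using Hdb[OF k] L by (simp add: mult_mono)
    show "norm (?A1 k v + ?A2 k v) \<le> L * (DIM('n) * \<kappa> * (L * norm v)) + L * norm v * \<kappa>"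
      using 1 2 by (rule norm_triangle_mono)
  qed
  also have "\<dots> = DIM('n) * (L + DIM('n) * L\<^sup>2) * \<kappa> * norm v"
    unfolding sum_constant by (rule alg)
  finally show "norm (fderiv (\<lambda>p. fderiv (Hc f c) p b) (chart_map c x) v)
      \<le> DIM('n) * (L + DIM('n) * L\<^sup>2) * C2_dist f * norm v"
    by (simp add: \<kappa>_def p_def)
qed

end

section \<open>The estimate near a point\<close>

context embedded_manifold
begin

text \<open>The C1 size of the ambient displacement at one point. The propagation lemma starts from
  values and first derivatives together, so this is the quantity passed from point to point.\<close>

definition displacement :: "('m, 'n) chart \<Rightarrow> ('m \<Rightarrow> 'm) \<Rightarrow> 'm \<Rightarrow> real" where
  "displacement c f x = norm (H f x) +
     (\<Sum>b\<in>Basis. norm (fderiv (Hc f c) (chart_map c x) b))"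

definition metric_defect :: "('m \<Rightarrow> 'm) \<Rightarrow> real" where
  "metric_defect f = field_norm M A g (\<lambda>x u v. pullback A f g x u v - g x u v)"

abbreviation tangent_defect :: "('m \<Rightarrow> 'm) \<Rightarrow> 'm \<Rightarrow> real" where
  "tangent_defect f x \<equiv> hs_norm_endo A g x (\<lambda>v c. differential A f x v c - v c)"

definition defect :: "('m \<Rightarrow> 'm) \<Rightarrow> real \<Rightarrow> real" where
  "defect f \<gamma> = C2_dist f * \<gamma> + metric_defect f / \<gamma>"

text \<open>The pieces of the cover that miss \<open>x0\<close> have a compact union. Outside it
  every point lies in a piece containing \<open>x0\<close>, so near \<open>x0\<close> only the
  charts of those pieces matter, and all of them are defined on one common ball.\<close>

lemma chart_cover_neighbourhood:
  assumes c: "c \<in> A" "x0 \<in> chart_dom c"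
  obtains R where "0 < R" "cball (chart_map c x0) R \<subseteq> chart_image c"
    "\<And>p. p \<in> cball (chart_map c x0) R \<Longrightarrow>
       \<exists>d K. (d, K) \<in> F \<and> x0 \<in> K \<and> chart_inv c p \<in> K"
    "\<And>d K. (d, K) \<in> F \<Longrightarrow> x0 \<in> K \<Longrightarrow>
       cball (chart_map c x0) R \<subseteq> chart_map c ` (chart_dom c \<inter> chart_dom d)"
proof -
  define F0 where "F0 = {dK \<in> F. x0 \<in> snd dK}"
  define T where "T = chart_dom c \<inter> (\<Inter>dK\<in>F0. chart_dom (fst dK))"
  define Z where "Z = (\<Union>dK\<in>F - F0. snd dK)"
  have x0M: "x0 \<in> M" using c chart_dom_subset by blast
  have "open_in_M T"
  proof (cases "F0 = {}")
    case True
    then show ?thesis using chart_dom_openin[OF c(1)] by (simp add: T_def)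
  next
    case False
    have "open_in_M (chart_dom (fst dK))" if "dK \<in> F0" for dK
      using that cover_chart[of "fst dK" "snd dK"] by (intro chart_dom_openin) (simp add: F0_def)
    moreover have "finite F0" using cover_finite by (simp add: F0_def)
    ultimately have "open_in_M (\<Inter>dK\<in>F0. chart_dom (fst dK))"
      using False by (intro openin_INT2) blast+
    then show ?thesis unfolding T_def by (intro openin_Int chart_dom_openin c)
  qed
  moreover have "compact Z"
    unfolding Z_def using cover_finite cover_compact by (intro compact_UN) auto
  then have "open_in_M (M - Z)"
    by (metis compact_imp_closed Diff_eq open_Compl openin_open)
  ultimately have T': "open_in_M (T \<inter> (M - Z))" by (rule openin_Int)
  have "x0 \<in> T \<inter> (M - Z)"
    using c x0M cover_dom by (auto simp: T_def Z_def F0_def)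
  moreover have "open (chart_map c ` (T \<inter> (M - Z)))"
    using T' by (intro chart_map_open_image c) (auto simp: T_def)
  ultimately obtain R where R: "0 < R" "cball (chart_map c x0) R \<subseteq> chart_map c ` (T \<inter> (M - Z))"
    using open_contains_cball by blast
  show ?thesis
  proof
    show "0 < R" by (rule R)
    show "cball (chart_map c x0) R \<subseteq> chart_image c" using R(2) by (auto simp: T_def)
  next
    fix p assume "p \<in> cball (chart_map c x0) R"
    then obtain x where x: "x \<in> T \<inter> (M - Z)" "p = chart_map c x" using R(2) by blast
    then have px: "chart_inv c p = x" using c by (simp add: T_def)
    obtain d K where dK: "(d, K) \<in> F" "x \<in> K" using x cover_M by blast
    moreover have "x0 \<in> K" using x(1) dK by (force simp: Z_def F0_def)
    ultimately show "\<exists>d K. (d, K) \<in> F \<and> x0 \<in> K \<and> chart_inv c p \<in> K" using px by blast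
  next
    fix d K assume "(d, K) \<in> F" "x0 \<in> K"
    then have "(d, K) \<in> F0" by (simp add: F0_def)
    then have "T \<inter> (M - Z) \<subseteq> chart_dom c \<inter> chart_dom (fst (d, K))" unfolding T_def by blast
    then have "T \<inter> (M - Z) \<subseteq> chart_dom c \<inter> chart_dom d" unfolding fst_conv .
    then show "cball (chart_map c x0) R \<subseteq> chart_map c ` (chart_dom c \<inter> chart_dom d)"
      using R(2) by (meson image_mono order_trans)
  qed
qed

text \<open>The derivative at the centre is injective, hence bounded below by some
  \<open>\<mu>0\<close>. On a ball where it varies by at most half of that, the derivative keeps the
  lower bound \<open>\<mu>0 / 2\<close>, and so does the map, by the mean value inequality for
  \<open>\<psi>\<close> minus its derivative at the centre. All constants are fixed before
  \<open>h\<close>.\<close>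

lemma immersion_chart_bounds:
  assumes c: "c \<in> A" "x0 \<in> chart_dom c" and R0: "0 < R0" "cball (chart_map c x0) R0 \<subseteq> chart_image c"
  obtains R L \<mu> where "0 < R" "R \<le> R0" "0 < L" "0 < \<mu>"
    "\<And>h u B \<kappa>. convex B \<Longrightarrow> B \<subseteq> cball (chart_map c x0) R \<Longrightarrow> (\<And>p. p \<in> B \<Longrightarrow> p + h p \<in> cball (chart_map c x0) R) \<Longrightarrow>
       (\<And>p. p \<in> B \<Longrightarrow> (h has_derivative u p) (at p)) \<Longrightarrow> 0 \<le> \<kappa> \<Longrightarrow>
       immersed_displacement B (cball (chart_map c x0) R) (\<iota> \<circ> chart_inv c)
         (\<lambda>p. fderiv (\<iota> \<circ> chart_inv c) p)
         (\<lambda>b p. fderiv (\<lambda>p. fderiv (\<iota> \<circ> chart_inv c) p b) p) h u L \<mu> \<kappa>"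
proof -
  define p0 where "p0 = chart_map c x0"
  define \<psi> where "\<psi> = \<iota> \<circ> chart_inv c"
  define D where "D = (\<lambda>p. fderiv \<psi> p)"
  have \<psi>C: "Ck_on k (chart_image c) \<psi>" for k unfolding \<psi>_def by (rule \<iota>_Ck[OF c(1)])
  note R0' = R0(2)[folded p0_def]
  \<comment> \<open>The C2 bounds are applied to the partial derivatives of \<open>\<psi>\<close>,
    because its second derivatives have to be Lipschitz; this consumes three derivatives of the
    embedding.\<close>
  have "Ck_on 2 (chart_image c) (\<lambda>p. D p b)" for b
    using \<psi>C[of "Suc 2"] unfolding D_def by (rule Ck_on_derivative)
  then obtain L1 where L1: "0 < L1"
    "\<And>b p. b \<in> Basis \<Longrightarrow> p \<in> cball p0 R0 \<Longrightarrow> norm (D p b) \<le> L1"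
    "\<And>b p v. b \<in> Basis \<Longrightarrow> p \<in> cball p0 R0 \<Longrightarrow> norm (fderiv (\<lambda>p. D p b) p v) \<le> L1 * norm v"
    "\<And>b p q v. b \<in> Basis \<Longrightarrow> p \<in> cball p0 R0 \<Longrightarrow> q \<in> cball p0 R0 \<Longrightarrow>
       norm (fderiv (\<lambda>p. D p b) p v - fderiv (\<lambda>p. D p b) q v) \<le> L1 * norm (p - q) * norm v"
    "\<And>b p q. b \<in> Basis \<Longrightarrow> p \<in> cball p0 R0 \<Longrightarrow> q \<in> cball p0 R0 \<Longrightarrow> norm (D p b - D q b) \<le> L1 * norm (p - q)"
    by (rule C2_on_cball_bounds[where I="Basis" and \<Phi>="\<lambda>b p. D p b", OF finite_Basis R0']) blast
  define L where "L = DIM('n) * L1"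
  have LL: "L1 \<le> L" "0 < L" using L1(1) DIM_positive[where 'a='n] by (auto simp: L_def Suc_le_eq)
  have \<psi>d: "(\<psi> has_derivative D p) (at p)" if "p \<in> cball p0 R0" for p
    unfolding D_def using \<psi>C[of 1] R0' that by (intro has_fderiv) auto
  note lin = has_derivative_linear[OF \<psi>d]
  have Db: "norm (D p v) \<le> L * norm v" if "p \<in> cball p0 R0" for p v
    unfolding L_def by (rule linear_norm_le_Basis[OF lin[OF that] L1(2)[OF _ that]])
  have Dl: "norm (D p v - D q v) \<le> L * norm (p - q) * norm v" if "p \<in> cball p0 R0" "q \<in> cball p0 R0" for p q v
    using linear_norm_le_Basis[OF linear_compose_sub[OF lin lin] L1(5)[OF _ that], OF that, of v]
    by (simp add: L_def mult_ac)
  have lin0: "linear (D p0)" using R0 lin[of p0] by simp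
  have "inj (D p0)" unfolding D_def \<psi>_def p0_def by (rule \<iota>_immersion[OF c])
  then obtain \<mu>0 where \<mu>0: "0 < \<mu>0" "\<And>v. \<mu>0 * norm v \<le> norm (D p0 v)"
    using linear_inj_bounded_below_pos[OF lin0] by metis
  define R where "R = min R0 (\<mu>0 / (2 * L))"
  have R: "0 < R" "R \<le> R0" using R0 \<mu>0 LL by (auto simp: R_def)
  have "L * R \<le> L * (\<mu>0 / (2 * L))" using LL by (intro mult_left_mono) (auto simp: R_def)
  then have R3: "L * R \<le> \<mu>0 / 2" using LL by simp
  define \<mu> where "\<mu> = \<mu>0 / 2"
  have near: "norm (D p v - D p0 v) \<le> \<mu> * norm v" if "p \<in> cball p0 R" for p v
  proof -
    have "norm (D p v - D p0 v) \<le> L * norm (p - p0) * norm v"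
      using that R by (intro Dl) auto
    also have "\<dots> \<le> L * R * norm v"
      using that LL by (intro mult_right_mono mult_left_mono) (auto simp: dist_norm norm_minus_commute)
    also have "\<dots> \<le> \<mu> * norm v" using R3 by (intro mult_right_mono) (auto simp: \<mu>_def)
    finally show ?thesis .
  qed
  have sub: "cball p0 R \<subseteq> cball p0 R0" using R by auto
  have lower': "\<mu> * norm v \<le> norm (D p v)" if "p \<in> cball p0 R" for p v
    using near[OF that, of v] \<mu>0(2)[of v] norm_triangle_ineq2[of "D p0 v" "D p0 v - D p v"]
    by (simp add: \<mu>_def norm_minus_commute)
  have lower: "\<mu> * norm (p - q) \<le> norm (\<psi> p - \<psi> q)" if "p \<in> cball p0 R" "q \<in> cball p0 R" for p q
  proof -
    have "norm ((\<psi> p - D p0 p) - (\<psi> q - D p0 q)) \<le> \<mu> * norm (p - q)"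
    proof (rule has_derivative_bound[OF convex_cball _ near that])
      fix p assume "p \<in> cball p0 R"
      then show "((\<lambda>p. \<psi> p - D p0 p) has_derivative (\<lambda>v. D p v - D p0 v)) (at p)"
        using sub lin0 by (intro has_derivative_diff \<psi>d linear_imp_has_derivative) auto
    qed
    moreover have "(\<psi> p - D p0 p) - (\<psi> q - D p0 q) = (\<psi> p - \<psi> q) - D p0 (p - q)"
      by (simp add: linear_diff[OF lin0])
    ultimately show ?thesis
      using \<mu>0(2)[of "p - q"] norm_triangle_ineq2[of "D p0 (p - q)" "\<psi> p - \<psi> q"]
      by (simp add: \<mu>_def norm_minus_commute)
  qed
  show ?thesis
  proof (rule that[OF R(1,2) LL(2)])
    show "0 < \<mu>" using \<mu>0 by (simp add: \<mu>_def)
    fix h u B \<kappa>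
    assume B: "convex B" "B \<subseteq> cball (chart_map c x0) R" "\<And>p. p \<in> B \<Longrightarrow> p + h p \<in> cball (chart_map c x0) R"
      "\<And>p. p \<in> B \<Longrightarrow> (h has_derivative u p) (at p)" "0 \<le> (\<kappa>::real)"
    have "immersed_displacement B (cball p0 R) \<psi> D (\<lambda>b p. fderiv (\<lambda>p. D p b) p) h u L \<mu> \<kappa>"
    proof
      show "0 < \<mu>" by fact
      fix p assume "p \<in> cball p0 R"
      then have p: "p \<in> cball p0 R0" using sub by auto
      show "(\<psi> has_derivative D p) (at p)" by (rule \<psi>d[OF p])
      show "norm (D p v) \<le> L * norm v" for v by (rule Db[OF p])
      fix b :: 'n assume b: "b \<in> Basis"
      have "p \<in> chart_image c" using p R0' by auto
      then show "((\<lambda>p. D p b) has_derivative fderiv (\<lambda>p. D p b) p) (at p)"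
        unfolding D_def using \<psi>C[of 2] by (intro has_fderiv) (auto simp: numeral_2_eq_2)
      show "norm (fderiv (\<lambda>p. D p b) p v) \<le> L * norm v" for v
        using L1(3)[OF b p, of v] mult_right_mono[OF LL(1), of "norm v"] by simp
    next
      fix p q assume "p \<in> cball p0 R" "q \<in> cball p0 R"
      then have pq: "p \<in> cball p0 R0" "q \<in> cball p0 R0" using sub by auto
      show "norm (\<psi> p - \<psi> q) \<le> L * norm (p - q)"
        by (rule has_derivative_bound[OF convex_cball \<psi>d Db pq])
      show "norm (D p v - D q v) \<le> L * norm (p - q) * norm v" for v by (rule Dl[OF pq])
      show "norm (fderiv (\<lambda>p. D p b) p v - fderiv (\<lambda>p. D p b) q v) \<le> L * norm (p - q) * norm v"
        if b: "b \<in> Basis" for b v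
        using L1(4)[OF b pq, of v] mult_right_mono[OF LL(1), of "norm (p - q) * norm v"] by (simp add: mult.assoc)
    qed (use B LL lower lower' in \<open>auto simp: p0_def\<close>)
    then show "immersed_displacement B (cball (chart_map c x0) R) (\<iota> \<circ> chart_inv c)
         (\<lambda>p. fderiv (\<iota> \<circ> chart_inv c) p)
         (\<lambda>b p. fderiv (\<lambda>p. fderiv (\<iota> \<circ> chart_inv c) p b) p) h u L \<mu> \<kappa>"
      unfolding D_def \<psi>_def p0_def .
  qed
qed

end

section \<open>Pointwise meaning of the defects in a chart\<close>

context embedded_manifold_map
begin

lemma metric_defect_bound:
  assumes c: "c \<in> A" "x \<in> chart_dom c" "f x \<in> chart_dom c"
  defines "D \<equiv> fderiv (chart_map c \<circ> f \<circ> chart_inv c) (chart_map c x)"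
  shows "\<bar>gcoord A g c (chart_map c (f x)) (D v) (D v) - gcoord A g c (chart_map c x) v v\<bar>
    \<le> (real DIM('n))\<^sup>2 * metric_defect f * gcoord A g c (chart_map c x) v v"
proof -
  let ?G = "gcoord A g c"
  let ?T = "\<lambda>u v. pullback A f g x u v - g x u v"
  let ?S = "\<lambda>u v. ?G (chart_map c (f x)) (D u) (D v) - ?G (chart_map c x) u v"
  have xM: "x \<in> M" using chart_dom_subset[OF c(1)] c(2) by blast
  have img: "chart_map c x \<in> chart_image c" "chart_map c (f x) \<in> chart_image c"
    using c by auto
  have lin: "linear D" unfolding D_def by (rule linear_frechet_derivative[OF f_differentiable[OF c(1,1,2,3)]])
  have S: "bilinear ?S"
    by (intro bilinear_diff bilinear_compose_linear[OF _ lin lin] gcoord_bilinear c img)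
  have ST: "?S u v = ?T (coord_vec A c x u) (coord_vec A c x v)" for u v
    unfolding pullback_coord[OF c(1,2,1,3)] gcoord_at[OF c(1,2)] D_def ..
  interpret inner_form "?G (chart_map c x)" by (rule gcoord_inner_product[OF c(1) img(1)])
  have "\<bar>?S v v\<bar> \<le> (real DIM('n))\<^sup>2 * hs_norm_form A g x ?T * sqrt (?G (chart_map c x) v v) * sqrt (?G (chart_map c x) v v)"
    by (rule form_le_hs_norm[OF c(1,2) S ST])
  also have "\<dots> = (real DIM('n))\<^sup>2 * hs_norm_form A g x ?T * ?G (chart_map c x) v v"
    using nonneg by (simp add: mult.assoc)
  also have "\<dots> \<le> (real DIM('n))\<^sup>2 * metric_defect f * ?G (chart_map c x) v v"
    using hs_norm_le_field_norm[OF compact_M xM] nonneg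
    by (intro mult_right_mono mult_left_mono) (auto simp: metric_defect_def)
  finally show ?thesis .
qed

text \<open>The Hilbert-Schmidt norm bounds the pairing of \<open>u v\<close> with every
  \<open>w\<close>; taking \<open>w = u v\<close> and cancelling one factor bounds the length of
  \<open>u v\<close>.\<close>

lemma fixed_point_bound:
  assumes c: "c \<in> A" "x \<in> chart_dom c" "f x = x"
  defines "u \<equiv> \<lambda>v. fderiv (chart_map c \<circ> f \<circ> chart_inv c) (chart_map c x) v - v"
  shows "sqrt (gcoord A g c (chart_map c x) (u v) (u v)) \<le>
    (real DIM('n))\<^sup>2 * tangent_defect f x * sqrt (gcoord A g c (chart_map c x) v v)"
proof -
  let ?G = "gcoord A g c (chart_map c x)"
  let ?\<theta> = "tangent_defect f x"
  have img: "chart_map c x \<in> chart_image c" using c by auto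
  have fx: "f x \<in> chart_dom c" using c by simp
  interpret inner_form ?G by (rule gcoord_inner_product[OF c(1) img])
  have lin: "linear u"
    unfolding u_def by (intro linear_compose_sub linear_frechet_derivative f_differentiable c fx linear_ident)
  have S: "bilinear (\<lambda>v w. ?G (u v) w)"
    by (rule bilinear_compose_linear[OF bil lin linear_ident])
  have ST: "?G (u v) w = g x ((\<lambda>v c. differential A f x v c - v c) (coord_vec A c x v)) (coord_vec A c x w)" for v w
  proof -
    have "coord_vec A c x (u v) = (\<lambda>d. differential A f x (coord_vec A c x v) d - coord_vec A c x v d)"
      using coord_vec_linear[OF c(1,2), of 1 _ "- 1" v] differential_coord_vec[OF c(1,2,1) fx, of v] c(3)
      by (simp add: u_def)
    then show ?thesis by (simp add: gcoord_at[OF c(1,2)])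
  qed
  have "\<bar>?G (u v) (u v)\<bar> \<le> (real DIM('n))\<^sup>2 * ?\<theta> * sqrt (?G v v) * sqrt (?G (u v) (u v))"
    unfolding hs_norm_endo_def by (rule form_le_hs_norm[OF c(1,2) S ST])
  then have le: "sqrt (?G (u v) (u v)) * sqrt (?G (u v) (u v)) \<le> (real DIM('n))\<^sup>2 * ?\<theta> * sqrt (?G v v) * sqrt (?G (u v) (u v))"
    using nonneg[of "u v"] by simp
  have ge: "0 \<le> (real DIM('n))\<^sup>2 * ?\<theta> * sqrt (?G v v)"
    using hs_norm_form_nonneg nonneg by (simp add: hs_norm_endo_def)
  show ?thesis
  proof (cases "?G (u v) (u v) = 0")
    case True
    then show ?thesis using ge by simp
  next
    case False
    then have "0 < sqrt (?G (u v) (u v))" using nonneg[of "u v"] by simp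
    then show ?thesis using le mult_right_le_imp_le by blast
  qed
qed

lemma displacement_ge:
  assumes c: "c \<in> A" "x \<in> chart_dom c"
  shows "norm (H f x) \<le> displacement c f x"
    "norm (fderiv (Hc f c) (chart_map c x) v) \<le> displacement c f x * norm v"
proof -
  let ?D = "fderiv (Hc f c) (chart_map c x)"
  show "norm (H f x) \<le> displacement c f x"
    unfolding displacement_def by (simp add: sum_nonneg)
  have "norm (?D v) = norm (\<Sum>b\<in>Basis. (v \<bullet> b) *\<^sub>R ?D b)"
    using linear_Basis_expansion[OF linear_frechet_derivative[OF H_differentiable[OF c]], of v] by simp
  also have "\<dots> \<le> (\<Sum>b\<in>Basis. norm v * norm (?D b))"
    by (rule sum_norm_le) (auto intro!: mult_right_mono Basis_le_norm)
  also have "\<dots> = (\<Sum>b\<in>Basis. norm (?D b)) * norm v" by (simp add: sum_distrib_left mult.commute)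
  also have "\<dots> \<le> displacement c f x * norm v"
    unfolding displacement_def by (intro mult_right_mono) auto
  finally show "norm (?D v) \<le> displacement c f x * norm v" .
qed

end

context embedded_manifold
begin

text \<open>The order of quantifiers is the point: \<open>V\<close>, \<open>C\<close> and
  \<open>r\<close> depend on \<open>x0\<close> and \<open>c\<close>, not on \<open>f\<close> or
  \<gamma>. The last conjunct starts the propagation at the fixed point.\<close>

lemma local_estimate:
  assumes c: "c \<in> A" "x0 \<in> chart_dom c"
  shows "\<exists>V C r. open_in_M V \<and> x0 \<in> V \<and> V \<subseteq> chart_dom c \<and> 0 < C \<and> 0 < r \<and>
    (\<forall>f. Ck_self_map 2 M A f \<longrightarrow> C2_dist f < r \<longrightarrow>
      (\<forall>\<gamma> x y. 0 < \<gamma> \<longrightarrow> \<gamma> < r \<longrightarrow> x \<in> V \<longrightarrow> y \<in> V \<longrightarrow>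
         displacement c f y \<le> C * (displacement c f x + defect f \<gamma>)) \<and>
      (\<forall>x\<in>V. f x = x \<longrightarrow>
         displacement c f x \<le> C * tangent_defect f x))"
proof -
  have x0M: "x0 \<in> M" using chart_dom_subset[OF c(1)] c(2) by blast
  define p0 where "p0 = chart_map c x0"
  define \<psi> where "\<psi> = \<iota> \<circ> chart_inv c"
  define D where "D = (\<lambda>p. fderiv \<psi> p)"
  define D2 where "D2 = (\<lambda>b p. fderiv (\<lambda>p. D p b) p)"
  let ?G = "gcoord A g c"
  obtain R0 where R0: "0 < R0" "cball p0 R0 \<subseteq> chart_image c"
    "\<And>p. p \<in> cball p0 R0 \<Longrightarrow> \<exists>d K. (d, K) \<in> F \<and> x0 \<in> K \<and> chart_inv c p \<in> K"
    "\<And>d K. (d, K) \<in> F \<Longrightarrow> x0 \<in> K \<Longrightarrow> cball p0 R0 \<subseteq> chart_map c ` (chart_dom c \<inter> chart_dom d)"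
    using chart_cover_neighbourhood[OF c] unfolding p0_def by metis
  obtain R L \<mu> where R: "0 < R" "R \<le> R0" and L: "0 < L" and \<mu>: "0 < \<mu>" and
    imm: "\<And>h u B \<kappa>. convex B \<Longrightarrow> B \<subseteq> cball p0 R \<Longrightarrow> (\<And>p. p \<in> B \<Longrightarrow> p + h p \<in> cball p0 R) \<Longrightarrow>
       (\<And>p. p \<in> B \<Longrightarrow> (h has_derivative u p) (at p)) \<Longrightarrow> 0 \<le> \<kappa> \<Longrightarrow>
       immersed_displacement B (cball p0 R) \<psi> D D2 h u L \<mu> \<kappa>"
    using immersion_chart_bounds[OF c R0(1) R0(2)[unfolded p0_def]] unfolding p0_def \<psi>_def D_def D2_def by blast
  define B' where "B' = cball p0 R"
  have B'R0: "B' \<subseteq> cball p0 R0" using R by (auto simp: B'_def)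
  then have B'c: "B' \<subseteq> chart_image c" using R0(2) by blast
  note B'c' = B'c[unfolded B'_def]
  obtain LG where LG: "0 < LG"
    "\<And>p a b. p \<in> B' \<Longrightarrow> \<bar>?G p a b\<bar> \<le> LG * norm a * norm b"
    "\<And>p q a b. p \<in> B' \<Longrightarrow> q \<in> B' \<Longrightarrow> \<bar>?G p a b - ?G q a b\<bar> \<le> LG * norm (p - q) * norm a * norm b"
    "\<And>i j p v. p \<in> B' \<Longrightarrow> i \<in> Basis \<Longrightarrow> j \<in> Basis \<Longrightarrow>
       norm (fderiv (\<lambda>p. ?G p i j) p v) \<le> LG * norm v"
    "\<And>i j p q v. p \<in> B' \<Longrightarrow> q \<in> B' \<Longrightarrow> i \<in> Basis \<Longrightarrow> j \<in> Basis \<Longrightarrow>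
       norm (fderiv (\<lambda>p. ?G p i j) p v - fderiv (\<lambda>p. ?G p i j) q v) \<le> LG * norm (p - q) * norm v"
    unfolding B'_def by (rule gcoord_bounds[OF c(1) B'c']) blast
  obtain m where m: "0 < m" "\<And>p v. p \<in> B' \<Longrightarrow> m * (norm v)\<^sup>2 \<le> ?G p v v"
    unfolding B'_def by (rule gcoord_lower_bound[OF c(1) compact_cball B'c']) blast
  \<comment> \<open>The charts of the cover pieces containing \<open>x0\<close>. There are finitely
    many, so a single \<open>LT\<close> bounds all transition maps used below.\<close>
  define I where "I = fst ` {dK \<in> F. x0 \<in> snd dK}"
  have IF: "d \<in> I" if "(d, K) \<in> F" "x0 \<in> K" for d K
    using that unfolding I_def by force
  have IC: "Ck_on 2 (cball p0 R0) (transition c d)" if d: "d \<in> I" for d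
  proof -
    obtain dK where "dK \<in> F" "x0 \<in> snd dK" "d = fst dK" using d unfolding I_def by blast
    then have dK: "(d, snd dK) \<in> F" "x0 \<in> snd dK" by simp_all
    show ?thesis
      by (rule Ck_on_subset[OF transition_Ck[OF c(1) cover_chart[OF dK(1)]] R0(4)[OF dK]])
  qed
  have "finite I" using cover_finite by (simp add: I_def)
  then obtain LT where LT: "0 < LT"
    "\<And>d p v. d \<in> I \<Longrightarrow> p \<in> B' \<Longrightarrow> norm (fderiv (transition c d) p v) \<le> LT * norm v"
    "\<And>d p b v. d \<in> I \<Longrightarrow> p \<in> B' \<Longrightarrow> b \<in> Basis \<Longrightarrow>
       norm (fderiv (\<lambda>p. fderiv (transition c d) p b) p v) \<le> LT * norm v"
    unfolding B'_def by (rule C2_on_cball_bounds[where \<Phi>="transition c", OF _ B'R0[unfolded B'_def] IC]) blast+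
  define V' where "V' = chart_inv c ` ball p0 R"
  have "open_in_M V'" unfolding V'_def
    using B'c' by (intro chart_inv_open_image c) (auto simp: subset_iff)
  moreover have "x0 \<in> V'" unfolding V'_def
    using c R(1) by (intro image_eqI[of _ _ p0]) (auto simp: p0_def)
  ultimately obtain r1 where r1: "0 < r1" "\<And>y. y \<in> M \<Longrightarrow> norm (\<iota> y - \<iota> x0) < r1 \<Longrightarrow> y \<in> V'"
    using \<iota>_separates by metis
  \<comment> \<open>Over the empty set the conditions on the displacement hold trivially; this makes
    the Lipschitz bound on \<open>\<psi>\<close> available before it is known that \<open>f\<close>
    stays in the chart.\<close>
  interpret I0: immersed_displacement "{}" B' \<psi> D D2 "\<lambda>_. 0" "\<lambda>_ _. 0" L \<mu> 0
    unfolding B'_def by (rule imm) auto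
  let ?n = "real DIM('n)"
  define a where "a = (1 + L / \<mu>) / \<mu>"
  define CH where "CH = 1 + ?n * LT + ?n * (?n * (LT + ?n * LT\<^sup>2))"
  define Cu where "Cu = (1 + (2 * DIM('n) + 2) * L * ((1 + L / \<mu>) / \<mu>)) / \<mu>"
  \<comment> \<open>One constant has to dominate \<open>LG\<close>, for \<open>G\<close> itself, and
    \<open>?n\<^sup>2 * (2 * LG)\<close>, for the increments of \<open>G\<close> along the
    displacement.\<close>
  define LA where "LA = LG * (1 + 2 * ?n\<^sup>2)"
  have a0: "0 < a" using L \<mu> by (auto simp: a_def add_pos_pos)
  have CH0: "0 < CH" "?n * LT \<le> CH" "?n * (?n * (LT + ?n * LT\<^sup>2)) \<le> CH"
    using LT(1) by (auto simp: CH_def intro!: add_pos_nonneg)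
  have Cu0: "0 < Cu" using L \<mu> by (auto simp: Cu_def add_pos_nonneg)
  have LA0: "0 < LA" "LG \<le> LA" "?n\<^sup>2 * (2 * LG) \<le> LA"
    using LG(1) by (auto simp: LA_def distrib_left intro!: mult_pos_pos add_pos_nonneg)
  \<comment> \<open>\<open>r1 / (4 * L)\<close> keeps the ambient image of the ball within
    \<open>r1 / 4\<close> of \<open>\<iota> x0\<close>. The last two bounds are the smallness
    conditions of the propagation lemma, with 9072 = 2 * 324 * 14.\<close>
  define \<rho> where "\<rho> = min R (min (r1 / (4 * L)) (min (1 / 4) (m / (9072 * LA))))"
  have \<rho>: "0 < \<rho>" "\<rho> \<le> R" "\<rho> \<le> r1 / (4 * L)" "\<rho> \<le> 1 / 4" "\<rho> \<le> m / (9072 * LA)"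
    using R L r1 m LA0 by (auto simp: \<rho>_def)
  have \<rho>1: "L * \<rho> < r1 / 2"
  proof -
    have "L * \<rho> \<le> L * (r1 / (4 * L))" using L \<rho>(3) by (intro mult_left_mono) auto
    also have "\<dots> = r1 / 4" using L by simp
    finally show ?thesis using r1 by linarith
  qed
  have small: "4 * \<rho> \<le> 1" "324 * \<rho> / m * (14 * LA) \<le> 1 / 2"
    using \<rho>(4,5) m(1) LA0(1) by (simp_all add: field_simps)
  \<comment> \<open>\<open>r1 / 2\<close> keeps \<open>f\<close> of the small ball in
    \<open>V'\<close>, \<open>\<rho> / 2\<close> gives room \<open>2 * \<gamma>\<close>, and the
    last two make the a priori bounds on \<open>h\<close>, \<open>u\<close> and the Lipschitz
    constant of \<open>u\<close> at most 1.\<close>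
  define r where "r = min (r1 / 2) (min (\<rho> / 2) (min (1 / (a * CH)) (1 / (Cu * CH))))"
  have r: "0 < r" "r \<le> r1 / 2" "r \<le> \<rho> / 2" "r \<le> 1 / (a * CH)" "r \<le> 1 / (Cu * CH)"
    using r1 \<rho> a0 CH0 Cu0 by (auto simp: r_def)
  define B where "B = cball p0 \<rho>"
  define V where "V = chart_inv c ` ball p0 \<rho>"
  have BB': "B \<subseteq> B'" using \<rho> by (auto simp: B_def B'_def)
  define Q0 where "Q0 = 324 * \<rho> / m * (?n\<^sup>2 * LG)"
  define C1 where "C1 = (1 + 2 * ?n) * L"
  \<comment> \<open>\<open>C1\<close> turns bounds on \<open>h\<close> and \<open>u\<close> into a
    bound on \<open>displacement\<close>. The first summand serves the propagation, the second the
    fixed point.\<close>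
  define C where "C = C1 * (2 * (a + 6 * (Cu * CH) + Q0)) + C1 * (?n\<^sup>2 * sqrt (LG / m))"
  have Q0: "0 \<le> Q0" using \<rho> m LG by (simp add: Q0_def)
  have C1: "0 < C1" using L by (simp add: C1_def add_pos_nonneg)
  have C2: "0 < C1 * (2 * (a + 6 * (Cu * CH) + Q0))"
    using C1 a0 Cu0 CH0 Q0 by (intro mult_pos_pos add_pos_nonneg) auto
  have C3: "0 \<le> C1 * (?n\<^sup>2 * sqrt (LG / m))" using C1 LG(1) m(1) by simp
  have V: "open_in_M V" "x0 \<in> V" "V \<subseteq> chart_dom c"
  proof -
    have "ball p0 \<rho> \<subseteq> B'" using \<rho> by (auto simp: B'_def)
    then have "ball p0 \<rho> \<subseteq> chart_image c" using B'c by blast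
    then show "open_in_M V" "V \<subseteq> chart_dom c"
      unfolding V_def using c chart_inv_dom[OF c(1)] by (auto intro!: chart_inv_open_image)
    show "x0 \<in> V" unfolding V_def
      using c \<rho> by (intro image_eqI[of _ _ p0]) (auto simp: p0_def)
  qed
  have VB: "chart_map c x \<in> B" "x \<in> chart_dom c" if x: "x \<in> V" for x
  proof -
    obtain p where p: "p \<in> ball p0 \<rho>" "x = chart_inv c p" using x unfolding V_def by blast
    then have pB: "p \<in> B" by (simp add: B_def)
    then have "p \<in> chart_image c" using BB' B'c by blast
    then show "chart_map c x \<in> B" "x \<in> chart_dom c" using p pB c by auto
  qed
  have main: "(\<forall>\<gamma> x y. 0 < \<gamma> \<longrightarrow> \<gamma> < r \<longrightarrow> x \<in> V \<longrightarrow> y \<in> V \<longrightarrow>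
         displacement c f y \<le> C * (displacement c f x + defect f \<gamma>)) \<and>
      (\<forall>x\<in>V. f x = x \<longrightarrow>
         displacement c f x \<le> C * tangent_defect f x)"
    if f: "Ck_self_map 2 M A f" "C2_dist f < r" for f
  proof -
    interpret f: embedded_manifold_map M A g F \<iota> f by unfold_locales (rule f(1))
    define \<kappa> \<eta> where "\<kappa> = C2_dist f" and "\<eta> = metric_defect f"
    have \<kappa>0: "0 \<le> \<kappa>" using f.H_le[OF x0M] norm_ge_zero order_trans unfolding \<kappa>_def by blast
    have \<kappa>r: "\<kappa> < r" using f(2) by (simp add: \<kappa>_def)
    have \<eta>0: "0 \<le> \<eta>"
      using f.hs_norm_le_field_norm[OF compact_M x0M] hs_norm_form_nonneg order_trans
      unfolding \<eta>_def metric_defect_def by blast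
    have ak: "a * (CH * \<kappa>) \<le> 1" "Cu * (CH * \<kappa>) \<le> 1"
    proof -
      have "\<kappa> \<le> 1 / (a * CH)" "\<kappa> \<le> 1 / (Cu * CH)" using \<kappa>r r by auto
      then show "a * (CH * \<kappa>) \<le> 1" "Cu * (CH * \<kappa>) \<le> 1"
        using a0 CH0 Cu0 by (auto simp: field_simps)
    qed
    define fh where "fh = chart_map c \<circ> f \<circ> chart_inv c"
    define h where "h = (\<lambda>p. fh p - p)"
    define u where "u = (\<lambda>p v. fderiv fh p v - v)"
    define S where "S = chart_map c ` (chart_dom c \<inter> f -` chart_dom c)"
    have pt: "chart_inv c p \<in> chart_dom c" "chart_map c (chart_inv c p) = p" if "p \<in> B" for p
      using that BB' B'c c by auto
    \<comment> \<open>By the triangle inequality in the ambient space, \<open>f\<close> moves the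
      points of \<open>B\<close> to within \<open>r1\<close> of \<open>\<iota> x0\<close>, hence
      into the larger ball of the same chart; so the displacement can be read in \<open>c\<close>
      alone.\<close>
    have fpt: "f (chart_inv c p) \<in> chart_dom c" "chart_map c (f (chart_inv c p)) \<in> B'" if p: "p \<in> B" for p
    proof -
      let ?x = "chart_inv c p"
      have xM: "?x \<in> M" using pt[OF p] chart_dom_subset[OF c(1)] by blast
      have "norm (\<iota> ?x - \<iota> x0) = norm (\<psi> p - \<psi> p0)" using c by (simp add: \<psi>_def p0_def)
      also have "\<dots> \<le> L * norm (p - p0)" using p BB' R by (intro I0.\<psi>_lip) (auto simp: B'_def)
      also have "\<dots> \<le> L * \<rho>"
        using p L by (intro mult_left_mono) (auto simp: B_def dist_norm norm_minus_commute)
      finally have "norm (\<iota> ?x - \<iota> x0) < r1 / 2" using \<rho>1 by linarith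
      moreover have "norm (\<iota> (f ?x) - \<iota> ?x) < r1 / 2"
        using f.H_le[OF xM] \<kappa>r r by (simp add: \<kappa>_def H_def)
      ultimately have "norm (\<iota> (f ?x) - \<iota> x0) < r1"
        using norm_triangle_ineq[of "\<iota> (f ?x) - \<iota> ?x" "\<iota> ?x - \<iota> x0"] by simp
      then have "f ?x \<in> V'" using f.f_maps[OF xM] r1(2) by blast
      then obtain q where q: "q \<in> ball p0 R" "f ?x = chart_inv c q" unfolding V'_def by blast
      then have "q \<in> B'" by (simp add: B'_def)
      moreover then have "q \<in> chart_image c" using B'c by blast
      ultimately show "f ?x \<in> chart_dom c" "chart_map c (f ?x) \<in> B'" using q c by auto
    qed
    have hp: "p + h p = chart_map c (f (chart_inv c p))" for p by (simp add: h_def fh_def)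
    have S: "open S" "B \<subseteq> S"
      using f.f_dom_open[OF c(1) c(1)] pt fpt by (auto simp: S_def intro!: image_eqI[of _ "chart_map c" "chart_inv c _"])
    have h_deriv: "(h has_derivative u p) (at p)" if p: "p \<in> B" for p
    proof -
      have "fh differentiable (at p)"
        using f.f_differentiable[OF c(1,1) pt(1)[OF p] fpt(1)[OF p]] pt(2)[OF p] by (simp add: fh_def)
      then show ?thesis
        unfolding h_def u_def by (intro has_derivative_diff has_fderiv has_derivative_ident)
    qed
    have maps: "p + h p \<in> B'" if "p \<in> B" for p using fpt(2)[OF that] by (simp add: hp)
    have cB: "convex B" by (simp add: B_def)
    interpret im: immersed_displacement B B' \<psi> D D2 h u L \<mu> "CH * \<kappa>"
      unfolding B'_def using cB BB' maps h_deriv CH0 \<kappa>0 by (intro imm) (auto simp: B'_def)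
    have Hf: "\<psi> (q + h q) - \<psi> q = (Hc f c) q" if "q \<in> S" for q
      using that c by (auto simp: S_def hp \<psi>_def H_def)
    \<comment> \<open>On the open set \<open>S\<close> the two descriptions of the ambient
      displacement agree, so uniqueness of derivatives identifies \<open>DH\<close> with the
      quantity bounded by \<kappa>.\<close>
    have DH: "im.DH p = fderiv (Hc f c) p" if p: "p \<in> B" for p
    proof (rule frechet_derivative_at)
      show "(H f \<circ> chart_inv c has_derivative im.DH p) (at p)"
        using S p by (intro has_derivative_transform_within_open[OF im.H_deriv[OF p] S(1) _ Hf]) auto
    qed
    have Hb: "norm (\<psi> (p + h p) - \<psi> p) \<le> CH * \<kappa>" if p: "p \<in> B" for p
    proof -
      have "p \<in> S" using S p by blast
      moreover have "chart_inv c p \<in> M" using pt[OF p] chart_dom_subset[OF c(1)] by blast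
      ultimately have "norm (\<psi> (p + h p) - \<psi> p) \<le> \<kappa>"
        using f.H_le by (simp add: Hf \<kappa>_def)
      also have "\<dots> \<le> CH * \<kappa>"
        using \<kappa>0 LT(1) mult_right_mono[of 1 CH \<kappa>] by (simp add: CH_def)
      finally show ?thesis .
    qed
    have der: "norm (im.DH p v) \<le> ?n * LT * \<kappa> * norm v"
      "b \<in> Basis \<Longrightarrow> norm (fderiv (\<lambda>p. fderiv (Hc f c) p b) p v)
         \<le> ?n * (LT + ?n * LT\<^sup>2) * \<kappa> * norm v" if p: "p \<in> B" for p v b
    proof -
      have "p \<in> cball p0 R0" using p BB' B'R0 by blast
      then obtain d K where dK: "(d, K) \<in> F" "x0 \<in> K" "chart_inv c p \<in> K" using R0(3) by blast
      have pB': "p \<in> B'" using p BB' by blast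
      note dI = IF[OF dK(1,2)]
      have t1: "norm (fderiv (transition c d) (chart_map c (chart_inv c p)) v) \<le> LT * norm v" for v
        unfolding pt(2)[OF p] by (rule LT(2)[OF dI pB'])
      have t2: "norm (fderiv (\<lambda>p. fderiv (transition c d) p b) (chart_map c (chart_inv c p)) v) \<le> LT * norm v"
        if "b \<in> Basis" for b v
        unfolding pt(2)[OF p] by (rule LT(3)[OF dI pB' that])
      have "norm (fderiv (Hc f c) (chart_map c (chart_inv c p)) v) \<le> ?n * LT * C2_dist f * norm v"
        by (rule f.H_chart_derivative_bound[OF c(1) pt(1)[OF p] dK(1,3) less_imp_le[OF LT(1)] t1]) (erule t2)
      then show "norm (im.DH p v) \<le> ?n * LT * \<kappa> * norm v"
        unfolding DH[OF p] pt(2)[OF p] \<kappa>_def .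
      assume b: "b \<in> Basis"
      have "norm (fderiv (\<lambda>p. fderiv (Hc f c) p b) (chart_map c (chart_inv c p)) v)
         \<le> ?n * (LT + ?n * LT\<^sup>2) * C2_dist f * norm v"
        by (rule f.H_chart_second_derivative_bound[OF c(1) pt(1)[OF p] dK(1,3) less_imp_le[OF LT(1)] t1]) (erule t2, rule b)
      then show "norm (fderiv (\<lambda>p. fderiv (Hc f c) p b) p v)
         \<le> ?n * (LT + ?n * LT\<^sup>2) * \<kappa> * norm v"
        unfolding pt(2)[OF p] \<kappa>_def .
    qed
    have DHb: "norm (im.DH p v) \<le> CH * \<kappa> * norm v" if p: "p \<in> B" for p v
    proof -
      have "?n * LT * \<kappa> * norm v \<le> CH * \<kappa> * norm v"
        using CH0(2) \<kappa>0 by (intro mult_right_mono) auto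
      then show ?thesis using der(1)[OF p, of v] by linarith
    qed
    have DHl: "norm (im.DH p v - im.DH q v) \<le> CH * \<kappa> * norm (p - q) * norm v" if p: "p \<in> B" and q: "q \<in> B" for p q v
    proof -
      have linDH: "linear (im.DH p)" if "p \<in> B" for p by (rule has_derivative_linear[OF im.H_deriv[OF that]])
      have "norm (im.DH p b - im.DH q b) \<le> ?n * (LT + ?n * LT\<^sup>2) * \<kappa> * norm (p - q)" if b: "b \<in> Basis" for b
        unfolding DH[OF p] DH[OF q]
      proof (rule has_derivative_bound[OF cB _ der(2)[OF _ b] p q])
        fix p assume p: "p \<in> B"
        show "((\<lambda>p. fderiv (Hc f c) p b) has_derivative
          fderiv (\<lambda>p. fderiv (Hc f c) p b) p) (at p)"
          using has_fderiv[OF f.H_derivative_differentiable[OF c(1) pt(1)[OF p], of b]]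
          unfolding pt(2)[OF p] .
      qed
      then have "norm (im.DH p v - im.DH q v) \<le> ?n * (?n * (LT + ?n * LT\<^sup>2) * \<kappa> * norm (p - q)) * norm v"
        by (rule linear_norm_le_Basis[OF linear_compose_sub[OF linDH[OF p] linDH[OF q]]])
      also have "\<dots> = (?n * (?n * (LT + ?n * LT\<^sup>2))) * (\<kappa> * norm (p - q) * norm v)" by (simp only: mult.assoc)
      also have "\<dots> \<le> CH * (\<kappa> * norm (p - q) * norm v)"
        using CH0(3) \<kappa>0 by (intro mult_right_mono) auto
      finally show ?thesis by (simp only: mult.assoc)
    qed
    have h1: "norm (h p) \<le> 1" and u1: "norm (u p v) \<le> norm v" if p: "p \<in> B" for p v
    proof -
      show "norm (h p) \<le> 1"
        using im.displacement_le(1)[OF p Hb[OF p] DHb[OF p]] ak(1) by (simp add: a_def)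
      have "norm (u p v) \<le> a * (CH * \<kappa>) * norm v"
        using im.displacement_le(2)[OF p Hb[OF p] DHb[OF p]] by (simp add: a_def)
      also have "\<dots> \<le> 1 * norm v" using ak(1) by (rule mult_right_mono) simp
      finally show "norm (u p v) \<le> norm v" by simp
    qed
    have ul: "norm (u p v - u q v) \<le> Cu * (CH * \<kappa>) * norm (p - q) * norm v" if "p \<in> B" "q \<in> B" for p q v
      unfolding Cu_def by (rule im.u_lipschitz[OF Hb DHb DHl refl ak(1)[unfolded a_def] that])
    \<comment> \<open>Shown for every \<open>W\<close> bounding \<open>h\<close> and
      \<open>u\<close>, as the propagation lemma demands. The factor of \<eta> is
      \<open>?n\<^sup>2\<close> from the Hilbert-Schmidt norm times \<open>LG\<close> from passing
      to Euclidean lengths.\<close>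
    have AI: "almost_isometry B B' h u ?G LA m (?n\<^sup>2 * LG * \<eta>) (Cu * (CH * \<kappa>)) W"
      if W: "0 \<le> W" "\<And>p. p \<in> B \<Longrightarrow> norm (h p) \<le> W" "\<And>p v. p \<in> B \<Longrightarrow> norm (u p v) \<le> W * norm v" for W
    proof
      show "convex B" "B \<subseteq> B'" "0 \<le> LA" "0 < m" "0 \<le> W" "Cu * (CH * \<kappa>) \<le> 1" "0 \<le> Cu * (CH * \<kappa>)"
        "0 \<le> ?n\<^sup>2 * LG * \<eta>"
        using cB BB' LA0 m W ak Cu0 CH0 \<kappa>0 \<eta>0 LG by auto
      fix p a b assume p: "p \<in> B'"
      then have pc: "p \<in> chart_image c" using B'c by blast
      show "bilinear (?G p)" by (rule gcoord_bilinear[OF c(1) pc])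
      show "?G p a b = ?G p b a" by (rule inner_form.sym[OF gcoord_inner_product[OF c(1) pc]])
      show "\<bar>?G p a b\<bar> \<le> LA * norm a * norm b"
        using LG(2)[OF p, of a b] mult_right_mono[OF LA0(2), of "norm a * norm b"] by (simp add: mult.assoc)
    next
      fix p q a b assume p: "p \<in> B'" "q \<in> B'"
      show "\<bar>?G p a b - ?G q a b\<bar> \<le> LA * norm (p - q) * norm a * norm b"
        using LG(3)[OF p, of a b] mult_right_mono[OF LA0(2), of "norm (p - q) * norm a * norm b"] by (simp add: mult.assoc)
    next
      fix p q a b assume p: "p \<in> B" "q \<in> B"
      have pc: "p \<in> chart_image c" "q \<in> chart_image c"
        "p + h p \<in> chart_image c" "q + h q \<in> chart_image c"
        using p BB' B'c maps by blast+
      have "\<bar>(?G (p + h p) a b - ?G p a b) - (?G (q + h q) a b - ?G q a b)\<bar> \<le> ?n\<^sup>2 * (2 * LG * W * norm (p - q)) * norm a * norm b"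
      proof (rule bilinear_bound_Basis[where S="\<lambda>a b. (?G (p + h p) a b - ?G p a b) - (?G (q + h q) a b - ?G q a b)"])
        show "bilinear (\<lambda>a b. (?G (p + h p) a b - ?G p a b) - (?G (q + h q) a b - ?G q a b))"
          by (intro bilinear_diff gcoord_bilinear c pc)
        fix i j :: 'n assume ij: "i \<in> Basis" "j \<in> Basis"
        have dG: "((\<lambda>p. ?G p i j) has_derivative fderiv (\<lambda>p. ?G p i j) p) (at p)" if "p \<in> B'" for p
        proof (rule has_fderiv)
          have "p \<in> chart_image c" using that B'c by blast
          then show "(\<lambda>p. ?G p i j) differentiable (at p)"
            using gcoord_Ck[OF c(1), of "Suc 0" i j] Ck_on_differentiable by blast
        qed
        have "norm ((?G (p + h p) i j - ?G p i j) - (?G (q + h q) i j - ?G q i j)) \<le> 2 * LG * W * norm (p - q)"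
          by (rule displacement_increment_bound[where \<Phi>="\<lambda>p. ?G p i j", OF cB dG LG(4)[OF _ ij] LG(5)[OF _ _ ij] h_deriv W(2,3) BB' maps less_imp_le[OF LG(1)] p])
        then show "\<bar>(?G (p + h p) i j - ?G p i j) - (?G (q + h q) i j - ?G q i j)\<bar> \<le> 2 * LG * W * norm (p - q)" by simp
      qed
      also have "\<dots> = (?n\<^sup>2 * (2 * LG)) * (W * norm (p - q) * norm a * norm b)" by (simp only: mult.assoc)
      also have "\<dots> \<le> LA * (W * norm (p - q) * norm a * norm b)"
        using LA0(3) W(1) by (intro mult_right_mono) auto
      finally show "\<bar>(?G (p + h p) a b - ?G p a b) - (?G (q + h q) a b - ?G q a b)\<bar> \<le> LA * W * norm (p - q) * norm a * norm b"
        by (simp only: mult.assoc)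
      show "norm (u p a - u q a) \<le> Cu * (CH * \<kappa>) * norm (p - q) * norm a" by (rule ul[OF p])
    next
      fix p v assume p: "p \<in> B"
      have pB': "p \<in> B'" using p BB' by blast
      show "p + h p \<in> B'" by (rule maps[OF p])
      show "m * (norm v)\<^sup>2 \<le> ?G p v v" by (rule m(2)[OF pB'])
      show "(h has_derivative u p) (at p)" by (rule h_deriv[OF p])
      show "norm (h p) \<le> W" "norm (u p v) \<le> W * norm v" by (rule W(2)[OF p], rule W(3)[OF p])
      show "norm (u p v) \<le> norm v" by (rule u1[OF p])
      have uv: "v + u p v = fderiv fh p v" by (simp add: u_def)
      have "\<bar>?G (p + h p) (v + u p v) (v + u p v) - ?G p v v\<bar> \<le> ?n\<^sup>2 * \<eta> * ?G p v v"
        using f.metric_defect_bound[OF c(1) pt(1)[OF p] fpt(1)[OF p], of v]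
        unfolding uv hp fh_def pt(2)[OF p] \<eta>_def .
      also have "?G p v v \<le> LG * (norm v)\<^sup>2"
        using LG(2)[OF pB', of v v] by (simp add: power2_eq_square mult.assoc)
      then have "?n\<^sup>2 * \<eta> * ?G p v v \<le> ?n\<^sup>2 * \<eta> * (LG * (norm v)\<^sup>2)"
        using \<eta>0 by (intro mult_left_mono) auto
      finally show "\<bar>?G (p + h p) (v + u p v) (v + u p v) - ?G p v v\<bar> \<le> ?n\<^sup>2 * LG * \<eta> * (norm v)\<^sup>2"
        by (simp add: mult_ac)
    qed
    have disp: "displacement c f x \<le> C1 * Q"
      if x: "x \<in> V" and Q: "norm (h (chart_map c x)) \<le> Q" "\<And>v. norm (u (chart_map c x) v) \<le> Q * norm v" for x Q
    proof -
      let ?p = "chart_map c x"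
      note p = VB[OF x]
      have pS: "?p \<in> S" using p S by blast
      have "norm (H f x) \<le> L * Q"
        using im.DH_le(1)[OF p(1) Q] Hf[OF pS] p(2) c(1) by simp
      moreover have "(\<Sum>b\<in>Basis. norm (fderiv (Hc f c) ?p b)) \<le> (\<Sum>b\<in>(Basis::'n set). 2 * L * Q)"
      proof (rule sum_mono)
        fix b :: 'n assume b: "b \<in> Basis"
        show "norm (fderiv (Hc f c) ?p b) \<le> 2 * L * Q"
          using im.DH_le(2)[OF p(1) Q, of b] b unfolding DH[OF p(1)] by simp
      qed
      ultimately have "displacement c f x \<le> L * Q + ?n * (2 * L * Q)" by (simp add: displacement_def)
      then show ?thesis by (simp add: C1_def algebra_simps)
    qed
    show ?thesis
    proof (intro conjI allI impI ballI)
      fix \<gamma> x y assume \<gamma>: "0 < \<gamma>" "\<gamma> < r" and xy: "x \<in> V" "y \<in> V"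
      let ?p = "chart_map c x" and ?q = "chart_map c y"
      note p = VB[OF xy(1)] and q = VB[OF xy(2)]
      define N where "N = displacement c f x"
      have N0: "0 \<le> N" unfolding N_def using f.displacement_ge(1)[OF c(1) p(2)] norm_ge_zero order_trans by blast
      have pS: "?p \<in> S" using p S by blast
      have 1: "norm (\<psi> (?p + h ?p) - \<psi> ?p) \<le> N"
        using f.displacement_ge(1)[OF c(1) p(2)] Hf[OF pS] p(2) c(1) by (simp add: N_def)
      have 2: "norm (im.DH ?p v) \<le> N * norm v" for v
        unfolding DH[OF p(1)] N_def by (rule f.displacement_ge(2)[OF c(1) p(2)])
      define Q where "Q = 2 * (a * N + 6 * (Cu * (CH * \<kappa>)) * \<gamma> + 324 * \<rho> / m * ((?n\<^sup>2 * LG * \<eta>) / \<gamma>))"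
      have aN: "0 \<le> a * N" "norm (h ?p) \<le> a * N" "norm (u ?p v) \<le> a * N * norm v" for v
        using im.displacement_le[OF p(1) 1 2, folded a_def] a0 N0 by simp_all
      have \<gamma>2: "2 * \<gamma> \<le> \<rho>" using \<gamma> r(3) by simp
      note bounds = almost_isometry_propagation[OF AI[unfolded B_def] h1[unfolded B_def] u1[unfolded B_def]
          \<gamma>(1) \<gamma>2 small p(1)[unfolded B_def] aN q(1)[unfolded B_def], folded Q_def]
      have "displacement c f y \<le> C1 * Q" by (rule disp[OF xy(2) bounds])
      also have "Q \<le> 2 * (a + 6 * (Cu * CH) + Q0) * (N + defect f \<gamma>)"
      proof -
        have d: "0 \<le> \<kappa> * \<gamma>" "0 \<le> \<eta> / \<gamma>" using \<kappa>0 \<eta>0 \<gamma> by auto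
        have "Q = 2 * (a * N + 6 * (Cu * CH) * (\<kappa> * \<gamma>) + Q0 * (\<eta> / \<gamma>))"
          by (simp add: Q_def Q0_def mult_ac)
        also have "\<dots> \<le> 2 * (a * (N + (\<kappa> * \<gamma> + \<eta> / \<gamma>)) + 6 * (Cu * CH) * (N + (\<kappa> * \<gamma> + \<eta> / \<gamma>)) + Q0 * (N + (\<kappa> * \<gamma> + \<eta> / \<gamma>)))"
          using a0 Cu0 CH0 Q0 N0 d by (intro mult_left_mono add_mono) auto
        finally show ?thesis by (simp add: defect_def \<kappa>_def \<eta>_def algebra_simps)
      qed
      then have "C1 * Q \<le> C1 * (2 * (a + 6 * (Cu * CH) + Q0)) * (N + defect f \<gamma>)"
        using C1 by (simp add: mult_left_mono mult.assoc)
      also have "\<dots> \<le> C * (N + defect f \<gamma>)"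
        using C3 N0 \<kappa>0 \<eta>0 \<gamma>(1) by (intro mult_right_mono) (auto simp: C_def defect_def \<kappa>_def \<eta>_def)
      finally show "displacement c f y \<le> C * (displacement c f x + defect f \<gamma>)" by (simp add: N_def)
    next
      fix x assume x: "x \<in> V" and fx: "f x = x"
      let ?p = "chart_map c x"
      note p = VB[OF x]
      have pB': "?p \<in> B'" using p BB' by blast
      define \<theta> where "\<theta> = tangent_defect f x"
      have \<theta>0: "0 \<le> \<theta>" using hs_norm_form_nonneg by (simp add: \<theta>_def hs_norm_endo_def)
      define Q where "Q = ?n\<^sup>2 * sqrt (LG / m) * \<theta>"
      have Q0': "0 \<le> Q" using \<theta>0 LG(1) m(1) by (simp add: Q_def)
      have "h ?p = 0" using fx p c by (simp add: h_def fh_def)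
      then have 1: "norm (h ?p) \<le> Q" using Q0' by simp
      have 2: "norm (u ?p v) \<le> Q * norm v" for v
      proof -
        have "sqrt (m * (norm (u ?p v))\<^sup>2) \<le> sqrt (?G ?p (u ?p v) (u ?p v))"
          by (rule real_sqrt_le_mono[OF m(2)[OF pB']])
        also have "\<dots> \<le> ?n\<^sup>2 * \<theta> * sqrt (?G ?p v v)"
          using f.fixed_point_bound[OF c(1) p(2) fx, of v] unfolding u_def fh_def \<theta>_def .
        also have "\<dots> \<le> ?n\<^sup>2 * \<theta> * sqrt (LG * (norm v)\<^sup>2)"
          using LG(2)[OF pB', of v v] \<theta>0
          by (intro mult_left_mono real_sqrt_le_mono) (auto simp: power2_eq_square mult.assoc)
        finally have "sqrt m * norm (u ?p v) \<le> ?n\<^sup>2 * \<theta> * (sqrt LG * norm v)"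
          by (simp add: real_sqrt_mult)
        then show ?thesis using m(1) by (simp add: Q_def real_sqrt_divide field_simps)
      qed
      have "displacement c f x \<le> C1 * Q" by (rule disp[OF x 1 2])
      also have "\<dots> = C1 * (?n\<^sup>2 * sqrt (LG / m)) * \<theta>" by (simp add: Q_def mult.assoc)
      also have "\<dots> \<le> C * \<theta>" using C2 \<theta>0 by (intro mult_right_mono) (auto simp: C_def)
      finally show "displacement c f x \<le> C * tangent_defect f x"
        by (simp add: \<theta>_def)
    qed
  qed
  have C: "0 < C" using C2 C3 by (simp add: C_def)
  show ?thesis
    by (rule exI[of _ V], rule exI[of _ C], rule exI[of _ r],
        intro conjI[OF V(1)] conjI[OF V(2)] conjI[OF V(3)] conjI[OF C] conjI[OF r(1)] allI impI)
      (rule main)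
qed

end

section \<open>From local to global\<close>

context embedded_manifold
begin

lemma displacement_nonneg: "0 \<le> displacement c f x"
  unfolding displacement_def by (simp add: sum_nonneg)

lemma defect_nonneg:
  assumes "Ck_self_map 2 M A f" "0 < \<gamma>" "M \<noteq> {}"
  shows "0 \<le> defect f \<gamma>"
proof -
  interpret f: embedded_manifold_map M A g F \<iota> f by unfold_locales (rule assms)
  obtain x where x: "x \<in> M" using assms(3) by blast
  have "0 \<le> C2_dist f" using f.H_le[OF x] norm_ge_zero order_trans by blast
  moreover have "0 \<le> metric_defect f"
    using f.hs_norm_le_field_norm[OF compact_M x] hs_norm_form_nonneg order_trans
    unfolding metric_defect_def by blast
  ultimately show ?thesis using assms(2) by (simp add: defect_def)
qed

text \<open>Only the single point \<open>x\<close> is concerned, so the constant may depend on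
  \<open>x\<close>; what matters is that it does not depend on \<open>f\<close>.\<close>

lemma displacement_chart_change:
  assumes c: "c \<in> A" "x \<in> chart_dom c" and d: "d \<in> A" "x \<in> chart_dom d"
  shows "\<exists>C>0. \<forall>f. Ck_self_map 2 M A f \<longrightarrow> displacement d f x \<le> C * displacement c f x"
proof -
  let ?t = "\<lambda>b. norm (fderiv (transition d c) (chart_map d x) b)"
  have "displacement d f x \<le> (1 + (\<Sum>b\<in>Basis. ?t b)) * displacement c f x" if f: "Ck_self_map 2 M A f" for f
  proof -
    interpret f: embedded_manifold_map M A g F \<iota> f by unfold_locales (rule f)
    have "norm (fderiv (Hc f d) (chart_map d x) b) \<le> ?t b * displacement c f x" for b
      using f.displacement_ge(2)[OF c, of "fderiv (transition d c) (chart_map d x) b"]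
      by (simp add: chart_change_derivative[OF d c f.H_differentiable[OF c]] mult.commute)
    then have "(\<Sum>b\<in>Basis. norm (fderiv (Hc f d) (chart_map d x) b)) \<le> (\<Sum>b\<in>Basis. ?t b) * displacement c f x"
      unfolding sum_distrib_right by (rule sum_mono)
    then show ?thesis using f.displacement_ge(1)[OF c] by (simp add: displacement_def[of d] distrib_right)
  qed
  moreover have "0 < 1 + (\<Sum>b\<in>Basis. ?t b)" by (intro add_pos_nonneg sum_nonneg) auto
  ultimately show ?thesis by blast
qed

definition some_chart :: "'m \<Rightarrow> ('m, 'n) chart" where
  "some_chart x = (SOME c. c \<in> A \<and> x \<in> chart_dom c)"

abbreviation disp :: "'m \<Rightarrow> ('m \<Rightarrow> 'm) \<Rightarrow> 'm \<Rightarrow> real" where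
  "disp a \<equiv> displacement (some_chart a)"

lemma some_chart: "x \<in> M \<Longrightarrow> some_chart x \<in> A" "x \<in> M \<Longrightarrow> x \<in> chart_dom (some_chart x)"
proof -
  assume "x \<in> M"
  then have "some_chart x \<in> A \<and> x \<in> chart_dom (some_chart x)"
    unfolding some_chart_def using chart_exists by (metis (mono_tags, lifting) someI_ex)
  then show "some_chart x \<in> A" "x \<in> chart_dom (some_chart x)" by auto
qed

text \<open>One radius limits both \<open>f\<close> and \<gamma>, so that finitely many estimates
  are combined by taking the minimum of their radii.\<close>

definition admissible :: "real \<Rightarrow> ('m \<Rightarrow> 'm) \<Rightarrow> real \<Rightarrow> bool" where
  "admissible r f \<gamma> \<longleftrightarrow> Ck_self_map 2 M A f \<and> C2_dist f < r \<and> 0 < \<gamma> \<and> \<gamma> < r"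

lemma admissible_mono: "admissible r f \<gamma> \<Longrightarrow> r \<le> r' \<Longrightarrow> admissible r' f \<gamma>"
  unfolding admissible_def by auto

definition estimate_on :: "'m \<Rightarrow> 'm set \<Rightarrow> real \<Rightarrow> real \<Rightarrow> bool" where
  "estimate_on a V C r \<longleftrightarrow> (\<forall>f \<gamma>. admissible r f \<gamma> \<longrightarrow>
     (\<forall>x\<in>V. \<forall>y\<in>V. disp a f y \<le> C * (disp a f x + defect f \<gamma>)) \<and>
     (\<forall>x\<in>V. f x = x \<longrightarrow> disp a f x \<le>
        C * tangent_defect f x))"

lemma estimate_on_exists:
  assumes "a \<in> M"
  shows "\<exists>V C r. open_in_M V \<and> a \<in> V \<and> V \<subseteq> chart_dom (some_chart a) \<and> 0 < C \<and> 0 < r \<and> estimate_on a V C r"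
proof -
  obtain V C r where V: "open_in_M V" "a \<in> V" "V \<subseteq> chart_dom (some_chart a)" "0 < C" "0 < r" and
    E: "\<forall>f. Ck_self_map 2 M A f \<longrightarrow> C2_dist f < r \<longrightarrow>
      (\<forall>\<gamma> x y. 0 < \<gamma> \<longrightarrow> \<gamma> < r \<longrightarrow> x \<in> V \<longrightarrow> y \<in> V \<longrightarrow>
         disp a f y \<le> C * (disp a f x + defect f \<gamma>)) \<and>
      (\<forall>x\<in>V. f x = x \<longrightarrow>
         disp a f x \<le> C * tangent_defect f x)"
    using local_estimate[OF some_chart[OF assms]] by (elim exE conjE) (rule that)
  have "estimate_on a V C r"
    unfolding estimate_on_def admissible_def
  proof (intro allI impI)
    fix f \<gamma> assume f: "Ck_self_map 2 M A f \<and> C2_dist f < r \<and> 0 < \<gamma> \<and> \<gamma> < r"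
    note Ef = E[THEN spec, THEN mp, THEN mp, OF conjunct1[OF f] conjunct1[OF conjunct2[OF f]]]
    show "(\<forall>x\<in>V. \<forall>y\<in>V. disp a f y \<le> C * (disp a f x + defect f \<gamma>)) \<and>
     (\<forall>x\<in>V. f x = x \<longrightarrow> disp a f x \<le>
        C * tangent_defect f x)"
      using conjunct1[OF Ef] f by (intro conjI[OF _ conjunct2[OF Ef]]) simp
  qed
  with V show ?thesis by blast
qed

lemma
  assumes "estimate_on a V C r" "admissible r f \<gamma>" "x \<in> V"
  shows estimate_onD: "y \<in> V \<Longrightarrow> disp a f y \<le> C * (disp a f x + defect f \<gamma>)"
    and estimate_on_fixed: "f x = x \<Longrightarrow> disp a f x \<le>
        C * tangent_defect f x"
  using assms unfolding estimate_on_def by simp_all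

text \<open>Each point is read in its own \<open>some_chart\<close>, and \<open>C\<close> and
  \<open>r\<close> may depend on the pair; uniformity over \<open>M\<close> is recovered afterwards
  from a finite subcover.\<close>

definition controls :: "'m \<Rightarrow> 'm \<Rightarrow> bool" where
  "controls x y \<longleftrightarrow> (\<exists>C r. 0 < C \<and> 0 < r \<and> (\<forall>f \<gamma>. admissible r f \<gamma> \<longrightarrow>
     disp y f y \<le> C * (disp x f x + defect f \<gamma>)))"

lemma controls_trans:
  assumes "controls x y" "controls y z" "M \<noteq> {}"
  shows "controls x z"
proof -
  obtain C r where 1: "0 < C" "0 < r" "\<And>f \<gamma>. admissible r f \<gamma> \<Longrightarrow>
     disp y f y \<le> C * (disp x f x + defect f \<gamma>)"
    using assms(1) unfolding controls_def by blast
  obtain C' r' where 2: "0 < C'" "0 < r'" "\<And>f \<gamma>. admissible r' f \<gamma> \<Longrightarrow>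
     disp z f z \<le> C' * (disp y f y + defect f \<gamma>)"
    using assms(2) unfolding controls_def by blast
  \<comment> \<open>The extra 1 absorbs the defect added by the second link.\<close>
  have "disp z f z \<le> C' * (C + 1) * (disp x f x + defect f \<gamma>)"
    if a: "admissible (min r r') f \<gamma>" for f \<gamma>
  proof -
    have d: "0 \<le> defect f \<gamma>" using a assms(3) by (auto simp: admissible_def intro: defect_nonneg)
    have "disp y f y + defect f \<gamma>
        \<le> C * (disp x f x + defect f \<gamma>) + (disp x f x + defect f \<gamma>)"
      using 1(3)[OF admissible_mono[OF a]] displacement_nonneg[of "some_chart x" f x] by simp
    then have "C' * (disp y f y + defect f \<gamma>)
        \<le> C' * ((C + 1) * (disp x f x + defect f \<gamma>))"
      using 2(1) by (intro mult_left_mono) (auto simp: algebra_simps)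
    then show ?thesis using 2(3)[OF admissible_mono[OF a]] by (simp add: mult.assoc)
  qed
  then show ?thesis
    unfolding controls_def using 1 2 by (intro exI[of _ "C' * (C + 1)"] exI[of _ "min r r'"]) auto
qed

text \<open>Both directions are required because connectedness is applied to a symmetric relation.
  The local estimate uses the chart at \<open>x0\<close> throughout, so a change of chart at
  \<open>x\<close> is inserted on either side.\<close>

lemma controls_locally:
  assumes x0: "x0 \<in> M"
  shows "\<exists>V. open_in_M V \<and> x0 \<in> V \<and> (\<forall>x\<in>V. controls x0 x \<and> controls x x0)"
proof -
  let ?c = "some_chart x0"
  note c = some_chart[OF x0]
  obtain V C r where V: "open_in_M V" "x0 \<in> V" "V \<subseteq> chart_dom ?c" and C: "0 < C" "0 < r" and
    E: "estimate_on x0 V C r"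
    using estimate_on_exists[OF x0] by blast
  note est = estimate_onD[OF E]
  have "controls x0 x \<and> controls x x0" if x: "x \<in> V" for x
  proof -
    have xM: "x \<in> M" using x V(1) openin_imp_subset by blast
    have xc: "x \<in> chart_dom ?c" using x V(3) by blast
    note d = some_chart[OF xM]
    obtain C1 where C1: "0 < C1" "\<And>f. Ck_self_map 2 M A f \<Longrightarrow> disp x f x \<le> C1 * displacement ?c f x"
      using displacement_chart_change[OF c(1) xc d] by blast
    obtain C2 where C2: "0 < C2" "\<And>f. Ck_self_map 2 M A f \<Longrightarrow> displacement ?c f x \<le> C2 * disp x f x"
      using displacement_chart_change[OF d c(1) xc] by blast
    have "disp x f x \<le> C1 * C * (displacement ?c f x0 + defect f \<gamma>)" if a: "admissible r f \<gamma>" for f \<gamma>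
    proof -
      have "disp x f x \<le> C1 * displacement ?c f x" using a C1(2) by (simp add: admissible_def)
      also have "\<dots> \<le> C1 * (C * (displacement ?c f x0 + defect f \<gamma>))"
        using est[OF a V(2) x] C1(1) by (intro mult_left_mono) auto
      finally show ?thesis by (simp add: mult.assoc)
    qed
    then have "controls x0 x" unfolding controls_def using C C1
      by (intro exI[of _ "C1 * C"] exI[of _ r]) auto
    moreover have "displacement ?c f x0 \<le> C * (C2 + 1) * (disp x f x + defect f \<gamma>)" if a: "admissible r f \<gamma>" for f \<gamma>
    proof -
      have f: "Ck_self_map 2 M A f" using a by (simp add: admissible_def)
      have d: "0 \<le> defect f \<gamma>" using a x0 by (auto simp: admissible_def intro: defect_nonneg)
      have "displacement ?c f x0 \<le> C * (displacement ?c f x + defect f \<gamma>)" by (rule est[OF a x V(2)])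
      also have "displacement ?c f x + defect f \<gamma> \<le> (C2 + 1) * (disp x f x + defect f \<gamma>)"
        using C2(2)[OF f] d displacement_nonneg[of "some_chart x" f x] mult_nonneg_nonneg[OF less_imp_le[OF C2(1)] d]
        by (simp add: distrib_left distrib_right)
      then have "C * (displacement ?c f x + defect f \<gamma>) \<le> C * ((C2 + 1) * (disp x f x + defect f \<gamma>))"
        using C(1) by (intro mult_left_mono) auto
      finally show ?thesis by (simp add: mult.assoc)
    qed
    then have "controls x x0" unfolding controls_def using C C2
      by (intro exI[of _ "C * (C2 + 1)"] exI[of _ r]) auto
    ultimately show ?thesis by blast
  qed
  then show ?thesis using V by blast
qed

lemma controls_all:
  assumes "x \<in> M" "y \<in> M"
  shows "controls x y"
proof -
  have "controls x y \<and> controls y x"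
  proof (rule connected_equivalence_relation[where R="\<lambda>x y. controls x y \<and> controls y x", OF connected_M assms])
    show "\<exists>T. open_in_M T \<and> a \<in> T \<and> (\<forall>x\<in>T. controls a x \<and> controls x a)" if "a \<in> M" for a
      by (rule controls_locally[OF that])
  qed (use controls_trans in blast)+
  then show ?thesis ..
qed

text \<open>The chain runs from the fixed point \<open>x\<close> to the centre \<open>a\<close> of
  its neighbourhood, from \<open>a\<close> to \<open>b\<close> by connectedness, and from
  \<open>b\<close> to \<open>y\<close>. A finite subcover leaves finitely many pairs of centres,
  hence uniform constants.\<close>

lemma global_estimate:
  assumes ne: "M \<noteq> {}"
  obtains r C where "0 < r" "r < 1" "0 < C"
    "\<And>f \<gamma> x y. admissible r f \<gamma> \<Longrightarrow> x \<in> M \<Longrightarrow> f x = x \<Longrightarrow> y \<in> M \<Longrightarrow>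
      norm (H f y) \<le> C * (tangent_defect f x + defect f \<gamma>)"
proof -
  define P1 where "P1 = (\<lambda>a V C r. open_in_M V \<and> a \<in> V \<and> V \<subseteq> chart_dom (some_chart a) \<and> 0 < C \<and> 0 < r \<and> estimate_on a V C r)"
  have "\<forall>a\<in>M. \<exists>V C r. P1 a V C r" unfolding P1_def using estimate_on_exists by blast
  then obtain V C r where P1: "\<And>a. a \<in> M \<Longrightarrow> P1 a (V a) (C a) (r a)" by metis
  have V: "\<And>a. a \<in> M \<Longrightarrow> open_in_M (V a)" "\<And>a. a \<in> M \<Longrightarrow> a \<in> V a"
      "\<And>a. a \<in> M \<Longrightarrow> V a \<subseteq> chart_dom (some_chart a)"
    and Cr: "\<And>a. a \<in> M \<Longrightarrow> 0 < C a" "\<And>a. a \<in> M \<Longrightarrow> 0 < r a"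
    and E: "\<And>a. a \<in> M \<Longrightarrow> estimate_on a (V a) (C a) (r a)"
    using P1 unfolding P1_def by blast+
  note est = estimate_onD[OF E] and fixp = estimate_on_fixed[OF E]
  have "(\<forall>U\<in>V ` M. open_in_M U) \<and> M \<subseteq> \<Union>(V ` M)" using V(1,2) by blast
  then obtain D where D: "D \<subseteq> V ` M" "finite D" "M \<subseteq> \<Union>D"
    using compact_M[unfolded compact_eq_openin_cover, THEN spec, of "V ` M"] by blast
  obtain P where P: "P \<subseteq> M" "finite P" "D = V ` P"
    using finite_subset_image[OF D(2,1)] by blast
  have P: "finite P" "P \<subseteq> M" "M \<subseteq> (\<Union>a\<in>P. V a)" using P D(3) by simp_all
  define P2 where "P2 = (\<lambda>ab C' r'. 0 < C' \<and> 0 < r' \<and> (\<forall>f \<gamma> x y. admissible r' f \<gamma> \<longrightarrow> x \<in> V (fst ab) \<longrightarrow> f x = x \<longrightarrow> y \<in> V (snd ab) \<longrightarrow>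
      norm (H f y) \<le> C' * (tangent_defect f x + defect f \<gamma>)))"
  have "\<forall>ab\<in>P \<times> P. \<exists>C' r'. P2 ab C' r'"
  proof
    fix ab assume "ab \<in> P \<times> P"
    then obtain a b where ab: "ab = (a, b)" "a \<in> M" "b \<in> M" using P(2) by auto
    obtain C1 r1 where C1: "0 < C1" "0 < r1" "\<And>f \<gamma>. admissible r1 f \<gamma> \<Longrightarrow>
       disp b f b \<le> C1 * (disp a f a + defect f \<gamma>)"
      using controls_all[OF ab(2,3)] unfolding controls_def by blast
    \<comment> \<open>Read from the inside: the fixed-point bound at \<open>x\<close>, then the
      links from \<open>x\<close> to \<open>a\<close>, from \<open>a\<close> to \<open>b\<close> and
      from \<open>b\<close> to \<open>y\<close>. Each added 1 absorbs the defect entering at the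
      next link.\<close>
    define C' where "C' = C b * (C1 * (C a * (C a + 1) + 1) + 1)"
    define r' where "r' = min r1 (min (r a) (r b))"
    note pos = C1(1) Cr(1)[OF ab(2)] Cr(1)[OF ab(3)]
    have "norm (H f y) \<le> C' * (tangent_defect f x + defect f \<gamma>)"
      if adm: "admissible r' f \<gamma>" and x: "x \<in> V a" "f x = x" and y: "y \<in> V b" for f \<gamma> x y
    proof -
      have adms: "admissible r1 f \<gamma>" "admissible (r a) f \<gamma>" "admissible (r b) f \<gamma>"
        using admissible_mono[OF adm] by (auto simp: r'_def)
      have f: "Ck_self_map 2 M A f" using adm by (simp add: admissible_def)
      interpret f: embedded_manifold_map M A g F \<iota> f by unfold_locales (rule f)
      define \<delta> \<theta> where "\<delta> = defect f \<gamma>" and "\<theta> = tangent_defect f x"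
      have nn: "0 \<le> \<delta>" "0 \<le> \<theta>"
        using adm ne hs_norm_form_nonneg
        by (auto simp: \<delta>_def \<theta>_def admissible_def hs_norm_endo_def intro!: defect_nonneg)
      have s1: "disp a f x \<le> C a * \<theta>"
        using fixp[OF ab(2) adms(2) x] by (simp add: \<theta>_def)
      have "disp a f a \<le> C a * (disp a f x + \<delta>)"
        unfolding \<delta>_def by (rule est[OF ab(2) adms(2) x(1) V(2)[OF ab(2)]])
      also have "\<dots> \<le> C a * ((C a + 1) * (\<theta> + \<delta>))"
      proof (rule mult_left_mono[OF _ less_imp_le[OF pos(2)]])
        have "0 \<le> C a * \<delta>" using nn pos by simp
        then show "disp a f x + \<delta> \<le> (C a + 1) * (\<theta> + \<delta>)"
          unfolding distrib_left distrib_right using s1 nn by linarith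
      qed
      finally have s2: "disp a f a \<le> C a * (C a + 1) * (\<theta> + \<delta>)" by (simp add: mult.assoc)
      have "disp b f b \<le> C1 * (disp a f a + \<delta>)"
        unfolding \<delta>_def by (rule C1(3)[OF adms(1)])
      also have "\<dots> \<le> C1 * ((C a * (C a + 1) + 1) * (\<theta> + \<delta>))"
        using s2 nn pos by (intro mult_left_mono) (auto simp: distrib_right)
      finally have s3: "disp b f b \<le> C1 * (C a * (C a + 1) + 1) * (\<theta> + \<delta>)" by (simp add: mult.assoc)
      have yc: "y \<in> chart_dom (some_chart b)" using y V(3)[OF ab(3)] by blast
      have "norm (H f y) \<le> disp b f y"
        by (rule f.displacement_ge(1)[OF some_chart(1)[OF ab(3)] yc])
      also have "\<dots> \<le> C b * (disp b f b + \<delta>)"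
        unfolding \<delta>_def by (rule est[OF ab(3) adms(3) V(2)[OF ab(3)] y])
      also have "\<dots> \<le> C b * ((C1 * (C a * (C a + 1) + 1) + 1) * (\<theta> + \<delta>))"
        using s3 nn pos by (intro mult_left_mono) (auto simp: distrib_right)
      finally show ?thesis by (simp add: C'_def \<theta>_def \<delta>_def mult.assoc)
    qed
    moreover have "0 < C'" using pos by (auto simp: C'_def intro!: mult_pos_pos add_pos_pos)
    moreover have "0 < r'" using C1(2) Cr(2)[OF ab(2)] Cr(2)[OF ab(3)] by (simp add: r'_def)
    ultimately have "P2 ab C' r'" unfolding P2_def ab(1) fst_conv snd_conv by blast
    then show "\<exists>C' r'. P2 ab C' r'" by blast
  qed
  then obtain C' r' where P2: "\<And>ab. ab \<in> P \<times> P \<Longrightarrow> P2 ab (C' ab) (r' ab)" by metis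
  have C': "\<And>ab. ab \<in> P \<times> P \<Longrightarrow> 0 < C' ab" "\<And>ab. ab \<in> P \<times> P \<Longrightarrow> 0 < r' ab"
    "\<And>ab f \<gamma> x y. ab \<in> P \<times> P \<Longrightarrow> admissible (r' ab) f \<gamma> \<Longrightarrow> x \<in> V (fst ab) \<Longrightarrow> f x = x \<Longrightarrow> y \<in> V (snd ab) \<Longrightarrow>
      norm (H f y) \<le> C' ab * (tangent_defect f x + defect f \<gamma>)"
    using P2 unfolding P2_def by blast+
  \<comment> \<open>The inserted \<open>1 / 2\<close> forces \<open>rr < 1\<close>.\<close>
  define rr where "rr = Min (insert (1 / 2) (r' ` (P \<times> P)))"
  define CC where "CC = 1 + (\<Sum>ab\<in>P \<times> P. C' ab)"
  have fin: "finite (P \<times> P)" using P(1) by simp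
  show ?thesis
  proof
    show "0 < rr" using fin C'(2) by (auto simp: rr_def)
    have "rr \<le> 1 / 2" unfolding rr_def using fin by (intro Min_le) auto
    then show "rr < 1" by simp
    show "0 < CC" unfolding CC_def using C'(1) by (intro add_pos_nonneg sum_nonneg) (auto simp: less_imp_le)
    fix f \<gamma> x y assume adm: "admissible rr f \<gamma>" and x: "x \<in> M" "f x = x" and y: "y \<in> M"
    obtain a b where ab: "a \<in> P" "x \<in> V a" "b \<in> P" "y \<in> V b" using P(3) x(1) y by blast
    then have abP: "(a, b) \<in> P \<times> P" by simp
    have "rr \<le> r' (a, b)" unfolding rr_def using fin abP by (intro Min_le) auto
    then have "norm (H f y) \<le> C' (a, b) * (tangent_defect f x + defect f \<gamma>)"
      using C'(3)[OF abP admissible_mono[OF adm], of x y] ab x by simp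
    also have "\<dots> \<le> CC * (tangent_defect f x + defect f \<gamma>)"
    proof (rule mult_right_mono)
      have "C' (a, b) \<le> (\<Sum>ab\<in>P \<times> P. C' ab)"
        using C'(1) fin abP by (intro member_le_sum) (auto simp: less_imp_le)
      then show "C' (a, b) \<le> CC" by (simp add: CC_def)
      show "0 \<le> tangent_defect f x + defect f \<gamma>"
        using adm ne hs_norm_form_nonneg
        by (auto simp: admissible_def hs_norm_endo_def intro!: add_nonneg_nonneg defect_nonneg)
    qed
    finally show "norm (H f y) \<le> CC * (tangent_defect f x + defect f \<gamma>)" .
  qed
qed

end

theorem theorem27:
  fixes M :: "'m::t2_space set"
    and A :: "('m, 'n::euclidean_space) chart set"
    and g :: "('m, 'n) form_field"
    and F :: "(('m, 'n) chart \<times> 'm set) set"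
    and \<iota> :: "'m \<Rightarrow> 'e::euclidean_space"
  assumes "closed_manifold M A"
    and "riemannian_metric M A g"
    and "smooth_embedding M A \<iota>"
    and "compact_chart_cover M A F"
  shows "\<exists>r C :: real. 0 < r \<and> r < 1 \<and> 0 < C \<and>
    (\<forall>f \<theta> \<eta> \<kappa>.
       f \<in> Diff 2 M A \<longrightarrow>
       (\<exists>x\<in>M. f x = x \<and> hs_norm_endo A g x (\<lambda>v c. differential A f x v c - v c) = \<theta> \<and> \<theta> < r) \<longrightarrow>
       field_norm M A g (\<lambda>x u v. pullback A f g x u v - g x u v) = \<eta> \<and> \<eta> < r \<longrightarrow>
       Ck_dist 2 F \<iota> f id = \<kappa> \<and> \<kappa> < r \<longrightarrow>
       (\<forall>\<gamma>. 0 < \<gamma> \<and> \<gamma> < r \<longrightarrow>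
          Ck_dist 0 F \<iota> f id \<le> C * (\<theta> + \<kappa> * \<gamma> + \<eta> * inverse \<gamma>)))"
proof -
  have M: "smooth_atlas M A" "compact M" "connected M"
    using assms(1) unfolding closed_manifold_def by blast+
  interpret embedded_manifold M A g F \<iota>
    by unfold_locales (fact M assms)+
  obtain r C where r: "0 < r" "r < 1" "0 < C" and
    est: "\<And>f \<gamma> x y. admissible r f \<gamma> \<Longrightarrow> x \<in> M \<Longrightarrow> f x = x \<Longrightarrow> y \<in> M \<Longrightarrow>
      norm (H f y) \<le> C * (hs_norm_endo A g x (\<lambda>v c. differential A f x v c - v c) + defect f \<gamma>)"
  proof (cases "M = {}")
    \<comment> \<open>The definitions admit an empty \<open>M\<close>. The estimate is then vacuous,
      since it concerns a fixed point in \<open>M\<close>, while \<open>global_estimate\<close>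
      needs a nonempty \<open>M\<close>.\<close>
    case True
    show ?thesis by (rule that[of "1 / 2" 1]) (use True in simp_all)
  next
    case False
    show ?thesis by (rule global_estimate[OF False]) (rule that)
  qed
  have bound: "Ck_dist 0 F \<iota> f id \<le> C * (hs_norm_endo A g x (\<lambda>v c. differential A f x v c - v c) +
      Ck_dist 2 F \<iota> f id * \<gamma> + field_norm M A g (\<lambda>x u v. pullback A f g x u v - g x u v) * inverse \<gamma>)"
    if "f \<in> Diff 2 M A" "x \<in> M" "f x = x" "Ck_dist 2 F \<iota> f id < r" "0 < \<gamma>" "\<gamma> < r" for f x \<gamma>
  proof -
    have "admissible r f \<gamma>" using that by (simp add: admissible_def Diff_def)
    from est[OF this that(2,3)] show ?thesis
      using that(2) by (intro Ck_dist_0_le) (auto simp add: defect_def metric_defect_def divide_inverse add.assoc)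
  qed
  show ?thesis
  proof (rule exI[of _ r], rule exI[of _ C], intro conjI[OF r(1)] conjI[OF r(2)] conjI[OF r(3)] allI impI)
    fix f \<theta> \<eta> \<kappa> \<gamma>
    assume f: "f \<in> Diff 2 M A"
      and \<theta>: "\<exists>x\<in>M. f x = x \<and> hs_norm_endo A g x (\<lambda>v c. differential A f x v c - v c) = \<theta> \<and> \<theta> < r"
      and \<eta>: "field_norm M A g (\<lambda>x u v. pullback A f g x u v - g x u v) = \<eta> \<and> \<eta> < r"
      and \<kappa>: "Ck_dist 2 F \<iota> f id = \<kappa> \<and> \<kappa> < r" and \<gamma>: "0 < \<gamma> \<and> \<gamma> < r"
    from \<theta> obtain x where x: "x \<in> M" "f x = x"
      "hs_norm_endo A g x (\<lambda>v c. differential A f x v c - v c) = \<theta>" by blast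
    have "Ck_dist 2 F \<iota> f id < r" using \<kappa> by simp
    from bound[OF f x(1,2) this conjunct1[OF \<gamma>] conjunct2[OF \<gamma>]]
    show "Ck_dist 0 F \<iota> f id \<le> C * (\<theta> + \<kappa> * \<gamma> + \<eta> * inverse \<gamma>)"
      unfolding x(3) conjunct1[OF \<eta>] conjunct1[OF \<kappa>] .
  qed
qed

end
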